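(* Let $\alpha_1,\alpha_2,\beta_1,\beta_2,\beta_3\in\mathbb{C}$ be constants and let $f(z)$ be a transcendental entire solution of the second order algebraic differential equation $$f''(z)f(z)-f'(z)^2+\alpha_1f'(z)f(z)+\alpha_2f(z)^2=\beta_1f(z)+\beta_2f'(z)+\beta_3 .$$ If $f(z)$ has finite order, then $\sigma(f)=1$ or $\sigma(f)=2$; and if $f(z)$ has infinite order, then $\varsigma(f)=1$.
   Context: For an entire function $f$, the order of growth is $\sigma(f)=\limsup_{|z|\to\infty}\frac{\log\log|f(z)|}{\log|z|}$, and, if $\sigma(f)=\infty$, the hyper-order is $\varsigma(f)=\limsup_{|z|\to\infty}\frac{\log\log\log|f(z)|}{\log|z|}$ (the limsup being taken over those $z$ for which the iterated logarithms are defined). *)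

theory Defs
  imports "HOL-Complex_Analysis.Complex_Analysis"
begin

definition transcendental_entire :: "(complex \<Rightarrow> complex) \<Rightarrow> bool" where
  "transcendental_entire f \<longleftrightarrow> f holomorphic_on UNIV \<and> \<not> (\<exists>p :: complex poly. f = poly p)"

text \<open>
  The upper limits are taken as \<open>z\<close> tends to infinity inside the set where the iterated real
  logarithm is defined: \<open>ln (ln r)\<close> needs \<open>r > 1\<close> and \<open>ln (ln (ln r))\<close> needs \<open>r > exp 1\<close>.
  Without this restriction the totalised \<open>ln\<close> would contribute arbitrary values.
\<close>

definition growth_order :: "(complex \<Rightarrow> complex) \<Rightarrow> ereal" where
  "growth_order f =
     Limsup (inf at_infinity (principal {z. norm (f z) > 1}))
       (\<lambda>z. ereal (ln (ln (norm (f z))) / ln (norm z)))"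

definition hyper_order :: "(complex \<Rightarrow> complex) \<Rightarrow> ereal" where
  "hyper_order f =
     Limsup (inf at_infinity (principal {z. norm (f z) > exp 1}))
       (\<lambda>z. ereal (ln (ln (ln (norm (f z)))) / ln (norm z)))"

end

theory Submission
  imports Defs "HOL-Real_Asymp.Real_Asymp" "HOL-Computational_Algebra.Fundamental_Theorem_Algebra"
begin

text \<open>
  With \<open>a1, a2, b1, b2, b3\<close> for the coefficients, write \<open>w = f'/f\<close> and \<open>v = 1/f\<close>; the equation becomes \<open>w' + a1 w + a2 = b1 v + b2 v w + b3 v\<^sup>2\<close>, so
  \<open>f\<close> behaves like \<open>exp (c exp (- a1 z))\<close> (times a linear exponential) where it is large. If \<open>a1 \<noteq> 0\<close>
  and there is one point at which \<open>f\<close> and \<open>w\<close> are both large, then following a suitable curve from that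
  point gives doubly exponential growth, hence infinite order and hyper-order at least 1; if there is no
  such point, then \<open>f\<close> has exponential type.

  The upper bounds come from the zeros of \<open>f\<close>, at which \<open>f'\<close> is a root \<open>\<gamma>\<close> of \<open>x\<^sup>2 + b2 x + b3\<close>. If only one
  root occurs, then \<open>q = (f' - \<gamma>)/f\<close> is entire. If two roots occur, or if there are double zeros, then
  \<open>h = (f'' - A f' - B)/f\<close> is entire for suitable constants. Near points where \<open>q\<close> or \<open>h\<close> is large and
  grows in a controlled way, \<open>1/f\<close> is exponentially small, and the differential equation
  of \<open>q\<close> or \<open>h\<close> reduces to a bound on \<open>q'\<close> or \<open>h'\<close>. It follows that \<open>q\<close> or \<open>h\<close> is \<open>O(exp (c |z|))\<close>, and a
  polynomial if \<open>a1 = 0\<close>, so that \<open>f\<close> solves a linear differential equation with known coefficients.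
\<close>

text \<open>Quantitative facts about an entire function are read off at maximum points of its
  modulus times a radial weight, where the logarithmic derivative is prescribed by the weight. If a
  growth bound on \<open>E\<close> fails, there is such a point with \<open>|E| = N ^ 8\<close>,
  with \<open>E\<close> under control on the disc of radius \<open>1 / N\<close> and
  \<open>|E'|\<close> bounded below; the differential equation has to contradict this lower bound.
  Smallness of \<open>1/f\<close> at that point has the following cause. On a disc of radius
  comparable to \<open>1 / N\<close>, \<open>f'/f\<close> is nearly constant, of size
  \<open>N ^ 8\<close> for \<open>q\<close> and \<open>N ^ 4\<close> for \<open>h\<close>, while
  \<open>1/f\<close> is at most a power of \<open>N\<close>. Walking to the boundary against the
  growth of \<open>f\<close> gains a factor \<open>exp (- c N ^ 7)\<close> or
  \<open>exp (- c N ^ 3)\<close>, which beats all powers. In the equation of \<open>h\<close> a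
  multiple of \<open>f'/f\<close> survives, so the growth tests must tolerate errors of size
  \<open>N ^ 4\<close>. Lower bounds on the order use weights of very small type: they yield points
  where \<open>f'/f\<close> is small but still large compared with \<open>1/f\<close>, which the
  equations exclude.\<close>

abbreviation entire :: "(complex \<Rightarrow> complex) \<Rightarrow> bool" where
  "entire f \<equiv> f holomorphic_on UNIV"

lemma entire_has_deriv:
  "entire f \<Longrightarrow> (f has_field_derivative deriv f z) (at z)"
  by (simp add: holomorphic_derivI)

lemma entire_deriv: "entire f \<Longrightarrow> entire (deriv f)"
  by (simp add: holomorphic_deriv)

lemma entire_isCont: "entire f \<Longrightarrow> isCont f z"
  by (meson DERIV_isCont entire_has_deriv)

lemma gronwall_real:
  fixes u \<phi> :: "real \<Rightarrow> real"
  assumes "a \<le> b"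
    and u: "\<And>t. a \<le> t \<Longrightarrow> t \<le> b \<Longrightarrow> (u has_real_derivative u' t) (at t)"
    and \<phi>: "\<And>t. a \<le> t \<Longrightarrow> t \<le> b \<Longrightarrow> (\<phi> has_real_derivative \<phi>' t) (at t)"
    and le: "\<And>t. a \<le> t \<Longrightarrow> t \<le> b \<Longrightarrow> u' t \<le> \<phi>' t * u t"
  shows "u b \<le> u a * exp (\<phi> b - \<phi> a)"
proof -
  have "u b * exp (- \<phi> b) \<le> u a * exp (- \<phi> a)"
  proof (rule DERIV_nonpos_imp_nonincreasing[OF \<open>a \<le> b\<close>])
    fix t assume t: "a \<le> t" "t \<le> b"
    have "((\<lambda>t. u t * exp (- \<phi> t)) has_real_derivative (u' t - \<phi>' t * u t) * exp (- \<phi> t)) (at t)"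
      by (auto intro!: derivative_eq_intros u[OF t] \<phi>[OF t] simp: algebra_simps)
    moreover have "(u' t - \<phi>' t * u t) * exp (- \<phi> t) \<le> 0"
      using le[OF t] by (simp add: mult_le_0_iff)
    ultimately show "\<exists>y. ((\<lambda>t. u t * exp (- \<phi> t)) has_real_derivative y) (at t) \<and> y \<le> 0"
      by blast
  qed
  then have "u b * exp (- \<phi> b) * exp (\<phi> b) \<le> u a * exp (- \<phi> a) * exp (\<phi> b)"
    by (intro mult_right_mono) auto
  then show ?thesis by (simp add: mult.assoc flip: exp_add)
qed

lemma norm_sq_has_deriv:
  fixes x :: "real \<Rightarrow> complex"
  assumes "(x has_vector_derivative x') (at t)"
  shows "((\<lambda>t. (norm (x t))\<^sup>2) has_real_derivative 2 * Re (cnj (x t) * x')) (at t)"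
proof -
  have "((\<lambda>t. x t \<bullet> x t) has_vector_derivative (x t \<bullet> x' + x' \<bullet> x t)) (at t)"
    using assms bounded_bilinear.has_vector_derivative[OF bounded_bilinear_inner] by blast
  then show ?thesis
    by (simp add: has_real_derivative_iff_has_vector_derivative power2_norm_eq_inner
        inner_complex_def algebra_simps)
qed

subsection \<open>Growth bounds and order\<close>

lemma eventually_norm_gt: "\<forall>\<^sub>F z in at_infinity. norm (z::complex) > r"
  using filterlim_norm_at_top filterlim_at_top_dense by blast

lemma eventually_at_infinityI_real:
  assumes "\<forall>\<^sub>F r in at_top. P (r::real)"
  shows "\<forall>\<^sub>F z in at_infinity. P (norm (z::complex))"
  using filterlim_norm_at_top[where 'a = complex] assms by (auto simp: filterlim_iff)

lemma growth_order_le: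
  assumes ev: "\<forall>\<^sub>F z in at_infinity. norm (f z) \<le> exp (C * norm z ^ k)"
  shows "growth_order f \<le> ereal (real k)"
  unfolding growth_order_def Limsup_le_iff
proof (intro allI impI)
  fix y assume y: "ereal (real k) < y"
  \<comment> \<open>\<open>C\<close> may be nonpositive; replacing it by a number that is at least 1
    makes its logarithm meaningful.\<close>
  define D where "D = max C 1"
  have "D \<ge> 1" "C \<le> D" by (auto simp: D_def)
  obtain y' where y': "real k < y'" "ereal y' < y"
    using ereal_dense2[OF y] by auto
  have "((\<lambda>r::real. real k + ln D / ln r) \<longlongrightarrow> real k) at_top"
    by real_asymp
  then have "\<forall>\<^sub>F r in at_top. real k + ln D / ln r < y'"
    using y'(1) by (auto simp: order_tendsto_iff)
  then have "\<forall>\<^sub>F z in at_infinity. real k + ln D / ln (norm (z::complex)) < y'"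
    by (rule eventually_at_infinityI_real)
  with ev eventually_norm_gt[of 1]
  show "\<forall>\<^sub>F x in inf at_infinity (principal {z. 1 < norm (f z)}).
          ereal (ln (ln (norm (f x))) / ln (norm x)) < y"
    unfolding eventually_inf_principal
  proof eventually_elim
    case (elim z)
    show ?case
    proof
      assume "z \<in> {z. 1 < norm (f z)}"
      then have f1: "norm (f z) > 1" by simp
      have "ln (norm (f z)) \<le> C * norm z ^ k"
        using f1 elim(1) by (metis exp_gt_zero less_trans ln_exp ln_le_cancel_iff zero_less_one)
      also have "\<dots> \<le> D * norm z ^ k" using \<open>C \<le> D\<close> by (simp add: mult_right_mono)
      finally have "ln (ln (norm (f z))) \<le> ln (D * norm z ^ k)"
        using f1 by (intro ln_mono ln_gt_zero)
      also have "\<dots> = ln D + real k * ln (norm z)"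
        using elim \<open>D \<ge> 1\<close> by (subst ln_mult) (auto simp: ln_realpow)
      finally have "ln (ln (norm (f z))) / ln (norm z) \<le> (ln D + real k * ln (norm z)) / ln (norm z)"
        using elim by (intro divide_right_mono) auto
      also have "\<dots> = real k + ln D / ln (norm z)"
        using elim(2) ln_gt_zero[of "norm z"] by (simp add: add_divide_distrib)
      finally have "ln (ln (norm (f z))) / ln (norm z) < y'" using elim by linarith
      then show "ereal (ln (ln (norm (f z))) / ln (norm z)) < y"
        using y'(2) by (meson ereal_less_eq(3) le_less_trans less_imp_le)
    qed
  qed
qed

lemma hyper_order_le:
  assumes ev: "\<forall>\<^sub>F z in at_infinity. norm (f z) \<le> exp (exp (C * norm z))"
  shows "hyper_order f \<le> 1"
  unfolding hyper_order_def Limsup_le_iff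
proof (intro allI impI)
  fix y assume y: "(1::ereal) < y"
  define D where "D = max C 1"
  have "D \<ge> 1" "C \<le> D" by (auto simp: D_def)
  obtain y' where y': "1 < y'" "ereal y' < y"
    using ereal_dense2[OF y] by (auto simp: one_ereal_def)
  have "((\<lambda>r::real. 1 + ln D / ln r) \<longlongrightarrow> 1) at_top"
    by real_asymp
  then have "\<forall>\<^sub>F r in at_top. 1 + ln D / ln r < y'"
    using y'(1) by (auto simp: order_tendsto_iff)
  then have "\<forall>\<^sub>F z in at_infinity. 1 + ln D / ln (norm (z::complex)) < y'"
    by (rule eventually_at_infinityI_real)
  with ev eventually_norm_gt[of 1]
  show "\<forall>\<^sub>F x in inf at_infinity (principal {z. exp 1 < norm (f z)}).
          ereal (ln (ln (ln (norm (f x)))) / ln (norm x)) < y"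
    unfolding eventually_inf_principal
  proof eventually_elim
    case (elim z)
    show ?case
    proof
      assume "z \<in> {z. exp 1 < norm (f z)}"
      then have f1: "norm (f z) > exp 1" by simp
      have pos: "norm (f z) > 0" using f1 by (meson exp_gt_zero less_trans)
      have ln1: "ln (norm (f z)) > 1"
        using f1 pos by (metis exp_gt_zero ln_exp ln_less_cancel_iff)
      have "ln (norm (f z)) \<le> exp (C * norm z)"
        using pos elim(1) by (metis exp_gt_zero ln_exp ln_le_cancel_iff)
      then have "ln (ln (norm (f z))) \<le> C * norm z"
        using ln1 by (metis exp_gt_zero ln_exp ln_le_cancel_iff less_trans zero_less_one)
      also have "\<dots> \<le> D * norm z" using \<open>C \<le> D\<close> by (simp add: mult_right_mono)
      finally have "ln (ln (ln (norm (f z)))) \<le> ln (D * norm z)"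
        using ln1 by (intro ln_mono) auto
      also have "\<dots> = ln D + ln (norm z)"
        using elim \<open>D \<ge> 1\<close> by (subst ln_mult) auto
      finally have "ln (ln (ln (norm (f z)))) / ln (norm z) \<le> (ln D + ln (norm z)) / ln (norm z)"
        using elim by (intro divide_right_mono) auto
      also have "\<dots> = 1 + ln D / ln (norm z)"
        using elim(2) ln_gt_zero[of "norm z"] by (simp add: add_divide_distrib)
      finally have "ln (ln (ln (norm (f z)))) / ln (norm z) < y'" using elim by linarith
      then show "ereal (ln (ln (ln (norm (f z)))) / ln (norm z)) < y"
        using y'(2) by (meson ereal_less_eq(3) le_less_trans less_imp_le)
    qed
  qed
qed

lemma le_Limsup_frequently:
  fixes X :: "'a \<Rightarrow> ereal"
  assumes "\<And>y. ereal y < C \<Longrightarrow> \<exists>\<^sub>F x in F. ereal y \<le> X x"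
  shows "C \<le> Limsup F X"
proof (rule ccontr)
  assume "\<not> C \<le> Limsup F X"
  then obtain y where y: "Limsup F X < ereal y" "ereal y < C"
    using ereal_dense2[of "Limsup F X" C] by (meson not_le)
  from Limsup_lessD[OF y(1)] have "\<forall>\<^sub>F x in F. \<not> (ereal y \<le> X x)"
    by (simp add: not_le)
  with assms[OF y(2)] show False by (simp add: frequently_def)
qed

text \<open>At the given points \<open>ln (ln |f z|)\<close> is at least \<open>c |z|\<close>.
  Divided by \<open>ln |z|\<close> this is unbounded; after one more logarithm the quotient tends to
  1.\<close>

lemma
  assumes fr: "\<And>R. \<exists>z. norm z \<ge> R \<and> norm (f z) \<ge> exp (exp (c * norm z))" and c: "c > 0"
  shows hyper_order_ge: "hyper_order f \<ge> 1"
    and growth_order_eq_top: "growth_order f = \<infinity>"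
proof -
  have key: "\<exists>z. norm (f z) \<ge> exp (exp (c * norm z)) \<and> P (norm z)"
    if "\<forall>\<^sub>F r in at_top. P (r::real)" for P
    using that fr unfolding eventually_at_top_linorder by meson
  have main: "\<exists>\<^sub>F z in inf at_infinity (principal A). Q z"
    if ev: "\<forall>\<^sub>F r in at_top. \<forall>z. norm z = r \<longrightarrow> norm (f z) \<ge> exp (exp (c * norm z)) \<longrightarrow> z \<in> A \<and> Q z"
    for A Q
    unfolding frequently_def eventually_inf_principal
  proof
    assume "\<forall>\<^sub>F z in at_infinity. z \<in> A \<longrightarrow> \<not> Q z"
    then obtain b where b: "\<And>z. norm z \<ge> b \<Longrightarrow> z \<in> A \<longrightarrow> \<not> Q z"
      unfolding eventually_at_infinity by auto
    from eventually_conj[OF ev eventually_ge_at_top[of b]] key obtain z where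
      "norm (f z) \<ge> exp (exp (c * norm z))" "norm z \<ge> b"
      "\<forall>z'. norm z' = norm z \<longrightarrow> norm (f z') \<ge> exp (exp (c * norm z')) \<longrightarrow> z' \<in> A \<and> Q z'"
      by blast
    with b show False by blast
  qed
  have lns: "ln (norm (f z)) \<ge> exp (c * norm z)" "ln (ln (norm (f z))) \<ge> c * norm z"
    if "norm (f z) \<ge> exp (exp (c * norm z))" for z
  proof -
    show 1: "ln (norm (f z)) \<ge> exp (c * norm z)"
      using that by (metis exp_gt_zero less_le_trans ln_exp ln_le_cancel_iff)
    then show "ln (ln (norm (f z))) \<ge> c * norm z"
      by (metis exp_gt_zero less_le_trans ln_exp ln_le_cancel_iff)
  qed
  show "hyper_order f \<ge> 1"
    unfolding hyper_order_def
  proof (rule le_Limsup_frequently)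
    fix y assume y: "ereal y < 1"
    then have y1: "y < 1" by (simp add: one_ereal_def)
    have "((\<lambda>r::real. ln (c * r) / ln r) \<longlongrightarrow> 1) at_top"
      using c by real_asymp
    then have "\<forall>\<^sub>F r in at_top. ln (c * r) / ln r > y"
      using y1 by (auto simp: order_tendsto_iff)
    with eventually_gt_at_top[of "max 1 (1/c)"]
    have "\<forall>\<^sub>F r in at_top. \<forall>z. norm z = r \<longrightarrow> norm (f z) \<ge> exp (exp (c * norm z)) \<longrightarrow>
        z \<in> {z. exp 1 < norm (f z)} \<and> ereal y \<le> ereal (ln (ln (ln (norm (f z)))) / ln (norm z))"
    proof eventually_elim
      case (elim r)
      show ?case
      proof (intro allI impI)
        fix z assume z: "norm z = r" "norm (f z) \<ge> exp (exp (c * norm z))"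
        have cr: "c * r > 1" using elim c by (simp add: field_simps)
        have "exp 1 < exp (exp (c * r))"
          using cr by (simp add: less_trans)
        then have "exp 1 < norm (f z)" using z by (metis less_le_trans)
        moreover have "ln (ln (ln (norm (f z)))) \<ge> ln (c * r)"
          using lns(2)[OF z(2)] cr z(1) by (simp add: ln_mono)
        then have "ln (ln (ln (norm (f z)))) / ln (norm z) \<ge> ln (c * r) / ln r"
          using z(1) elim by (simp add: divide_right_mono)
        ultimately show "z \<in> {z. exp 1 < norm (f z)} \<and>
            ereal y \<le> ereal (ln (ln (ln (norm (f z)))) / ln (norm z))"
          using elim by auto
      qed
    qed
    then show "\<exists>\<^sub>F z in inf at_infinity (principal {z. exp 1 < norm (f z)}).
        ereal y \<le> ereal (ln (ln (ln (norm (f z)))) / ln (norm z))"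
      by (rule main)
  qed
  have "\<infinity> \<le> growth_order f"
    unfolding growth_order_def
  proof (rule le_Limsup_frequently)
    fix y assume y: "ereal y < \<infinity>"
    have "LIM r at_top. c * r / ln r :> at_top"
      using c by real_asymp
    then have "\<forall>\<^sub>F r in at_top. c * r / ln r \<ge> y"
      by (simp add: filterlim_at_top)
    with eventually_gt_at_top[of 1]
    have "\<forall>\<^sub>F r in at_top. \<forall>z. norm z = r \<longrightarrow> norm (f z) \<ge> exp (exp (c * norm z)) \<longrightarrow>
        z \<in> {z. 1 < norm (f z)} \<and> ereal y \<le> ereal (ln (ln (norm (f z))) / ln (norm z))"
    proof eventually_elim
      case (elim r)
      show ?case
      proof (intro allI impI)
        fix z assume z: "norm z = r" "norm (f z) \<ge> exp (exp (c * norm z))"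
        have "1 < exp (exp (c * r))" by simp
        then have "1 < norm (f z)" using z by (meson less_le_trans one_less_exp_iff exp_gt_zero)
        moreover have "ln (ln (norm (f z))) / ln (norm z) \<ge> c * r / ln r"
          using lns(2)[OF z(2)] z(1) elim by (simp add: divide_right_mono)
        ultimately show "z \<in> {z. 1 < norm (f z)} \<and>
            ereal y \<le> ereal (ln (ln (norm (f z))) / ln (norm z))"
          using elim by auto
      qed
    qed
    then show "\<exists>\<^sub>F z in inf at_infinity (principal {z. 1 < norm (f z)}).
        ereal y \<le> ereal (ln (ln (norm (f z))) / ln (norm z))"
      by (rule main)
  qed
  then show "growth_order f = \<infinity>" by simp
qed

lemma growth_order_less_imp_bound:
  assumes lt: "growth_order f < ereal (real k)"
  obtains \<rho> where "\<rho> < real k" "\<forall>\<^sub>F z in at_infinity. norm (f z) \<le> exp (norm z powr \<rho>)"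
proof -
  obtain \<rho> where \<rho>: "growth_order f < ereal \<rho>" "\<rho> < real k"
    using ereal_dense2[OF lt] by auto
  from Limsup_lessD[OF \<rho>(1)[unfolded growth_order_def]]
  have "\<forall>\<^sub>F z in at_infinity. norm (f z) > 1 \<longrightarrow> ln (ln (norm (f z))) / ln (norm z) < \<rho>"
    by (simp add: eventually_inf_principal)
  with eventually_norm_gt[of 1]
  have "\<forall>\<^sub>F z in at_infinity. norm (f z) \<le> exp (norm z powr \<rho>)"
  proof eventually_elim
    case (elim z)
    show ?case
    proof (cases "norm (f z) > 1")
      case True
      then have "ln (ln (norm (f z))) < \<rho> * ln (norm z)"
        using elim ln_gt_zero[of "norm z"] by (simp add: pos_divide_less_eq)
      then have "exp (ln (ln (norm (f z)))) < exp (\<rho> * ln (norm z))" by simp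
      then have "ln (norm (f z)) < norm z powr \<rho>"
        using True elim ln_gt_zero[OF True] by (auto simp: powr_def simp del: exp_less_cancel_iff)
      then have "exp (ln (norm (f z))) < exp (norm z powr \<rho>)" by (simp only: exp_less_cancel_iff)
      then show ?thesis
        using True by (metis exp_ln less_imp_le less_trans zero_less_one)
    next
      case False
      moreover have "1 \<le> exp (norm z powr \<rho>)" by simp
      ultimately show ?thesis by linarith
    qed
  qed
  with \<rho>(2) show ?thesis using that by blast
qed

lemma entire_poly_bound:
  assumes "entire E" "\<And>z. A \<le> norm z \<Longrightarrow> norm (E z) \<le> B * norm z ^ n"
  shows "\<exists>p. E = poly p"
proof -
  have "E z = poly (\<Sum>k\<le>n. monom ((deriv ^^ k) E 0 / fact k) k) z" for z
    using Liouville_polynomial[OF assms(1), of A B n z] assms(2)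
    by (simp add: poly_sum poly_monom)
  then show ?thesis by blast
qed

subsection \<open>Points of controlled growth\<close>

text \<open>At a local maximum of \<open>ln |f z| - g (|z|^2)\<close> the complex derivative
  \<open>f' / (2 f) - g' cnj z\<close> of this real function vanishes.\<close>

lemma weighted_max_deriv:
  fixes g :: "real \<Rightarrow> real"
  assumes f: "entire f"
    and g: "(g has_real_derivative g') (at ((norm z0)\<^sup>2))"
    and nz: "f z0 \<noteq> 0" and d: "d > 0"
    and max: "\<And>z. dist z z0 < d \<Longrightarrow>
      norm (f z) * exp (- g ((norm z)\<^sup>2)) \<le> norm (f z0) * exp (- g ((norm z0)\<^sup>2))"
  shows "deriv f z0 = of_real (2 * g') * cnj z0 * f z0"
proof -
  \<comment> \<open>Up to a positive factor the derivative of \<open>U\<close> at 0 is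
    \<open>2 * Re (A * u)\<close>. The direction \<open>u = cnj A\<close> turns this into
    \<open>2 * |A|^2\<close>, so one direction is enough to conclude \<open>A = 0\<close>.\<close>
  define A where "A = cnj (f z0) * deriv f z0 - of_real (2 * g') * cnj z0 * of_real ((norm (f z0))\<^sup>2)"
  define u where "u = cnj A"
  define U where "U = (\<lambda>t. (norm (f (z0 + of_real t * u)))\<^sup>2 * exp (- 2 * g ((norm (z0 + of_real t * u))\<^sup>2)))"
  have line: "((\<lambda>t. z0 + of_real t * u) has_vector_derivative u) (at 0)"
    by (auto intro!: derivative_eq_intros simp: has_vector_derivative_def scaleR_conv_of_real)
  have "((\<lambda>t. f (z0 + of_real t * u)) has_vector_derivative u * deriv f z0) (at 0)"
    using field_vector_diff_chain_at[OF line, of f "deriv f z0"] entire_has_deriv[OF f]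
    by (simp add: o_def)
  from norm_sq_has_deriv[OF this]
  have n1: "((\<lambda>t. (norm (f (z0 + of_real t * u)))\<^sup>2) has_real_derivative 2 * Re (cnj (f z0) * (u * deriv f z0))) (at 0)"
    by simp
  have n2: "((\<lambda>t. (norm (z0 + of_real t * u))\<^sup>2) has_real_derivative 2 * Re (cnj z0 * u)) (at 0)"
    using norm_sq_has_deriv[OF line] by simp
  have n3: "((\<lambda>t. g ((norm (z0 + of_real t * u))\<^sup>2)) has_real_derivative g' * (2 * Re (cnj z0 * u))) (at 0)"
    using DERIV_chain2[OF _ n2, of g g'] g by simp
  have "(U has_real_derivative
      (2 * Re (cnj (f z0) * (u * deriv f z0)) - 4 * g' * Re (cnj z0 * u) * (norm (f z0))\<^sup>2) * exp (- 2 * g ((norm z0)\<^sup>2))) (at 0)"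
    unfolding U_def
    by (rule derivative_eq_intros n1 n3 refl)+ (simp add: algebra_simps)
  moreover have "U y \<le> U 0" if "\<bar>0 - y\<bar> < d / (norm u + 1)" for y
  proof -
    have "\<bar>y\<bar> * norm u \<le> \<bar>y\<bar> * (norm u + 1)" by (simp add: mult_left_mono)
    also have "\<dots> < d" using that by (simp add: pos_less_divide_eq add_nonneg_pos)
    finally have "norm (f (z0 + of_real y * u)) * exp (- g ((norm (z0 + of_real y * u))\<^sup>2)) \<le> norm (f z0) * exp (- g ((norm z0)\<^sup>2))"
      by (intro max) (simp add: dist_norm norm_mult)
    then have "(norm (f (z0 + of_real y * u)) * exp (- g ((norm (z0 + of_real y * u))\<^sup>2)))\<^sup>2 \<le> (norm (f z0) * exp (- g ((norm z0)\<^sup>2)))\<^sup>2"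
      by (rule power_mono) simp
    then show ?thesis
      by (simp add: U_def power_mult_distrib flip: exp_double)
  qed
  ultimately have "(2 * Re (cnj (f z0) * (u * deriv f z0)) - 4 * g' * Re (cnj z0 * u) * (norm (f z0))\<^sup>2) * exp (- 2 * g ((norm z0)\<^sup>2)) = 0"
    using d by (intro DERIV_local_max[where d = "d / (norm u + 1)"]) (auto intro!: divide_pos_pos add_nonneg_pos)
  then have "2 * Re (cnj (f z0) * (u * deriv f z0)) - 4 * g' * Re (cnj z0 * u) * (norm (f z0))\<^sup>2 = 0"
    by simp
  moreover have "2 * Re (cnj (f z0) * (u * deriv f z0)) - 4 * g' * Re (cnj z0 * u) * (norm (f z0))\<^sup>2 = 2 * Re (A * u)"
    by (simp add: A_def algebra_simps)
  ultimately have "Re (A * cnj A) = 0" unfolding u_def by linarith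
  then have "(norm A)\<^sup>2 = 0" by (simp only: Re_complex_of_real flip: complex_norm_square)
  then have "A = 0" by simp
  then have "cnj (f z0) * deriv f z0 = of_real (2 * g') * cnj z0 * (f z0 * cnj (f z0))"
    by (simp only: A_def complex_norm_square right_minus_eq)
  then have "cnj (f z0) * (deriv f z0 - of_real (2 * g') * cnj z0 * f z0) = 0"
    by (simp add: algebra_simps)
  with nz show ?thesis by simp
qed

text \<open>
  \<open>z0\<close> maximises \<open>|E z| exp (- g (|z|\<^sup>2)) (1 - |z|\<^sup>2/R\<^sup>2) ^ 8\<close> on a disc of large radius \<open>R\<close>. The last factor
  keeps the maximum in the interior, and its exponent is the reason for measuring \<open>|E z0|\<close> as \<open>N ^ 8\<close>: the
  factor is at least \<open>N ^ -8\<close> at \<open>z0\<close>, hence of constant order on the disc of radius \<open>1/N\<close> around \<open>z0\<close>.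
\<close>

lemma growth_point:
  fixes g g' :: "real \<Rightarrow> real"
  assumes E: "entire E"
    and g: "\<And>x. x \<ge> 0 \<Longrightarrow> (g has_real_derivative g' x) (at x)"
    and g_nonneg: "\<And>x. x \<ge> 0 \<Longrightarrow> g x \<ge> 0" and g'_nonneg: "\<And>x. x \<ge> 0 \<Longrightarrow> g' x \<ge> 0"
    and lip: "\<And>z y :: complex. g ((norm z)\<^sup>2) \<le> g ((norm y)\<^sup>2) + s * norm (z - y)" and s: "s \<ge> 0"
    and unb: "\<And>K. \<exists>z. norm (E z) > K * exp (g ((norm z)\<^sup>2))"
  obtains z0 N where "N \<ge> M" "N \<ge> 1" "norm z0 \<ge> 1" "norm (E z0) = N ^ 8"
    "\<And>z. z \<in> cball z0 (1 / N) \<Longrightarrow> norm (E z) \<le> 2 ^ 8 * exp s * N ^ 8"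
    "2 * g' ((norm z0)\<^sup>2) * norm z0 * N ^ 8 \<le> norm (deriv E z0)"
    "exp (g ((norm z0)\<^sup>2)) \<le> N ^ 8"
proof -
  have contE: "continuous_on S E" for S
    using E holomorphic_on_imp_continuous_on continuous_on_subset by blast
  obtain B where B: "B > 0" "\<And>z. norm z \<le> 1 \<Longrightarrow> norm (E z) \<le> B"
    using compact_imp_bounded[OF compact_continuous_image[OF contE compact_cball[of "0::complex" 1]]]
    unfolding bounded_pos by auto
  define M' where "M' = max M 1"
  \<comment> \<open>The factor \<open>2 ^ 8\<close> pays for the cutoff at \<open>z1\<close>, where
    \<open>T z1\<close> is at least 1/2. Of the remaining surplus at the maximum,
    \<open>M' ^ 8\<close> yields \<open>N >= M\<close>, and \<open>B\<close>, a bound on the unit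
    disc, forces \<open>norm z0 >= 1\<close>.\<close>
  define K where "K = 2 ^ 8 * (M' ^ 8 + B)"
  have M': "M' \<ge> 1" "M' \<ge> M" by (auto simp: M'_def)
  then have M8: "M' ^ 8 \<ge> 1" by simp
  obtain z1 where z1: "norm (E z1) > K * exp (g ((norm z1)\<^sup>2))"
    using unb by blast
  define R where "R = 2 * norm z1 + 5"
  have R: "R \<ge> 5" "norm z1 \<le> R / 2" by (auto simp: R_def)
  define T where "T = (\<lambda>z::complex. 1 - (norm z)\<^sup>2 / R\<^sup>2)"
  define P where "P = (\<lambda>z. norm (E z) * exp (- g ((norm z)\<^sup>2)) * T z ^ 8)"
  have contg: "continuous_on {0..} g"
    using g by (meson DERIV_isCont atLeast_iff continuous_at_imp_continuous_on)
  have "continuous_on (cball 0 R) (\<lambda>z::complex. g ((norm z)\<^sup>2))"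
    by (rule continuous_on_compose2[OF contg]) (auto intro!: continuous_intros)
  then have "continuous_on (cball 0 R) P"
    unfolding P_def T_def using R by (intro continuous_intros contE) auto
  then obtain z0 where z0: "z0 \<in> cball 0 R" "\<And>z. z \<in> cball 0 R \<Longrightarrow> P z \<le> P z0"
    using continuous_attains_sup[OF compact_cball, of 0 R P] R by auto
  have "(norm z1)\<^sup>2 \<le> (R / 2)\<^sup>2" using R by (intro power_mono) auto
  then have "(norm z1)\<^sup>2 * 4 \<le> R\<^sup>2" by (simp add: power_divide)
  then have "2 * (norm z1)\<^sup>2 \<le> R\<^sup>2" using zero_le_power2[of "norm z1"] by linarith
  then have T1: "T z1 \<ge> 1 / 2" using R by (simp add: T_def field_simps)
  have "M' ^ 8 + B = K * (1 / 2) ^ 8" by (simp add: K_def power_one_over)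
  also have "\<dots> \<le> norm (E z1) * exp (- g ((norm z1)\<^sup>2)) * T z1 ^ 8"
  proof (rule mult_mono)
    show "K \<le> norm (E z1) * exp (- g ((norm z1)\<^sup>2))"
      using z1 by (simp add: exp_minus field_simps)
    show "(1 / 2) ^ 8 \<le> T z1 ^ 8" by (rule power_mono[OF T1]) simp
  qed auto
  also have "\<dots> = P z1" by (simp add: P_def)
  also have "\<dots> \<le> P z0" using R by (intro z0) auto
  finally have P0: "M' ^ 8 + B \<le> P z0" .
  define \<tau> where "\<tau> = T z0"
  have "(norm z0)\<^sup>2 \<le> R\<^sup>2" using z0(1) by (intro power_mono) auto
  then have "\<tau> \<ge> 0" "\<tau> \<le> 1" using R by (auto simp: \<tau>_def T_def field_simps)
  moreover have "\<tau> \<noteq> 0" using P0 B M8 by (auto simp: P_def \<tau>_def)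
  ultimately have \<tau>: "\<tau> > 0" "\<tau> \<le> 1" by auto
  define m where "m = norm (E z0)"
  have P0_eq: "P z0 = m * exp (- g ((norm z0)\<^sup>2)) * \<tau> ^ 8" by (simp add: P_def m_def \<tau>_def)
  have "m * exp (- g ((norm z0)\<^sup>2)) * \<tau> ^ 8 \<le> m * 1 * \<tau> ^ 8"
    using g_nonneg[of "(norm z0)\<^sup>2"] \<tau> by (intro mult_right_mono mult_left_mono) (auto simp: m_def)
  then have m1: "M' ^ 8 + B \<le> m * \<tau> ^ 8" using P0 P0_eq by simp
  have "m * \<tau> ^ 8 \<le> m * 1" using \<tau> by (intro mult_left_mono power_le_one) (auto simp: m_def)
  then have m2: "M' ^ 8 + B \<le> m" using m1 by simp
  have "m * exp (- g ((norm z0)\<^sup>2)) * \<tau> ^ 8 \<le> m * exp (- g ((norm z0)\<^sup>2)) * 1"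
    using \<tau> by (intro mult_left_mono power_le_one) (auto simp: m_def)
  then have m3: "M' ^ 8 + B \<le> m * exp (- g ((norm z0)\<^sup>2))" using P0 P0_eq by simp
  define N where "N = root 8 m"
  have m0: "m > 0" using m2 M8 B by linarith
  have N8: "N ^ 8 = m" using m0 by (simp add: N_def)
  have Npos: "N > 0" using m0 by (simp add: N_def)
  have "M' ^ 8 \<le> N ^ 8" using m2 B N8 by simp
  then have NM: "N \<ge> M'" using Npos power_le_imp_le_base[of M' 7 N] by simp
  have N1: "N \<ge> 1" using NM M' by simp
  \<comment> \<open>The weight \<open>exp (- g)\<close> is at most 1, so the size of the maximum
    bounds \<open>m * \<tau> ^ 8\<close> below by 1. Thus \<open>\<tau> >= 1 / N\<close>, and the
    cutoff cannot degenerate on the disc of radius \<open>1 / N\<close>.\<close>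
  have "1 ^ 8 \<le> (N * \<tau>) ^ 8" using m1 M8 B N8 by (simp add: power_mult_distrib)
  then have N\<tau>: "N * \<tau> \<ge> 1" using power_le_imp_le_base[of 1 7 "N * \<tau>"] Npos \<tau> by simp
  have nz1: "norm z0 \<ge> 1"
  proof (rule ccontr)
    assume "\<not> norm z0 \<ge> 1"
    then have "m \<le> B" unfolding m_def by (intro B) auto
    with m2 M8 show False by linarith
  qed
  have loc: "T z \<ge> \<tau> / 2 \<and> norm (E z) * exp (- g ((norm z)\<^sup>2)) * T z ^ 8 \<le> m * exp (- g ((norm z0)\<^sup>2)) * \<tau> ^ 8"
    if z: "dist z z0 \<le> 1 / N" for z
  proof -
    define \<delta> where "\<delta> = dist z z0"
    have "1 / N \<le> \<tau>" using N\<tau> Npos by (simp add: field_simps)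
    then have \<delta>: "\<delta> \<ge> 0" "\<delta> \<le> \<tau>" using z by (auto simp: \<delta>_def)
    have zR: "norm z0 \<le> R" using z0(1) by auto
    have "norm z \<le> norm z0 + \<delta>" unfolding \<delta>_def dist_norm by norm
    then have "(norm z)\<^sup>2 \<le> (norm z0 + \<delta>)\<^sup>2" by (intro power_mono) auto
    also have "\<dots> = (norm z0)\<^sup>2 + \<delta> * (2 * norm z0 + \<delta>)" by (simp add: power2_eq_square algebra_simps)
    also have "\<dots> \<le> (norm z0)\<^sup>2 + \<tau> * (2 * R + 1)"
      using \<delta> \<tau> zR by (intro add_left_mono mult_mono) auto
    \<comment> \<open>\<open>R >= 5\<close> makes \<open>2 * R + 1\<close> at most half of
      \<open>R^2\<close>, so a step of length at most \<open>\<tau>\<close> lowers the cutoff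
      \<open>T\<close> by at most \<open>\<tau> / 2\<close>.\<close>
    also have "\<dots> \<le> (norm z0)\<^sup>2 + \<tau> * (R\<^sup>2 / 2)"
    proof -
      have "5 * R \<le> R * R" using R by (intro mult_right_mono) auto
      then have "2 * R + 1 \<le> R\<^sup>2 / 2" using R unfolding power2_eq_square by linarith
      then show ?thesis using \<tau> by (intro add_left_mono mult_left_mono) auto
    qed
    finally have "(norm z)\<^sup>2 / R\<^sup>2 \<le> ((norm z0)\<^sup>2 + \<tau> * (R\<^sup>2 / 2)) / R\<^sup>2"
      by (rule divide_right_mono) simp
    also have "\<dots> = (norm z0)\<^sup>2 / R\<^sup>2 + \<tau> / 2" using R by (simp add: add_divide_distrib)
    finally have "T z0 - \<tau> / 2 \<le> T z" by (simp add: T_def)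
    then have T: "T z \<ge> \<tau> / 2" by (simp add: \<tau>_def)
    then have "T z > 0" using \<tau> by linarith
    then have "(norm z)\<^sup>2 < R\<^sup>2" using R by (simp add: T_def field_simps)
    then have "norm z < R" using R by (simp add: power_less_imp_less_base)
    then have "P z \<le> P z0" by (intro z0) auto
    then have "P z \<le> m * exp (- g ((norm z0)\<^sup>2)) * \<tau> ^ 8" by (simp only: P0_eq)
    then show ?thesis using T unfolding P_def by blast
  qed
  have bound: "norm (E z) \<le> 2 ^ 8 * exp s * N ^ 8" if z: "z \<in> cball z0 (1 / N)" for z
  proof -
    have z': "dist z z0 \<le> 1 / N" using z by (simp add: dist_commute)
    have "norm (E z) * exp (- g ((norm z)\<^sup>2)) * (\<tau> / 2) ^ 8 \<le> norm (E z) * exp (- g ((norm z)\<^sup>2)) * T z ^ 8"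
      using loc[OF z'] \<tau> by (intro mult_left_mono power_mono) auto
    also have "\<dots> \<le> m * exp (- g ((norm z0)\<^sup>2)) * \<tau> ^ 8" using loc[OF z'] by blast
    finally have "(norm (E z) * exp (- g ((norm z)\<^sup>2))) * \<tau> ^ 8 \<le> (2 ^ 8 * m * exp (- g ((norm z0)\<^sup>2))) * \<tau> ^ 8"
      by (simp add: power_divide)
    then have "norm (E z) * exp (- g ((norm z)\<^sup>2)) \<le> 2 ^ 8 * m * exp (- g ((norm z0)\<^sup>2))"
      using \<tau> by (subst (asm) mult_le_cancel_right) auto
    then have "norm (E z) * exp (- g ((norm z)\<^sup>2)) * exp (g ((norm z)\<^sup>2)) \<le> 2 ^ 8 * m * exp (- g ((norm z0)\<^sup>2)) * exp (g ((norm z)\<^sup>2))"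
      by (rule mult_right_mono) auto
    then have "norm (E z) \<le> 2 ^ 8 * m * exp (g ((norm z)\<^sup>2) - g ((norm z0)\<^sup>2))"
      by (simp add: exp_minus exp_diff field_simps)
    also have "\<dots> \<le> 2 ^ 8 * m * exp s"
    proof -
      have "1 / N \<le> 1" using N1 by simp
      then have "norm (z - z0) \<le> 1" using z' unfolding dist_norm by linarith
      then have "s * norm (z - z0) \<le> s * 1" using s by (intro mult_left_mono) auto
      with lip[of z z0] have "g ((norm z)\<^sup>2) - g ((norm z0)\<^sup>2) \<le> s" by linarith
      then show ?thesis using m0 by simp
    qed
    finally show ?thesis by (simp add: N8 mult_ac)
  qed
  \<comment> \<open>The cutoff is absorbed into the weight, as \<open>T ^ 8\<close> is the
    exponential of \<open>8 * ln (1 - |z|^2 / R^2)\<close>. Its contribution to the derivative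
    \<open>G'\<close> is nonnegative, so it can only improve the lower bound on
    \<open>deriv E z0\<close>.\<close>
  define G where "G = (\<lambda>x. g x - 8 * ln (1 - x / R\<^sup>2))"
  define G' where "G' = g' ((norm z0)\<^sup>2) + 8 * (1 / R\<^sup>2 / \<tau>)"
  have "1 - (norm z0)\<^sup>2 / R\<^sup>2 > 0" using \<tau> by (simp add: \<tau>_def T_def)
  then have G: "(G has_real_derivative G') (at ((norm z0)\<^sup>2))"
    unfolding G_def G'_def
    by (auto intro!: derivative_eq_intros g simp: \<tau>_def T_def divide_simps)
  have expG: "exp (- G ((norm z)\<^sup>2)) = exp (- g ((norm z)\<^sup>2)) * T z ^ 8" if "T z > 0" for z
  proof -
    have "exp (- G ((norm z)\<^sup>2)) = exp (- g ((norm z)\<^sup>2)) * exp (8 * ln (T z))"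
      by (simp add: G_def T_def flip: exp_add)
    also have "exp (8 * ln (T z)) = T z ^ 8"
      using that by (metis exp_ln exp_of_nat_mult of_nat_numeral)
    finally show ?thesis .
  qed
  have "deriv E z0 = of_real (2 * G') * cnj z0 * E z0"
  proof (rule weighted_max_deriv[OF E G])
    show "E z0 \<noteq> 0" using m0 by (auto simp: m_def)
    show "1 / N > 0" using Npos by simp
    fix z assume "dist z z0 < 1 / N"
    from loc[OF less_imp_le[OF this]] \<tau>
    show "norm (E z) * exp (- G ((norm z)\<^sup>2)) \<le> norm (E z0) * exp (- G ((norm z0)\<^sup>2))"
      by (subst (1 2) expG) (auto simp: \<tau>_def m_def mult.assoc)
  qed
  then have "norm (deriv E z0) = 2 * \<bar>G'\<bar> * norm z0 * N ^ 8"
    by (simp add: norm_mult N8 m_def)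
  moreover have "g' ((norm z0)\<^sup>2) \<le> G'" using \<tau> R by (simp add: G'_def)
  then have "2 * g' ((norm z0)\<^sup>2) * norm z0 * N ^ 8 \<le> 2 * \<bar>G'\<bar> * norm z0 * N ^ 8"
    using Npos by (intro mult_right_mono) auto
  moreover have "exp (g ((norm z0)\<^sup>2)) \<le> N ^ 8"
  proof -
    have "1 \<le> m * exp (- g ((norm z0)\<^sup>2))" using m3 M8 B by linarith
    then show ?thesis by (simp add: N8 exp_minus field_simps)
  qed
  ultimately show ?thesis using that[of N z0] NM M' N1 nz1 N8 bound by (simp add: m_def)
qed

text \<open>If \<open>E\<close> outgrows \<open>exp (s * sqrt (1 + |z|^2))\<close>, then
  \<open>growth_point\<close> supplies a point with \<open>|E| = N ^ 8\<close> for large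
  \<open>N\<close> and \<open>|E'| >= s / 2 * |E|\<close>. Since \<open>s / 2 = C0 + 2\<close>, the
  assumed bound on \<open>E'\<close> fails there. It is assumed for every \<open>K\<close> because
  the local bound of \<open>growth_point\<close> contains \<open>exp s\<close>.\<close>

lemma exp_type_of_deriv_bound:
  assumes E: "entire E" and C0: "C0 \<ge> 0"
    and hyp: "\<And>K. \<exists>M C. \<forall>z0 N. N \<ge> M \<longrightarrow> norm (E z0) = N ^ 8 \<longrightarrow>
      (\<forall>z\<in>cball z0 (1 / N). norm (E z) \<le> K * N ^ 8) \<longrightarrow> norm (deriv E z0) \<le> C0 * N ^ 8 + C * N ^ 4"
  shows "\<exists>K c. c > 0 \<and> (\<forall>z. norm (E z) \<le> K * exp (c * norm z))"
proof -
  define s where "s = 2 * C0 + 4"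
  define g where "g = (\<lambda>x. s * sqrt (1 + x))"
  define g' where "g' = (\<lambda>x. s / (2 * sqrt (1 + x)))"
  have s: "s \<ge> 4" using C0 by (simp add: s_def)
  show ?thesis
  proof (cases "\<exists>K. \<forall>z. norm (E z) \<le> K * exp (g ((norm z)\<^sup>2))")
    case True
    then obtain K where K: "\<And>z. norm (E z) \<le> K * exp (g ((norm z)\<^sup>2))" by blast
    have "norm (E z) \<le> (\<bar>K\<bar> * exp s) * exp (s * norm z)" for z
    proof -
      have "sqrt (1 + (norm z)\<^sup>2) \<le> 1 + norm z"
        by (rule real_le_lsqrt) (auto simp: power2_eq_square algebra_simps)
      then have "g ((norm z)\<^sup>2) \<le> s * (1 + norm z)"
        unfolding g_def using s by (intro mult_left_mono) auto
      then have "exp (g ((norm z)\<^sup>2)) \<le> exp s * exp (s * norm z)"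
        by (simp add: algebra_simps flip: exp_add)
      then have "\<bar>K\<bar> * exp (g ((norm z)\<^sup>2)) \<le> \<bar>K\<bar> * (exp s * exp (s * norm z))"
        by (rule mult_left_mono) simp
      moreover have "norm (E z) \<le> \<bar>K\<bar> * exp (g ((norm z)\<^sup>2))"
        by (rule order_trans[OF K]) (simp add: mult_right_mono)
      ultimately show ?thesis by (simp add: mult.assoc)
    qed
    moreover have "s > 0" using s by simp
    ultimately show ?thesis by blast
  next
    case False
    from hyp[of "2 ^ 8 * exp s"] obtain M C where MC: "\<And>z0 N. N \<ge> M \<Longrightarrow> norm (E z0) = N ^ 8 \<Longrightarrow>
      (\<forall>z\<in>cball z0 (1 / N). norm (E z) \<le> 2 ^ 8 * exp s * N ^ 8) \<Longrightarrow> norm (deriv E z0) \<le> C0 * N ^ 8 + C * N ^ 4"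
      by blast
    have lip: "g ((norm z)\<^sup>2) \<le> g ((norm y)\<^sup>2) + s * norm (z - y)" for z y :: complex
    proof -
      have "sqrt (1 + (norm z)\<^sup>2) \<le> sqrt (1 + (norm y)\<^sup>2) + \<bar>norm z - norm y\<bar>"
        using real_sqrt_sum_squares_triangle_ineq[of 1 0 "norm y" "norm z - norm y"] by simp
      also have "\<bar>norm z - norm y\<bar> \<le> norm (z - y)" by (rule norm_triangle_ineq3)
      finally have "s * sqrt (1 + (norm z)\<^sup>2) \<le> s * (sqrt (1 + (norm y)\<^sup>2) + norm (z - y))"
        using s by (intro mult_left_mono) auto
      then show ?thesis by (simp add: g_def algebra_simps)
    qed
    have unb: "\<exists>z. norm (E z) > K * exp (g ((norm z)\<^sup>2))" for K
      using False by (meson not_le)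
    have dg: "(g has_real_derivative g' x) (at x)" if "x \<ge> 0" for x
      unfolding g_def g'_def using that by (auto intro!: derivative_eq_intros simp: divide_simps)
    obtain z0 N where *: "N \<ge> max M (\<bar>C\<bar> + 1)" "N \<ge> 1" "norm z0 \<ge> 1" "norm (E z0) = N ^ 8"
      "\<And>z. z \<in> cball z0 (1 / N) \<Longrightarrow> norm (E z) \<le> 2 ^ 8 * exp s * N ^ 8"
      "2 * g' ((norm z0)\<^sup>2) * norm z0 * N ^ 8 \<le> norm (deriv E z0)"
      by (rule growth_point[OF E dg _ _ lip _ unb, of "max M (\<bar>C\<bar> + 1)"])
        (use s in \<open>auto simp: g_def g'_def\<close>)
    have "sqrt (1 + (norm z0)\<^sup>2) \<le> 2 * norm z0"
    proof (rule real_le_lsqrt)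
      have "1 \<le> (norm z0)\<^sup>2" using *(3) by simp
      then show "1 + (norm z0)\<^sup>2 \<le> (2 * norm z0)\<^sup>2" by (simp add: power_mult_distrib)
    qed auto
    then have "s / 2 \<le> 2 * g' ((norm z0)\<^sup>2) * norm z0"
      using s *(3) by (simp add: g'_def field_simps add_pos_nonneg)
    then have "s / 2 * N ^ 8 \<le> 2 * g' ((norm z0)\<^sup>2) * norm z0 * N ^ 8"
      using *(2) by (intro mult_right_mono) auto
    also have "\<dots> \<le> C0 * N ^ 8 + C * N ^ 4"
      using *(6) MC[of N z0] * by simp
    finally have "2 * N ^ 8 \<le> C * N ^ 4" by (simp add: s_def algebra_simps)
    then have "(2 * N ^ 4) * N ^ 4 \<le> C * N ^ 4" by (simp add: mult.assoc flip: power_add)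
    then have "2 * N ^ 4 \<le> C" using *(2) by (subst (asm) mult_le_cancel_right) auto
    moreover have "N ^ 1 \<le> N ^ 4" using *(2) by (intro power_increasing) auto
    ultimately show ?thesis using *(1,2) by simp
  qed
qed

text \<open>The weight is \<open>(1 + |z|^2)^2\<close>. At a point from \<open>growth_point\<close>
  this weight is at most \<open>N ^ 8\<close>, so \<open>|z0| <= N^2\<close>, and the logarithmic
  derivative, of order \<open>1 / |z0|\<close>, costs at most a factor \<open>N^2\<close>. Hence
  \<open>|E'| >= 2 * N ^ 6\<close>, which an error of size \<open>N ^ 4\<close> cannot
  match.\<close>

lemma polynomial_of_deriv_bound:
  assumes E: "entire E"
    and hyp: "\<And>K. \<exists>M C. \<forall>z0 N. N \<ge> M \<longrightarrow> norm (E z0) = N ^ 8 \<longrightarrow>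
      (\<forall>z\<in>cball z0 (1 / N). norm (E z) \<le> K * N ^ 8) \<longrightarrow> norm (deriv E z0) \<le> C * N ^ 4"
  shows "\<exists>p. E = poly p"
proof -
  define g where "g = (\<lambda>x::real. 2 * ln (1 + x))"
  define g' where "g' = (\<lambda>x::real. 2 / (1 + x))"
  have expg: "exp (g x) = (1 + x)\<^sup>2" if "x \<ge> 0" for x
    using that by (simp add: g_def exp_double)
  show ?thesis
  proof (cases "\<exists>K. \<forall>z. norm (E z) \<le> K * exp (g ((norm z)\<^sup>2))")
    case True
    then obtain K where K: "\<And>z. norm (E z) \<le> K * exp (g ((norm z)\<^sup>2))" by blast
    have "norm (E z) \<le> (4 * \<bar>K\<bar>) * norm z ^ 4" if "1 \<le> norm z" for z
    proof -
      have "1 \<le> (norm z)\<^sup>2" using that by simp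
      then have "(1 + (norm z)\<^sup>2)\<^sup>2 \<le> (2 * (norm z)\<^sup>2)\<^sup>2" by (intro power_mono) auto
      then have "exp (g ((norm z)\<^sup>2)) \<le> 4 * norm z ^ 4" by (simp add: expg power_mult_distrib)
      then have "\<bar>K\<bar> * exp (g ((norm z)\<^sup>2)) \<le> \<bar>K\<bar> * (4 * norm z ^ 4)"
        by (rule mult_left_mono) simp
      moreover have "norm (E z) \<le> \<bar>K\<bar> * exp (g ((norm z)\<^sup>2))"
        by (rule order_trans[OF K]) (simp add: mult_right_mono)
      ultimately show ?thesis by (simp add: mult_ac)
    qed
    then show ?thesis by (rule entire_poly_bound[OF E])
  next
    case False
    from hyp[of "2 ^ 8 * exp 4"] obtain M C where MC: "\<And>z0 N. N \<ge> M \<Longrightarrow> norm (E z0) = N ^ 8 \<Longrightarrow>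
      (\<forall>z\<in>cball z0 (1 / N). norm (E z) \<le> 2 ^ 8 * exp 4 * N ^ 8) \<Longrightarrow> norm (deriv E z0) \<le> C * N ^ 4"
      by blast
    have lip: "g ((norm z)\<^sup>2) \<le> g ((norm y)\<^sup>2) + 4 * norm (z - y)" for z y :: complex
    proof -
      define d where "d = norm (z - y)"
      have d: "d \<ge> 0" by (simp add: d_def)
      have "norm z \<le> norm y + d" unfolding d_def by norm
      then have "(norm z)\<^sup>2 \<le> (norm y + d)\<^sup>2" by (intro power_mono) auto
      then have "1 + (norm z)\<^sup>2 \<le> 1 + (norm y)\<^sup>2 + 2 * norm y * d + d\<^sup>2"
        by (simp add: power2_eq_square algebra_simps)
      also have "\<dots> \<le> (1 + (norm y)\<^sup>2) * (1 + 2 * d + (2 * d)\<^sup>2 / 2)"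
      proof -
        have "2 * norm y * d \<le> (1 + (norm y)\<^sup>2) * d"
          using d sum_power2_ge_zero[of "norm y - 1" 0] by (intro mult_right_mono) (auto simp: power2_eq_square algebra_simps)
        moreover have "0 \<le> (norm y)\<^sup>2 * d" "0 \<le> (norm y)\<^sup>2 * d\<^sup>2" "0 \<le> d\<^sup>2" using d by auto
        moreover have "(1 + (norm y)\<^sup>2) * (1 + 2 * d + (2 * d)\<^sup>2 / 2) =
            1 + (norm y)\<^sup>2 + 2 * d + 2 * ((norm y)\<^sup>2 * d) + 2 * d\<^sup>2 + 2 * ((norm y)\<^sup>2 * d\<^sup>2)"
          by (simp add: algebra_simps power2_eq_square)
        moreover have "(1 + (norm y)\<^sup>2) * d = d + (norm y)\<^sup>2 * d" by (simp add: algebra_simps)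
        ultimately show ?thesis using d by linarith
      qed
      also have "\<dots> \<le> (1 + (norm y)\<^sup>2) * exp (2 * d)"
        using d by (intro mult_left_mono exp_lower_Taylor_quadratic) auto
      finally have "ln (1 + (norm z)\<^sup>2) \<le> ln ((1 + (norm y)\<^sup>2) * exp (2 * d))"
        by (intro ln_mono) (auto intro: add_pos_nonneg)
      also have "\<dots> = ln (1 + (norm y)\<^sup>2) + 2 * d"
        by (subst ln_mult) (auto intro: add_pos_nonneg simp: add_nonneg_eq_0_iff)
      finally show ?thesis by (simp add: g_def d_def)
    qed
    have unb: "\<exists>z. norm (E z) > K * exp (g ((norm z)\<^sup>2))" for K
      using False by (meson not_le)
    have dg: "(g has_real_derivative g' x) (at x)" if "x \<ge> 0" for x
      unfolding g_def g'_def using that by (auto intro!: derivative_eq_intros simp: divide_simps)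
    obtain z0 N where *: "N \<ge> max M (\<bar>C\<bar> + 1)" "N \<ge> 1" "norm z0 \<ge> 1" "norm (E z0) = N ^ 8"
      "\<And>z. z \<in> cball z0 (1 / N) \<Longrightarrow> norm (E z) \<le> 2 ^ 8 * exp 4 * N ^ 8"
      "2 * g' ((norm z0)\<^sup>2) * norm z0 * N ^ 8 \<le> norm (deriv E z0)"
      "exp (g ((norm z0)\<^sup>2)) \<le> N ^ 8"
      by (rule growth_point[OF E dg _ _ lip _ unb, of "max M (\<bar>C\<bar> + 1)"])
        (auto simp: g_def g'_def)
    have "(1 + (norm z0)\<^sup>2)\<^sup>2 \<le> (N ^ 4)\<^sup>2" using *(7) by (simp add: expg flip: power_mult)
    then have "1 + (norm z0)\<^sup>2 \<le> N ^ 4"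
      by (rule power2_le_imp_le) simp
    then have "(norm z0)\<^sup>2 \<le> (N\<^sup>2)\<^sup>2" by (simp flip: power_mult)
    then have z0N: "norm z0 \<le> N\<^sup>2" using power2_le_imp_le[of "norm z0" "N\<^sup>2"] by simp
    have "2 * N ^ 6 \<le> 2 * g' ((norm z0)\<^sup>2) * norm z0 * N ^ 8"
    proof -
      have "(1 + (norm z0)\<^sup>2) \<le> 2 * (norm z0 * norm z0)" using *(3) mult_mono[of 1 "norm z0" 1 "norm z0"]
        by (simp add: power2_eq_square)
      also have "\<dots> \<le> 2 * (norm z0 * N\<^sup>2)" using z0N by (intro mult_left_mono) auto
      finally have "1 + (norm z0)\<^sup>2 \<le> 2 * (norm z0 * N\<^sup>2)" .
      moreover have "0 < 1 + (norm z0)\<^sup>2" by (simp add: add_pos_nonneg)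
      ultimately have "2 \<le> 2 * g' ((norm z0)\<^sup>2) * norm z0 * N\<^sup>2"
        by (simp add: g'_def le_divide_eq)
      then have "2 * N ^ 6 \<le> 2 * g' ((norm z0)\<^sup>2) * norm z0 * N\<^sup>2 * N ^ 6"
        using *(2) by (intro mult_right_mono) auto
      then show ?thesis by (simp add: mult.assoc flip: power_add)
    qed
    also have "\<dots> \<le> C * N ^ 4" using *(6) MC[of N z0] * by simp
    finally have "(2 * N\<^sup>2) * N ^ 4 \<le> C * N ^ 4" by (simp add: mult.assoc flip: power_add)
    then have "2 * N\<^sup>2 \<le> C" using *(2) by (subst (asm) mult_le_cancel_right) auto
    moreover have "N ^ 1 \<le> N\<^sup>2" using *(2) by (intro power_increasing) auto
    ultimately show ?thesis using *(1,2) by simp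
  qed
qed

text \<open>Where \<open>|f| >= L\<close> the hypothesis is already the derivative bound asked for
  by the growth test, with no error term; \<open>N >= max L 1\<close> guarantees that the test point
  lies in this region.\<close>

lemma exp_type_or_large_log_deriv:
  assumes f: "entire f"
    and no: "\<And>z. norm (f z) \<ge> L \<Longrightarrow> norm (deriv f z) \<le> L * norm (f z)"
  shows "\<exists>K c. c > 0 \<and> (\<forall>z. norm (f z) \<le> K * exp (c * norm z))"
proof (rule exp_type_of_deriv_bound[OF f, of "max L 0"])
  show "\<exists>M C. \<forall>z0 N. N \<ge> M \<longrightarrow> norm (f z0) = N ^ 8 \<longrightarrow>
      (\<forall>z\<in>cball z0 (1 / N). norm (f z) \<le> K * N ^ 8) \<longrightarrow> norm (deriv f z0) \<le> max L 0 * N ^ 8 + C * N ^ 4" for K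
  proof (rule exI[of _ "max L 1"], rule exI[of _ 0], intro allI impI)
    fix z0 N assume N: "N \<ge> max L 1" "norm (f z0) = N ^ 8"
    have "N ^ 1 \<le> N ^ 8" using N by (intro power_increasing) auto
    then have "norm (deriv f z0) \<le> L * norm (f z0)" using N by (intro no) auto
    also have "\<dots> \<le> max L 0 * N ^ 8" using N by (simp add: mult_right_mono)
    finally show "norm (deriv f z0) \<le> max L 0 * N ^ 8 + 0 * N ^ 4" by simp
  qed
qed auto

text \<open>Along the segment from \<open>z0\<close> in the direction \<open>- cnj w0\<close>, the
  modulus of \<open>f\<close> decays at rate at least \<open>|w0| / 2\<close>. At the end of the
  segment \<open>|f|\<close> is still at least \<open>1 / V\<close>, so it must have been
  exponentially larger at \<open>z0\<close>.\<close>

lemma nonvanishing_lower_bound: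
  assumes f: "entire f" and r: "r \<ge> 0" and V: "V > 0"
    and nz: "\<And>z. z \<in> cball z0 r \<Longrightarrow> f z \<noteq> 0 \<and> norm (deriv f z / f z - w0) \<le> norm w0 / 2 \<and> norm (1 / f z) \<le> V"
  shows "norm (1 / f z0) \<le> V * exp (- norm w0 * r / 2)"
proof -
  define u where "u = (if w0 = 0 then 0 else cnj w0 / of_real (norm w0))"
  have "w0 * u = of_real (norm w0)"
  proof (cases "w0 = 0")
    case False
    then have "w0 * u = (w0 * cnj w0) / of_real (norm w0)" by (simp add: u_def)
    also have "\<dots> = of_real (norm w0)" by (simp add: power2_eq_square flip: complex_norm_square)
    finally show ?thesis .
  qed (simp add: u_def)
  then have u: "norm u \<le> 1" "Re (w0 * u) = norm w0"
    by (simp_all add: u_def norm_divide)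
  define x where "x = (\<lambda>t::real. f (z0 - of_real t * u))"
  define x' where "x' = (\<lambda>t::real. - u * deriv f (z0 - of_real t * u))"
  have x: "(x has_vector_derivative x' t) (at t)" for t
  proof -
    have line: "((\<lambda>t. z0 - of_real t * u) has_vector_derivative - u) (at t)"
      by (auto intro!: derivative_eq_intros simp: has_vector_derivative_def scaleR_conv_of_real)
    show ?thesis unfolding x_def x'_def
      using field_vector_diff_chain_at[OF line, of f] entire_has_deriv[OF f]
      by (simp add: o_def)
  qed
  have inb: "z0 - of_real t * u \<in> cball z0 r" if "0 \<le> t" "t \<le> r" for t
    using u(1) that mult_mono[of t r "norm u" 1] by (simp add: dist_norm norm_mult)
  have "(norm (x r))\<^sup>2 \<le> (norm (x 0))\<^sup>2 * exp (- norm w0 * r - - norm w0 * 0)"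
  proof (rule gronwall_real[OF r norm_sq_has_deriv[OF x]])
    show "((\<lambda>t. - norm w0 * t) has_real_derivative - norm w0) (at t)" for t
      by (auto intro!: derivative_eq_intros)
    fix t assume t: "0 \<le> t" "t \<le> r"
    define y where "y = z0 - of_real t * u"
    define w where "w = deriv f y / f y"
    have fy: "f y \<noteq> 0" and wy: "norm (w - w0) \<le> norm w0 / 2"
      using nz[OF inb[OF t]] by (auto simp: y_def w_def)
    have "norm ((w - w0) * u) \<le> norm w0 / 2 * 1"
      unfolding norm_mult by (rule mult_mono[OF wy u(1)]) auto
    moreover have "\<bar>Re ((w - w0) * u)\<bar> \<le> norm ((w - w0) * u)" by (rule abs_Re_le_cmod)
    moreover have "Re (w * u) = norm w0 + Re ((w - w0) * u)" using u(2) by (simp add: algebra_simps)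
    ultimately have Re: "Re (w * u) \<ge> norm w0 / 2" by linarith
    have "cnj (x t) * x' t = - (w * u) * of_real ((norm (x t))\<^sup>2)"
      using fy unfolding x_def x'_def y_def[symmetric] complex_norm_square by (simp add: w_def)
    then have "2 * Re (cnj (x t) * x' t) = - 2 * Re (w * u) * (norm (x t))\<^sup>2"
      by (simp add: algebra_simps)
    also have "\<dots> \<le> - norm w0 * (norm (x t))\<^sup>2" using Re by (intro mult_right_mono) auto
    finally show "2 * Re (cnj (x t) * x' t) \<le> - norm w0 * (norm (x t))\<^sup>2" .
  qed
  also have "\<dots> = (norm (x 0) * exp (- norm w0 * r / 2))\<^sup>2"
    by (simp add: power_mult_distrib flip: exp_double)
  finally have le: "norm (x r) \<le> norm (f z0) * exp (- norm w0 * r / 2)"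
    by (rule power2_le_imp_le[THEN order_trans]) (auto simp: x_def)
  have nr: "x r \<noteq> 0" "norm (1 / x r) \<le> V" using nz[OF inb[OF r order_refl]] by (auto simp: x_def)
  have n0: "f z0 \<noteq> 0" using nz[of z0] r by auto
  have "norm (1 / f z0) * norm (x r) \<le> exp (- norm w0 * r / 2)"
    using le n0 by (simp add: norm_divide field_simps)
  then have "norm (1 / f z0) \<le> norm (1 / x r) * exp (- norm w0 * r / 2)"
    using nr by (simp add: norm_divide field_simps)
  also have "\<dots> \<le> V * exp (- norm w0 * r / 2)" using nr by (intro mult_right_mono) auto
  finally show ?thesis .
qed

subsection \<open>Lower growth bounds\<close>

lemma deriv_zero_imp_const:
  fixes F :: "complex \<Rightarrow> complex"
  shows "(\<And>z. (F has_field_derivative 0) (at z)) \<Longrightarrow> \<exists>c. \<forall>z. F z = c"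
  using has_field_derivative_zero_constant[of UNIV F] by auto

lemma powr_le_power_eventually:
  fixes \<rho> :: real
  assumes "\<rho> < real k" "\<eta> > 0"
  shows "\<forall>\<^sub>F r in at_top. r powr \<rho> \<le> \<eta> * r ^ k"
proof -
  have "((\<lambda>r::real. r powr (\<rho> - real k)) \<longlongrightarrow> 0) at_top"
    using assms by (intro tendsto_neg_powr filterlim_ident) auto
  then have "\<forall>\<^sub>F r in at_top. r powr (\<rho> - real k) < \<eta>"
    using assms by (auto simp: order_tendsto_iff)
  with eventually_gt_at_top[of 0] show ?thesis
    by eventually_elim (auto simp: powr_diff powr_realpow field_simps)
qed

lemma attains_max_at_infinity_0:
  fixes P :: "complex \<Rightarrow> real"
  assumes cont: "continuous_on UNIV P" and lim: "(P \<longlongrightarrow> 0) at_infinity" and pos: "P z1 > 0"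
  obtains z0 where "\<And>z. P z \<le> P z0"
proof -
  from lim pos have "\<forall>\<^sub>F z in at_infinity. P z < P z1" by (auto simp: order_tendsto_iff)
  then obtain b where b: "\<And>z. norm z \<ge> b \<Longrightarrow> P z < P z1"
    unfolding eventually_at_infinity by auto
  define S where "S = cball (0::complex) (max b (norm z1))"
  have "z1 \<in> S" by (simp add: S_def)
  moreover have "compact S" by (simp add: S_def)
  ultimately obtain z0 where z0: "z0 \<in> S" "\<And>z. z \<in> S \<Longrightarrow> P z \<le> P z0"
    using continuous_attains_sup[of S P] cont continuous_on_subset by blast
  have "P z \<le> P z0" for z
  proof (cases "z \<in> S")
    case False
    then have "P z < P z1" by (intro b) (auto simp: S_def)
    also have "\<dots> \<le> P z0" using z0 \<open>z1 \<in> S\<close> by blast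
    finally show ?thesis by simp
  qed (use z0 in blast)
  then show ?thesis by (rule that)
qed

lemma tendsto_exp_neg_power_at_infinity:
  assumes "\<eta> > 0" "k > 0"
  shows "((\<lambda>z::complex. exp (- \<eta> * norm z ^ k)) \<longlongrightarrow> 0) at_infinity"
proof -
  have "LIM r at_top. (r::real) ^ k :> at_top"
    using assms by (intro filterlim_pow_at_top filterlim_ident)
  then have "LIM r at_top. \<eta> * r ^ k :> at_top"
    using assms by (intro filterlim_tendsto_pos_mult_at_top[OF tendsto_const]) auto
  then have "((\<lambda>r. exp (- (\<eta> * r ^ k))) \<longlongrightarrow> 0) at_top"
    by (intro filterlim_compose[OF exp_at_bot]) (simp add: filterlim_uminus_at_top)
  from filterlim_compose[OF this filterlim_norm_at_top] show ?thesis by simp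
qed

text \<open>The weight decays at least like \<open>exp (- \<eta> |z| ^ k)\<close> and beats any
  function of order below \<open>k\<close>. The weighted modulus tends to 0 at infinity, and its
  maximum over the whole plane is attained without a cutoff.\<close>

lemma order_less_weighted_max:
  fixes g :: "real \<Rightarrow> real"
  assumes f: "entire f" "f z1 \<noteq> 0" and lt: "growth_order f < ereal (real k)" "k > 0"
    and g: "continuous_on {0..} g" and \<eta>: "\<eta> > 0"
    and ge: "\<And>z::complex. g ((norm z)\<^sup>2) \<ge> \<eta> * norm z ^ k"
  obtains z0 where "\<And>z. norm (f z) * exp (- g ((norm z)\<^sup>2)) \<le> norm (f z0) * exp (- g ((norm z0)\<^sup>2))"
proof -
  define P where "P = (\<lambda>z. norm (f z) * exp (- g ((norm z)\<^sup>2)))"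
  obtain \<rho> where \<rho>: "\<rho> < real k" "\<forall>\<^sub>F z in at_infinity. norm (f z) \<le> exp (norm z powr \<rho>)"
    using growth_order_less_imp_bound[OF lt(1)] .
  have "\<forall>\<^sub>F z in at_infinity. norm (z::complex) powr \<rho> \<le> \<eta> / 2 * norm z ^ k"
    by (rule eventually_at_infinityI_real[OF powr_le_power_eventually]) (use \<rho> \<eta> in auto)
  with \<rho>(2) have ev: "\<forall>\<^sub>F z in at_infinity. norm (P z) \<le> exp (- (\<eta> / 2) * norm z ^ k)"
  proof eventually_elim
    case (elim z)
    have "P z \<le> exp (norm z powr \<rho>) * exp (- g ((norm z)\<^sup>2))"
      unfolding P_def using elim by (intro mult_right_mono) auto
    also have "\<dots> \<le> exp (- (\<eta> / 2) * norm z ^ k)"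
      using elim(2) ge[of z] by (simp flip: exp_add)
    finally show ?case by (simp add: P_def)
  qed
  have "(P \<longlongrightarrow> 0) at_infinity"
    by (rule Lim_null_comparison[OF ev tendsto_exp_neg_power_at_infinity]) (use \<eta> lt in auto)
  moreover have "continuous_on UNIV (\<lambda>z::complex. g ((norm z)\<^sup>2))"
    by (rule continuous_on_compose2[OF g]) (auto intro!: continuous_intros)
  then have "continuous_on UNIV P"
    unfolding P_def using f by (intro continuous_intros holomorphic_on_imp_continuous_on) auto
  moreover have "P z1 > 0" using f by (simp add: P_def)
  ultimately show ?thesis
    using attains_max_at_infinity_0[of P z1] that unfolding P_def by blast
qed

lemma transcendental_superlinear:
  assumes "transcendental_entire f"
  shows "\<exists>z. norm z \<ge> K \<and> norm (f z) > K * norm z"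
  using entire_poly_bound[of f K K 1] assms unfolding transcendental_entire_def
  by (metis not_le power_one_right)

lemma deriv_bound_Cauchy:
  assumes f: "entire f" and r: "r > 0" and B: "\<And>x. norm (z - x) = r \<Longrightarrow> norm (f x) \<le> B"
  shows "norm (deriv f z) \<le> B / r" "norm (deriv (deriv f) z) \<le> 2 * B / r\<^sup>2"
proof -
  have "norm ((deriv ^^ n) f z) \<le> fact n * B / r ^ n" for n
    using f r B by (intro Cauchy_inequality)
      (auto intro: holomorphic_on_subset holomorphic_on_imp_continuous_on)
  from this[of 1] this[of 2] show "norm (deriv f z) \<le> B / r" "norm (deriv (deriv f) z) \<le> 2 * B / r\<^sup>2"
    by (simp_all add: numeral_2_eq_2)
qed

text \<open>Here \<open>z0\<close> maximises \<open>|f z| exp (- \<eta> sqrt (1 + |z|\<^sup>2))\<close>, with \<open>\<eta>\<close> small.\<close>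

lemma small_type_point:
  assumes tr: "transcendental_entire f" and lt: "growth_order f < 1" and \<epsilon>: "\<epsilon> > 0"
  obtains \<eta> z0 where "0 < \<eta>" "\<eta> \<le> \<epsilon>" "f z0 \<noteq> 0" "norm (1 / f z0) \<le> \<epsilon> * \<eta>"
    "\<eta> \<le> 2 * norm (deriv f z0 / f z0)" "norm (deriv f z0 / f z0) \<le> \<eta>"
    "norm (deriv (deriv f) z0 / f z0) \<le> 6 * \<eta>\<^sup>2"
proof -
  have f: "entire f" using tr by (simp add: transcendental_entire_def)
  have contf: "continuous_on (cball 0 1) f" using f holomorphic_on_imp_continuous_on continuous_on_subset by blast
  obtain B where B: "B > 0" "\<And>z. norm z \<le> 1 \<Longrightarrow> norm (f z) \<le> B"
    using compact_imp_bounded[OF compact_continuous_image[OF contf compact_cball[of "0::complex" 1]]]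
    unfolding bounded_pos by auto
  \<comment> \<open>\<open>exp 2\<close> compensates for the weight at \<open>z1\<close>, and
    \<open>B\<close> keeps \<open>z0\<close> out of the unit disc. The terms
    \<open>1 / \<epsilon>\<close> give \<open>\<eta> <= \<epsilon>\<close> and the smallness of
    \<open>1 / f z0\<close>.\<close>
  define K where "K = exp 2 * (B + 1 / \<epsilon> + 1) + 1 + 1 / \<epsilon>"
  have K1: "K \<ge> 1" "K \<ge> 1 / \<epsilon>" "K \<ge> exp 2 * (B + 1 / \<epsilon> + 1)"
    using B \<epsilon> by (auto simp: K_def)
  obtain z1 where z1: "norm z1 \<ge> K" "norm (f z1) > K * norm z1"
    using transcendental_superlinear[OF tr] by blast
  \<comment> \<open>Tying the type to \<open>z1\<close> keeps the weight at \<open>z1\<close> above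
    \<open>exp (- 2)\<close>, while superlinear growth makes \<open>|f z1|\<close> exceed
    \<open>K / \<eta>\<close>. This is where the factor \<open>\<eta>\<close> in the bound on
    \<open>1 / f z0\<close> comes from.\<close>
  define \<eta> where "\<eta> = 1 / norm z1"
  have z1p: "norm z1 > 0" "norm z1 \<ge> 1" using z1 K1 by linarith+
  then have \<eta>: "\<eta> > 0" "\<eta> \<le> 1" by (auto simp: \<eta>_def)
  have "1 / \<epsilon> \<le> norm z1" using z1 K1 by linarith
  then have \<eta>\<epsilon>: "\<eta> \<le> \<epsilon>" using \<epsilon> z1p by (simp add: \<eta>_def field_simps)
  define g where "g = (\<lambda>x. \<eta> * sqrt (1 + x))"
  have ge: "g ((norm z)\<^sup>2) \<ge> \<eta> * norm z ^ 1" for z :: complex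
    unfolding g_def using \<eta> by (intro mult_left_mono) (auto intro: real_le_rsqrt)
  have "0 \<le> K * norm z1" using K1 by simp
  then have fz1: "f z1 \<noteq> 0" using z1(2) by auto
  have contg: "continuous_on {0..} g" unfolding g_def by (intro continuous_intros)
  have lt': "growth_order f < ereal (real 1)" using lt by (simp add: one_ereal_def)
  obtain z0 where z0: "\<And>z. norm (f z) * exp (- g ((norm z)\<^sup>2)) \<le> norm (f z0) * exp (- g ((norm z0)\<^sup>2))"
    using order_less_weighted_max[OF f fz1 lt' zero_less_one contg \<eta>(1) ge] by blast
  have g0: "g x \<ge> 0" if "x \<ge> 0" for x using that \<eta> by (simp add: g_def)
  have "K * norm z1 * exp (- 2) \<le> norm (f z1) * exp (- g ((norm z1)\<^sup>2))"
  proof (intro mult_mono)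
    have "sqrt (1 + (norm z1)\<^sup>2) \<le> 2 * norm z1"
    proof (rule real_le_lsqrt)
      have "1 \<le> (norm z1)\<^sup>2" using z1p by simp
      then show "1 + (norm z1)\<^sup>2 \<le> (2 * norm z1)\<^sup>2" by (simp add: power_mult_distrib)
    qed auto
    then have "g ((norm z1)\<^sup>2) \<le> \<eta> * (2 * norm z1)"
      unfolding g_def using \<eta> by (intro mult_left_mono) auto
    then show "exp (- 2) \<le> exp (- g ((norm z1)\<^sup>2))" using z1p by (simp add: \<eta>_def)
  qed (use z1 K1 in auto)
  also have "\<dots> \<le> norm (f z0) * exp (- g ((norm z0)\<^sup>2))" by (rule z0)
  also have "\<dots> \<le> norm (f z0) * 1" using g0[of "(norm z0)\<^sup>2"] by (intro mult_left_mono) auto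
  finally have f0: "K * norm z1 * exp (- 2) \<le> norm (f z0)" by simp
  have "exp 2 * (B + 1 / \<epsilon> + 1) * norm z1 * exp (- 2) \<le> K * norm z1 * exp (- 2)"
    using K1(3) by (intro mult_right_mono) auto
  also have "exp 2 * (B + 1 / \<epsilon> + 1) * norm z1 * exp (- 2) = (B + 1 / \<epsilon> + 1) * norm z1"
    by (simp add: exp_minus)
  finally have f0': "(B + 1 / \<epsilon> + 1) * norm z1 \<le> norm (f z0)" using f0 by linarith
  have "(B + 1 / \<epsilon> + 1) * 1 \<le> (B + 1 / \<epsilon> + 1) * norm z1"
    using B \<epsilon> z1p by (intro mult_left_mono) auto
  then have f0B: "norm (f z0) > B" using f0' \<epsilon> by (smt (verit) divide_pos_pos)
  have "1 / \<epsilon> * norm z1 \<le> (B + 1 / \<epsilon> + 1) * norm z1" using B by (intro mult_right_mono) auto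
  then have f0\<epsilon>: "1 / \<epsilon> * norm z1 \<le> norm (f z0)" using f0' by linarith
  have nz: "f z0 \<noteq> 0" using f0B B by auto
  have z01: "norm z0 \<ge> 1" using f0B B(2)[of z0] by linarith
  have "norm (1 / f z0) \<le> \<epsilon> * \<eta>"
    using f0\<epsilon> nz z1p \<epsilon> by (simp add: \<eta>_def norm_divide field_simps)
  have "(g has_real_derivative \<eta> / (2 * sqrt (1 + (norm z0)\<^sup>2))) (at ((norm z0)\<^sup>2))"
  proof -
    have "1 + (norm z0)\<^sup>2 > 0" by (simp add: add_pos_nonneg)
    then show ?thesis
      unfolding g_def by (auto intro!: derivative_eq_intros simp: divide_simps)
  qed
  from weighted_max_deriv[OF f this nz zero_less_one z0]
  have "deriv f z0 / f z0 = of_real (\<eta> / sqrt (1 + (norm z0)\<^sup>2)) * cnj z0" using nz by simp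
  then have w: "norm (deriv f z0 / f z0) = \<eta> * norm z0 / sqrt (1 + (norm z0)\<^sup>2)"
    using \<eta> by (simp add: norm_mult norm_divide abs_of_nonneg add_nonneg_nonneg)
  have sq: "norm z0 \<le> sqrt (1 + (norm z0)\<^sup>2)" by (rule real_le_rsqrt) auto
  have sq2: "sqrt (1 + (norm z0)\<^sup>2) \<le> 2 * norm z0"
  proof (rule real_le_lsqrt)
    have "1 \<le> (norm z0)\<^sup>2" using z01 by simp
    then show "1 + (norm z0)\<^sup>2 \<le> (2 * norm z0)\<^sup>2" by (simp add: power_mult_distrib)
  qed auto
  have "\<eta> * norm z0 / sqrt (1 + (norm z0)\<^sup>2) \<le> \<eta> * 1"
    using sq \<eta> z01 by (simp add: divide_le_eq add_pos_nonneg)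
  moreover have "\<eta> \<le> 2 * (\<eta> * norm z0 / sqrt (1 + (norm z0)\<^sup>2))"
    using mult_left_mono[OF sq2, of \<eta>] \<eta> by (simp add: le_divide_eq add_pos_nonneg mult_ac)
  \<comment> \<open>On the circle of radius \<open>1 / \<eta>\<close> the weight changes by a factor
    of at most \<open>exp 1 <= 3\<close>, so \<open>|f| <= 3 * |f z0|\<close> there and the Cauchy
    estimate gives \<open>6 * \<eta>^2\<close>.\<close>
  moreover have "norm (deriv (deriv f) z0) \<le> 2 * (3 * norm (f z0)) / (1 / \<eta>)\<^sup>2"
  proof (rule deriv_bound_Cauchy(2)[OF f])
    show "1 / \<eta> > 0" using \<eta> by simp
    fix x assume x: "norm (z0 - x) = 1 / \<eta>"
    have "sqrt (1 + (norm x)\<^sup>2) \<le> sqrt (1 + (norm z0)\<^sup>2) + \<bar>norm x - norm z0\<bar>"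
      using real_sqrt_sum_squares_triangle_ineq[of 1 0 "norm z0" "norm x - norm z0"] by simp
    also have "\<bar>norm x - norm z0\<bar> \<le> 1 / \<eta>" using norm_triangle_ineq3[of x z0] x by (simp add: norm_minus_commute)
    finally have "\<eta> * sqrt (1 + (norm x)\<^sup>2) \<le> \<eta> * (sqrt (1 + (norm z0)\<^sup>2) + 1 / \<eta>)"
      using \<eta> by (intro mult_left_mono) auto
    then have "g ((norm x)\<^sup>2) - g ((norm z0)\<^sup>2) \<le> 1" using \<eta> by (simp add: g_def algebra_simps)
    then have "exp (g ((norm x)\<^sup>2) - g ((norm z0)\<^sup>2)) \<le> 3"
      using exp_le by (meson exp_le_cancel_iff order_trans)
    then have "norm (f z0) * exp (g ((norm x)\<^sup>2) - g ((norm z0)\<^sup>2)) \<le> norm (f z0) * 3"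
      by (rule mult_left_mono) simp
    moreover have "norm (f x) \<le> norm (f z0) * exp (g ((norm x)\<^sup>2) - g ((norm z0)\<^sup>2))"
      using z0[of x] by (simp add: exp_minus exp_diff field_simps)
    ultimately show "norm (f x) \<le> 3 * norm (f z0)" by simp
  qed
  then have "norm (deriv (deriv f) z0 / f z0) \<le> 6 * \<eta>\<^sup>2"
    using nz by (simp add: norm_divide field_simps)
  ultimately show ?thesis
    using that[of \<eta> z0] \<eta> \<eta>\<epsilon> nz \<open>norm (1 / f z0) \<le> \<epsilon> * \<eta>\<close> w by auto
qed

text \<open>Were the order below 2, \<open>|f| exp (- \<eta> |z|^2)\<close> would have a maximum
  point \<open>z0\<close>, with \<open>f'/f = 2 \<eta> cnj z0\<close> there. The equation makes this
  equal to \<open>c1 z0 + c0 + \<gamma> / f z0\<close>; for small \<open>\<eta>\<close> this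
  confines \<open>z0\<close> to a fixed disc, on which \<open>|f|\<close> is too small for a
  maximum.\<close>

lemma growth_order_ge_2:
  assumes tr: "transcendental_entire f" and c1: "c1 \<noteq> 0"
    and eq: "\<And>z. deriv f z = \<gamma> + (c1 * z + c0) * f z"
  shows "growth_order f \<ge> 2"
proof (rule ccontr)
  assume "\<not> growth_order f \<ge> 2"
  then have lt: "growth_order f < ereal (real 2)" by simp
  have f: "entire f" using tr by (simp add: transcendental_entire_def)
  define r where "r = 2 * (norm c0 + norm \<gamma>) / norm c1"
  have contf: "continuous_on (cball 0 r) f" using f holomorphic_on_imp_continuous_on continuous_on_subset by blast
  obtain B where B: "B > 0" "\<And>z. norm z \<le> r \<Longrightarrow> norm (f z) \<le> B"
    using compact_imp_bounded[OF compact_continuous_image[OF contf compact_cball[of "0::complex" r]]]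
    unfolding bounded_pos by auto
  obtain z1 where z1: "norm z1 \<ge> 3 * (B + 1)" "norm (f z1) > 3 * (B + 1) * norm z1"
    using transcendental_superlinear[OF tr] by blast
  have "3 * (B + 1) * 1 \<le> 3 * (B + 1) * norm z1" using z1 B by (intro mult_left_mono) auto
  then have z1': "norm (f z1) \<ge> 3 * (B + 1)" using z1 by linarith
  have z1p: "norm z1 > 0" by (rule less_le_trans[OF _ z1(1)]) (use B in simp)
  \<comment> \<open>The first bound lets \<open>c1 z0\<close> dominate
    \<open>2 \<eta> cnj z0\<close>; the second keeps the weight at \<open>z1\<close> above 1/3, so
    that \<open>|f z0|\<close> exceeds the bound \<open>B\<close> on the disc of radius
    \<open>r\<close>.\<close>
  define \<eta> where "\<eta> = min (norm c1 / 8) (1 / (norm z1)\<^sup>2)"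
  have \<eta>: "\<eta> > 0" "\<eta> \<le> norm c1 / 8" "\<eta> \<le> 1 / (norm z1)\<^sup>2" using c1 z1p by (auto simp: \<eta>_def)
  have "f z1 \<noteq> 0" using z1' B by auto
  then obtain z0 where z0: "\<And>z. norm (f z) * exp (- (\<eta> * (norm z)\<^sup>2)) \<le> norm (f z0) * exp (- (\<eta> * (norm z0)\<^sup>2))"
    using order_less_weighted_max[OF f _ lt _ _ \<eta>(1), of z1 "\<lambda>x. \<eta> * x"]
    by (auto intro!: continuous_intros)
  have "\<eta> * (norm z1)\<^sup>2 \<le> 1" using \<eta>(3) z1p by (simp add: field_simps)
  then have "exp (\<eta> * (norm z1)\<^sup>2) \<le> 3" using exp_le by (meson exp_le_cancel_iff order_trans)
  then have "1 / 3 \<le> exp (- (\<eta> * (norm z1)\<^sup>2))" by (simp add: exp_minus field_simps)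
  then have "3 * (B + 1) * (1 / 3) \<le> norm (f z1) * exp (- (\<eta> * (norm z1)\<^sup>2))"
    using z1' B by (intro mult_mono) auto
  also have "\<dots> \<le> norm (f z0) * exp (- (\<eta> * (norm z0)\<^sup>2))" by (rule z0)
  also have "\<dots> \<le> norm (f z0) * 1" using \<eta> by (intro mult_left_mono) auto
  finally have f0: "norm (f z0) \<ge> B + 1" by simp
  then have nz: "f z0 \<noteq> 0" and f01: "norm (f z0) \<ge> 1" using B by auto
  have "((\<lambda>x. \<eta> * x) has_real_derivative \<eta>) (at ((norm z0)\<^sup>2))"
    by (auto intro!: derivative_eq_intros)
  from weighted_max_deriv[OF f this nz zero_less_one z0]
  have "\<gamma> + (c1 * z0 + c0) * f z0 = of_real (2 * \<eta>) * cnj z0 * f z0" by (simp add: eq)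
  then have "c1 * z0 * f z0 = (of_real (2 * \<eta>) * cnj z0 - c0) * f z0 - \<gamma>" by (simp add: algebra_simps)
  then have "norm (c1 * z0 * f z0) \<le> norm (of_real (2 * \<eta>) * cnj z0 - c0) * norm (f z0) + norm \<gamma>"
    by (metis norm_mult norm_triangle_ineq4)
  also have "\<dots> \<le> (2 * \<eta> * norm z0 + norm c0) * norm (f z0) + norm \<gamma> * norm (f z0)"
  proof (intro add_mono mult_right_mono)
    show "norm (of_real (2 * \<eta>) * cnj z0 - c0) \<le> 2 * \<eta> * norm z0 + norm c0"
      using norm_triangle_ineq4[of "of_real (2 * \<eta>) * cnj z0" c0] \<eta> by (simp add: norm_mult)
    show "norm \<gamma> \<le> norm \<gamma> * norm (f z0)" using f01 mult_left_mono[of 1 "norm (f z0)" "norm \<gamma>"] by simp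
  qed auto
  finally have "(norm c1 * norm z0) * norm (f z0) \<le> (2 * \<eta> * norm z0 + norm c0 + norm \<gamma>) * norm (f z0)"
    by (simp add: norm_mult algebra_simps)
  then have "norm c1 * norm z0 \<le> 2 * \<eta> * norm z0 + norm c0 + norm \<gamma>"
    using nz by (subst (asm) mult_le_cancel_right) auto
  moreover have "2 * \<eta> * norm z0 \<le> 2 * (norm c1 / 8) * norm z0" using \<eta> by (intro mult_right_mono) auto
  moreover have "2 * (norm c1 / 8) * norm z0 = norm c1 * norm z0 / 4" by simp
  ultimately have "norm c1 * norm z0 \<le> 2 * (norm c0 + norm \<gamma>)"
    using norm_ge_zero[of c0] norm_ge_zero[of \<gamma>] by argo
  then have "norm z0 \<le> r" using c1 by (simp add: r_def field_simps)
  with B(2)[of z0] f0 show False by simp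
qed

text \<open>At the points from \<open>small_type_point\<close>,
  \<open>h = f''/f - A f'/f - B/f\<close> is \<open>O(\<eta>)\<close>, so \<open>h = 0\<close>. Next
  \<open>A f'/f\<close> is \<open>O(\<epsilon> \<eta>)\<close> while
  \<open>|f'/f| >= \<eta> / 2\<close>, so \<open>A = 0\<close>. Then \<open>f''\<close> is constant
  and \<open>f\<close> a polynomial.\<close>

lemma growth_order_ge_1_linear:
  assumes tr: "transcendental_entire f"
    and eq: "\<And>z. deriv (deriv f) z = A * deriv f z + h * f z + B"
  shows "growth_order f \<ge> 1"
proof (rule ccontr)
  assume "\<not> growth_order f \<ge> 1"
  then have lt: "growth_order f < 1" by simp
  have f: "entire f" using tr by (simp add: transcendental_entire_def)
  have pt: "\<exists>\<eta> w v d. 0 < \<eta> \<and> \<eta> \<le> \<epsilon> \<and> norm v \<le> \<epsilon> * \<eta> \<and> \<eta> \<le> 2 * norm w \<and> norm w \<le> \<eta> \<and> norm d \<le> 6 * \<eta>\<^sup>2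
      \<and> h = d - A * w - B * v" if "\<epsilon> > 0" for \<epsilon>
  proof -
    obtain \<eta> z0 where *: "0 < \<eta>" "\<eta> \<le> \<epsilon>" "f z0 \<noteq> 0" "norm (1 / f z0) \<le> \<epsilon> * \<eta>"
      "\<eta> \<le> 2 * norm (deriv f z0 / f z0)" "norm (deriv f z0 / f z0) \<le> \<eta>"
      "norm (deriv (deriv f) z0 / f z0) \<le> 6 * \<eta>\<^sup>2"
      using small_type_point[OF tr lt \<open>\<epsilon> > 0\<close>] .
    moreover have "h = deriv (deriv f) z0 / f z0 - A * (deriv f z0 / f z0) - B * (1 / f z0)"
      using *(3) eq[of z0] by (simp add: field_simps)
    ultimately show ?thesis by blast
  qed
  have h0: "h = 0"
  proof (rule ccontr)
    assume "h \<noteq> 0"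
    define D where "D = 6 + norm A + norm B"
    have D: "D > 0" by (simp add: D_def add_pos_nonneg)
    define \<epsilon> where "\<epsilon> = min 1 (norm h / (2 * D))"
    have \<epsilon>: "\<epsilon> > 0" "\<epsilon> \<le> 1" "\<epsilon> \<le> norm h / (2 * D)" using \<open>h \<noteq> 0\<close> D by (auto simp: \<epsilon>_def)
    obtain \<eta> w v d where *: "0 < \<eta>" "\<eta> \<le> \<epsilon>" "norm v \<le> \<epsilon> * \<eta>" "norm w \<le> \<eta>" "norm d \<le> 6 * \<eta>\<^sup>2" "h = d - A * w - B * v"
      using pt[OF \<epsilon>(1)] by blast
    have "\<eta>\<^sup>2 \<le> \<eta>" using * \<epsilon> by (simp add: power2_eq_square mult_left_le)
    have "\<epsilon> * \<eta> \<le> \<eta>" using * \<epsilon> by (simp add: mult_left_le_one_le)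
    have "norm h \<le> norm d + norm (A * w) + norm (B * v)" unfolding *(6) by norm
    also have "\<dots> \<le> 6 * \<eta> + norm A * \<eta> + norm B * \<eta>"
      unfolding norm_mult using * \<open>\<eta>\<^sup>2 \<le> \<eta>\<close> order_trans[OF *(3) \<open>\<epsilon> * \<eta> \<le> \<eta>\<close>] by (intro add_mono mult_left_mono) auto
    also have "\<dots> = D * \<eta>" by (simp add: D_def algebra_simps)
    also have "\<dots> \<le> D * (norm h / (2 * D))" using * \<epsilon> D by (intro mult_left_mono) auto
    also have "\<dots> = norm h / 2" using D by simp
    finally show False using \<open>h \<noteq> 0\<close> by simp
  qed
  have A0: "A = 0"
  proof (rule ccontr)
    assume "A \<noteq> 0"
    define D where "D = 6 + norm B"
    have D: "D > 0" by (simp add: D_def add_pos_nonneg)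
    define \<epsilon> where "\<epsilon> = norm A / (4 * D)"
    have \<epsilon>: "\<epsilon> > 0" using \<open>A \<noteq> 0\<close> D by (simp add: \<epsilon>_def)
    obtain \<eta> w v d where *: "0 < \<eta>" "\<eta> \<le> \<epsilon>" "norm v \<le> \<epsilon> * \<eta>" "\<eta> \<le> 2 * norm w" "norm d \<le> 6 * \<eta>\<^sup>2" "h = d - A * w - B * v"
      using pt[OF \<epsilon>(1)] by blast
    have "A * w = d - B * v" using *(6) h0 by (simp add: algebra_simps)
    then have "norm (A * w) \<le> norm d + norm (B * v)" by (simp add: norm_triangle_ineq4)
    also have "\<dots> \<le> 6 * (\<epsilon> * \<eta>) + norm B * (\<epsilon> * \<eta>)"
    proof -
      have "\<eta>\<^sup>2 \<le> \<epsilon> * \<eta>" using * by (simp add: power2_eq_square mult_right_mono)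
      then show ?thesis unfolding norm_mult using * by (intro add_mono mult_left_mono) auto
    qed
    also have "\<dots> = D * \<epsilon> * \<eta>" by (simp add: D_def algebra_simps)
    also have "\<dots> = norm A * \<eta> / 4" using D by (simp add: \<epsilon>_def)
    finally have "norm A * norm w \<le> norm A * (\<eta> / 4)" by (simp add: norm_mult)
    then have "norm w \<le> \<eta> / 4" using \<open>A \<noteq> 0\<close> by (subst (asm) mult_le_cancel_left_pos) auto
    with * show False by linarith
  qed
  have f1: "entire (deriv f)" using f by (rule entire_deriv)
  have "((\<lambda>z. deriv f z - B * z) has_field_derivative 0) (at z)" for z
    using eq[of z] entire_has_deriv[OF f1, of z] by (auto intro!: derivative_eq_intros simp: A0 h0)
  then obtain c where c: "\<And>z. deriv f z - B * z = c"
    using deriv_zero_imp_const by blast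
  then have c': "deriv f z = c + B * z" for z by (metis diff_eq_eq)
  have "((\<lambda>z. f z - (c * z + B / 2 * z\<^sup>2)) has_field_derivative 0) (at z)" for z
    using entire_has_deriv[OF f, of z] c'[of z] by (auto intro!: derivative_eq_intros)
  then obtain d where d: "\<And>z. f z - (c * z + B / 2 * z\<^sup>2) = d"
    using deriv_zero_imp_const by blast
  have "f z = poly [:d, c, B / 2:] z" for z
    using d[of z] by (simp add: power2_eq_square algebra_simps)
  then have "f = poly [:d, c, B / 2:]" by blast
  then show False using tr by (auto simp: transcendental_entire_def)
qed

text \<open>Bootstrap argument: at the infimum of the times with \<open>U < 0\<close>, continuity
  gives \<open>U >= 0\<close> up to and including that time. Hence \<open>U' > 0\<close> there, and
  \<open>U\<close> stays nonnegative a little longer, a contradiction.\<close>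

lemma stays_nonneg:
  fixes U U' :: "real \<Rightarrow> real"
  assumes U: "\<And>t. t \<ge> 0 \<Longrightarrow> (U has_real_derivative U' t) (at t)" and U0: "U 0 \<ge> 0"
    and step: "\<And>t. t \<ge> 0 \<Longrightarrow> (\<And>s. 0 \<le> s \<Longrightarrow> s \<le> t \<Longrightarrow> U s \<ge> 0) \<Longrightarrow> U' t > 0"
    and T: "T \<ge> 0"
  shows "U T \<ge> 0"
proof (rule ccontr)
  assume neg: "\<not> U T \<ge> 0"
  define S where "S = {t. 0 \<le> t \<and> U t < 0}"
  have S: "S \<noteq> {}" "bdd_below S" using neg T by (auto simp: S_def intro!: bdd_belowI[of _ 0])
  define t1 where "t1 = Inf S"
  have t1: "t1 \<ge> 0" unfolding t1_def using S by (intro cInf_greatest) (auto simp: S_def)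
  have before: "U s \<ge> 0" if "0 \<le> s" "s < t1" for s
    using that cInf_lower[OF _ S(2), of s] by (force simp: t1_def S_def)
  have at: "U t1 \<ge> 0"
  proof (cases "t1 = 0")
    case False
    then have "t1 > 0" using t1 by simp
    have "(U \<longlongrightarrow> U t1) (at_left t1)"
      using DERIV_isCont[OF U[OF t1]] by (simp add: isCont_def filterlim_at_split)
    moreover have "\<forall>\<^sub>F s in at_left t1. 0 \<le> U s"
      using eventually_at_left_real[OF \<open>t1 > 0\<close>] by eventually_elim (auto intro: before)
    ultimately show ?thesis by (rule tendsto_lowerbound) simp
  qed (use U0 in simp)
  then have "U s \<ge> 0" if "0 \<le> s" "s \<le> t1" for s
    using before that by (cases "s = t1") auto
  then have "U' t1 > 0" using step t1 by blast
  from DERIV_pos_inc_right[OF U[OF t1] this] obtain d where d: "d > 0" "\<And>h. 0 < h \<Longrightarrow> h < d \<Longrightarrow> U t1 < U (t1 + h)"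
    by auto
  have "t1 + d \<le> t" if "t \<in> S" for t
  proof (rule ccontr)
    assume "\<not> t1 + d \<le> t"
    moreover have "t1 \<le> t" using cInf_lower[OF that S(2)] by (simp add: t1_def)
    ultimately have "U t \<ge> 0"
      using d(2)[of "t - t1"] at by (cases "t = t1") auto
    then show False using that by (simp add: S_def)
  qed
  then have "t1 + d \<le> t1" unfolding t1_def[of] using S(1) by (intro cInf_greatest) auto
  with d show False by simp
qed

subsection \<open>Doubly exponential growth of solutions\<close>

locale hayman_ode =
  fixes f :: "complex \<Rightarrow> complex" and a1 a2 b1 b2 b3 :: complex
  assumes transcendental: "transcendental_entire f"
    and ode: "\<And>z. deriv (deriv f) z * f z - (deriv f z)\<^sup>2 + a1 * deriv f z * f z + a2 * (f z)\<^sup>2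
             = b1 * f z + b2 * deriv f z + b3"
begin

lemma f_entire: "entire f"
  using transcendental by (simp add: transcendental_entire_def)

lemma f_deriv: "(f has_field_derivative deriv f z) (at z)"
  using f_entire by (rule entire_has_deriv)

lemma f_deriv2: "(deriv f has_field_derivative deriv (deriv f) z) (at z)"
  by (intro entire_has_deriv entire_deriv f_entire)

lemma log_deriv_ode:
  assumes "f z \<noteq> 0"
  defines "w \<equiv> deriv f z / f z" and "v \<equiv> 1 / f z"
  shows "((\<lambda>z. deriv f z / f z) has_field_derivative
    (- a1 * w - a2 + (b1 * v + b2 * v * w + b3 * v\<^sup>2))) (at z)"
proof -
  have "((\<lambda>z. deriv f z / f z) has_field_derivative
      (deriv (deriv f) z * f z - deriv f z * deriv f z) / (f z * f z)) (at z)"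
    by (rule DERIV_divide[OF f_deriv2 f_deriv assms(1)])
  moreover have "deriv (deriv f) z * f z - deriv f z * deriv f z =
      b1 * f z + b2 * deriv f z + b3 - a1 * deriv f z * f z - a2 * (f z)\<^sup>2"
    using ode[of z] by (simp add: algebra_simps power2_eq_square)
  moreover have "(b1 * f z + b2 * deriv f z + b3 - a1 * deriv f z * f z - a2 * (f z)\<^sup>2) / (f z * f z) =
      - a1 * w - a2 + (b1 * v + b2 * v * w + b3 * v\<^sup>2)"
    using assms(1) by (simp add: w_def v_def field_simps power2_eq_square)
  ultimately show ?thesis by simp
qed

text \<open>
  Where \<open>f\<close> is large, \<open>w = f'/f\<close> nearly solves \<open>w' + a1 w + a2 = 0\<close>, so that \<open>ln f\<close> is nearly
  \<open>c exp (- a1 \<zeta>)\<close> plus a linear term. Moving along the curve on which \<open>c exp (- a1 \<zeta>) = c + t \<omega>\<close>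
  with \<open>Re \<omega> > 0\<close> keeps \<open>f\<close> large while \<open>ln f\<close> grows linearly in \<open>t\<close> and \<open>\<zeta>\<close> only logarithmically.
\<close>

lemma double_exponential_growth:
  assumes a1: "a1 \<noteq> 0"
  shows "\<exists>L. \<forall>z0. norm (f z0) \<ge> L \<longrightarrow> norm (deriv f z0) > L * norm (f z0) \<longrightarrow>
    (\<exists>c>0. \<forall>R. \<exists>z. norm z \<ge> R \<and> norm (f z) \<ge> exp (exp (c * norm z)))"
proof -
  define A where "A = norm a1"
  have A: "A > 0" using a1 by (simp add: A_def)
  \<comment> \<open>\<open>C\<close> bounds the perturbation of the linear equation for
    \<open>f'/f\<close>. In \<open>L\<close>, the summand 1 makes the initial modulus
    \<open>F0\<close> at least 1, \<open>24 * 256 * C1\<close> keeps the relative drift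
    \<open>k\<close> within 1/4 of 1, and the last terms give
    \<open>|c| >= 2 + 32 |a2| / A^2\<close>.\<close>
  define C where "C = norm b1 + norm b3 + norm b2 * A + norm b2 * norm a2 / A"
  define C1 where "C1 = C / A\<^sup>2"
  have C: "C \<ge> 0" and C1: "C1 \<ge> 0" using A by (auto simp: C_def C1_def)
  define L where "L = 1 + 24 * 256 * C1 + norm a2 / A + A * (2 + 32 * norm a2 / A\<^sup>2)"
  have L: "L \<ge> 1" "L \<ge> 24 * 256 * C1" "L \<ge> norm a2 / A + A * (2 + 32 * norm a2 / A\<^sup>2)"
    using A C1 by (auto simp: L_def)
  show ?thesis
  proof (rule exI[of _ L], intro allI impI)
    fix z0 assume f0: "norm (f z0) \<ge> L" and w0: "norm (deriv f z0) > L * norm (f z0)"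
    define F0 where "F0 = norm (f z0)"
    have F0: "F0 \<ge> 1" "F0 \<ge> 24 * 256 * C1" using f0 L by (auto simp: F0_def)
    define W where "W = (\<lambda>z. deriv f z / f z)"
    have nz0: "f z0 \<noteq> 0" using F0 by (auto simp: F0_def)
    have Wz0: "norm (W z0) \<ge> L" using w0 nz0 by (simp add: W_def norm_divide field_simps)
    define c where "c = - (W z0 + a2 / a1) / a1"
    have "norm (W z0) - norm (a2 / a1) \<le> norm (W z0 + a2 / a1)" by (rule norm_diff_ineq)
    then have "L - norm a2 / A \<le> norm (W z0 + a2 / a1)" using Wz0 by (simp add: A_def norm_divide)
    then have "A * (2 + 32 * norm a2 / A\<^sup>2) \<le> norm (W z0 + a2 / a1)" using L(3) by linarith
    moreover have "norm c = norm (W z0 + a2 / a1) / A"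
      unfolding c_def A_def norm_divide norm_minus_cancel by (rule refl)
    ultimately have nc: "norm c \<ge> 2 + 32 * norm a2 / A\<^sup>2" using A by (simp add: le_divide_eq mult.commute)
    have nc2: "norm c \<ge> 2" using nc A by (smt (verit) divide_nonneg_pos norm_ge_zero zero_less_power)
    then have c0: "c \<noteq> 0" by auto
    \<comment> \<open>One of the two sixth roots of unity with real part 1/2, on the same side of
      the real axis as \<open>c\<close>. The angle between \<open>\<omega>\<close> and
      \<open>c\<close> is then at most 120 degrees, so the ray \<open>c + t \<omega>\<close> stays
      away from 0 and \<open>p t / c\<close> avoids the branch cut of \<open>Ln\<close>.\<close>
    define \<omega> where "\<omega> = Complex (1/2) (if Im c \<ge> 0 then sqrt 3 / 2 else - sqrt 3 / 2)"
    have \<omega>: "norm \<omega> = 1" "Re \<omega> = 1 / 2" by (auto simp: \<omega>_def cmod_def power_divide)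
    have \<omega>c: "Re (\<omega> * cnj c) \<ge> - norm c / 2"
    proof -
      have "Re (\<omega> * cnj c) = Re c / 2 + \<bar>Im c\<bar> * sqrt 3 / 2" by (auto simp: \<omega>_def)
      moreover have "Re c \<ge> - norm c" using abs_Re_le_cmod[of c] by linarith
      moreover have "\<bar>Im c\<bar> * sqrt 3 \<ge> 0" by simp
      ultimately show ?thesis by linarith
    qed
    define p where "p = (\<lambda>t::real. c + of_real t * \<omega>)"
    have p_low: "(norm c + t) / 2 \<le> norm (p t)" if t: "t \<ge> 0" for t
    proof -
      have "(norm (p t))\<^sup>2 = (norm c)\<^sup>2 + 2 * t * Re (\<omega> * cnj c) + t\<^sup>2 * (norm \<omega>)\<^sup>2"
      proof -
        have "(norm (p t))\<^sup>2 = Re ((c + of_real t * \<omega>) * cnj (c + of_real t * \<omega>))"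
          unfolding p_def by (simp only: Re_complex_of_real flip: complex_norm_square)
        also have "\<dots> = Re (c * cnj c) + 2 * t * Re (\<omega> * cnj c) + t\<^sup>2 * Re (\<omega> * cnj \<omega>)"
          by (simp add: power2_eq_square algebra_simps)
        finally show ?thesis by (simp only: Re_complex_of_real flip: complex_norm_square)
      qed
      also have "\<dots> \<ge> (norm c)\<^sup>2 + 2 * t * (- norm c / 2) + t\<^sup>2 * (norm \<omega>)\<^sup>2"
        using \<omega>c t by (intro add_mono mult_left_mono) auto
      finally have "(norm c)\<^sup>2 - t * norm c + t\<^sup>2 \<le> (norm (p t))\<^sup>2" by (simp add: \<omega>)
      moreover have "((norm c + t) / 2)\<^sup>2 \<le> (norm c)\<^sup>2 - t * norm c + t\<^sup>2"
      proof -
        have "(norm c)\<^sup>2 - t * norm c + t\<^sup>2 - ((norm c + t) / 2)\<^sup>2 = 3 / 4 * (norm c - t)\<^sup>2"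
          by (simp add: power2_eq_square field_simps)
        then show ?thesis using zero_le_power2[of "norm c - t"] by linarith
      qed
      ultimately have "((norm c + t) / 2)\<^sup>2 \<le> (norm (p t))\<^sup>2" by (rule order_trans[rotated])
      then show ?thesis by (rule power2_le_imp_le) simp
    qed
    have p1: "norm (p t) \<ge> 1" "16 * (norm a2 / A\<^sup>2) \<le> norm (p t)" if "t \<ge> 0" for t
    proof -
      show "norm (p t) \<ge> 1" using p_low[OF that] that nc2 by argo
      have "norm c \<ge> 2 + 32 * (norm a2 / A\<^sup>2)" using nc by simp
      then show "16 * (norm a2 / A\<^sup>2) \<le> norm (p t)" using p_low[OF that] that by argo
    qed
    have p0: "p t \<noteq> 0" if "t \<ge> 0" for t using p1(1)[OF that] by auto
    have pc: "p t / c = 1 + of_real t * \<omega> / c" for t using c0 by (simp add: p_def add_divide_distrib)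
    have slit: "p t / c \<notin> \<real>\<^sub>\<le>\<^sub>0" if t: "t \<ge> 0" for t
    proof
      assume "p t / c \<in> \<real>\<^sub>\<le>\<^sub>0"
      then obtain x where x: "x \<le> 0" "p t / c = of_real x" by (rule nonpos_Reals_cases)
      then have tw: "of_real t * \<omega> = of_real (x - 1) * c" using c0 by (simp add: pc field_simps)
      then have "norm (of_real t * \<omega>) = norm (of_real (x - 1) * c)" by (rule arg_cong)
      then have tn: "t = (1 - x) * norm c"
        using x t unfolding norm_mult norm_of_real \<omega> by simp
      have "Re (of_real t * \<omega> * cnj c) = Re (of_real (x - 1) * c * cnj c)" using tw by (rule arg_cong)
      moreover have "Re (of_real t * \<omega> * cnj c) = t * Re (\<omega> * cnj c)" by (simp add: algebra_simps)
      moreover have "Re (of_real (x - 1) * c * cnj c) = (x - 1) * (norm c)\<^sup>2"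
        by (simp only: mult.assoc complex_norm_square[symmetric] of_real_mult[symmetric] Re_complex_of_real)
      moreover have "t * Re (\<omega> * cnj c) \<ge> t * (- norm c / 2)" using \<omega>c t by (intro mult_left_mono) auto
      moreover have "t * (- norm c / 2) = (x - 1) * (norm c)\<^sup>2 / 2"
        by (simp add: tn power2_eq_square algebra_simps)
      moreover have "(x - 1) * (norm c)\<^sup>2 < 0" using x c0 by (simp add: mult_less_0_iff)
      ultimately show False by linarith
    qed
    \<comment> \<open>This solves \<open>c exp (- a1 (\<zeta> - z0)) = p t\<close> for
      \<open>\<zeta>\<close>.\<close>
    define Z where "Z = (\<lambda>t. z0 - Ln (p t / c) / a1)"
    define Z' where "Z' = (\<lambda>t. - \<omega> / (a1 * p t))"
    have p': "(p has_vector_derivative \<omega>) (at t)" for t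
      unfolding p_def by (auto intro!: derivative_eq_intros simp: has_vector_derivative_def scaleR_conv_of_real)
    have Z: "(Z has_vector_derivative Z' t) (at t)" if t: "t \<ge> 0" for t
    proof -
      have "((\<lambda>x. z0 - Ln (x / c) / a1) has_field_derivative - (1 / (p t * a1))) (at (p t))"
      proof -
        have "((\<lambda>x. x / c) has_field_derivative 1 / c) (at (p t))"
          using c0 by (auto intro!: derivative_eq_intros)
        from DERIV_chain2[OF has_field_derivative_Ln[OF slit[OF t]] this]
        have "((\<lambda>x. Ln (x / c)) has_field_derivative 1 / p t) (at (p t))"
          using c0 by simp
        from DERIV_cdivide[OF this, of a1]
        have "((\<lambda>x. Ln (x / c) / a1) has_field_derivative 1 / (p t * a1)) (at (p t))" by simp
        from DERIV_diff[OF DERIV_const this] show ?thesis by simp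
      qed
      from field_vector_diff_chain_at[OF p' this]
      show ?thesis by (simp add: o_def Z_def Z'_def mult.commute)
    qed
    have Z0: "Z 0 = z0" using c0 by (simp add: Z_def p_def)
    define F where "F = (\<lambda>t. f (Z t))"
    have F: "(F has_vector_derivative Z' t * deriv f (Z t)) (at t)" if "t \<ge> 0" for t
      using field_vector_diff_chain_at[OF Z[OF that] f_deriv] by (simp add: F_def o_def)
    \<comment> \<open>Without the perturbation, \<open>f'/f + a2 / a1\<close> would equal
      \<open>- a1 * p t\<close> along the curve. \<open>k\<close> is the ratio of the true value to
      this one, so it starts at 1 and its derivative contains only the perturbation.\<close>
    define k where "k = (\<lambda>t. - (W (Z t) + a2 / a1) / (a1 * p t))"
    define v where "v = (\<lambda>t. 1 / F t)"
    define Rr where "Rr = (\<lambda>t. b1 * v t + b2 * v t * W (Z t) + b3 * (v t)\<^sup>2)"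
    have Wk: "W (Z t) = - a1 * p t * k t - a2 / a1" if "t \<ge> 0" for t
      using a1 p0[OF that] by (simp add: k_def)
    have k0: "k 0 = 1" using a1 c0 nz0 by (auto simp: k_def Z0 p_def c_def)
    define k' where "k' = (\<lambda>t. Rr t * \<omega> / (a1 * p t)\<^sup>2)"
    have k: "(k has_vector_derivative k' t) (at t)" if t: "t \<ge> 0" and nz: "F t \<noteq> 0" for t
    proof -
      have "(W has_field_derivative (- a1 * W (Z t) - a2 + Rr t)) (at (Z t))"
        using log_deriv_ode[of "Z t"] nz unfolding W_def Rr_def v_def F_def by simp
      from field_vector_diff_chain_at[OF Z[OF t] this]
      have WZ: "((\<lambda>t. W (Z t)) has_vector_derivative Z' t * (- a1 * W (Z t) - a2 + Rr t)) (at t)"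
        by (simp add: o_def)
      have WZ2: "((\<lambda>t. W (Z t) + a2 / a1) has_vector_derivative Z' t * (- a1 * W (Z t) - a2 + Rr t)) (at t)"
        using WZ by (simp only: has_vector_derivative_add_const)
      have "((\<lambda>x. 1 / x) has_field_derivative - (1 / (p t)\<^sup>2)) (at (p t))"
        using p0[OF t] by (auto intro!: derivative_eq_intros simp: power2_eq_square)
      from field_vector_diff_chain_at[OF p' this]
      have ip: "((\<lambda>t. 1 / p t) has_vector_derivative - \<omega> / (p t)\<^sup>2) (at t)" by (simp add: o_def)
      have "((\<lambda>t. (W (Z t) + a2 / a1) * (1 / p t) * (- 1 / a1)) has_vector_derivative
         ((W (Z t) + a2 / a1) * (- \<omega> / (p t)\<^sup>2) + Z' t * (- a1 * W (Z t) - a2 + Rr t) * (1 / p t)) * (- 1 / a1)) (at t)"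
        by (rule has_vector_derivative_mult_left[OF has_vector_derivative_mult[OF WZ2 ip]])
      moreover have "((W (Z t) + a2 / a1) * (- \<omega> / (p t)\<^sup>2) + Z' t * (- a1 * W (Z t) - a2 + Rr t) * (1 / p t)) * (- 1 / a1) = k' t"
      proof -
        have gen: "((Wz + a2 / a) * (- \<omega> / P\<^sup>2) + - \<omega> / (a * P) * (- a * Wz - a2 + R) * (1 / P)) * (- 1 / a) = R * \<omega> / (a * P)\<^sup>2"
          if "a \<noteq> 0" "P \<noteq> 0" for a P Wz R :: complex
          using that by (simp add: divide_simps) (simp add: algebra_simps power2_eq_square)
        show ?thesis unfolding Z'_def k'_def by (rule gen[OF a1 p0[OF t]])
      qed
      moreover have "(\<lambda>t. (W (Z t) + a2 / a1) * (1 / p t) * (- 1 / a1)) = k"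
        using a1 by (auto simp: k_def fun_eq_iff field_simps)
      ultimately show ?thesis by simp
    qed
    \<comment> \<open>\<open>U >= 0\<close> says \<open>|f| >= F0 exp (t / 8)\<close> on the curve.
      As long as this holds, \<open>1/f\<close> is integrable in \<open>t\<close>, which keeps
      \<open>k\<close> near 1; that in turn makes \<open>U\<close> increase.
      \<open>stays_nonneg\<close> closes the circle.\<close>
    define U where "U = (\<lambda>t. (norm (F t))\<^sup>2 * exp (- t / 4) - F0\<^sup>2)"
    define U' where "U' = (\<lambda>t. (2 * Re (cnj (F t) * (Z' t * deriv f (Z t))) - (norm (F t))\<^sup>2 / 4) * exp (- t / 4))"
    have U: "(U has_real_derivative U' t) (at t)" if "t \<ge> 0" for t
    proof -
      have "((\<lambda>t. exp (- t / 4)) has_real_derivative - exp (- t / 4) / 4) (at t)"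
        by (auto intro!: derivative_eq_intros)
      from DERIV_diff[OF DERIV_mult[OF norm_sq_has_deriv[OF F[OF that]] this] DERIV_const[of "F0\<^sup>2"]]
      show ?thesis unfolding U_def U'_def by (simp add: algebra_simps)
    qed
    have Fge: "norm (F t) \<ge> F0 * exp (t / 8)" if "U t \<ge> 0" for t
    proof -
      have "(F0 * exp (t / 8))\<^sup>2 = F0\<^sup>2 * exp (t / 4)" by (simp add: power_mult_distrib flip: exp_double)
      also have "\<dots> \<le> (norm (F t))\<^sup>2 * exp (- t / 4) * exp (t / 4)"
        using that by (intro mult_right_mono) (auto simp: U_def)
      also have "\<dots> = (norm (F t))\<^sup>2" by (simp add: mult.assoc flip: exp_add)
      finally show ?thesis by (rule power2_le_imp_le) simp
    qed
    have "U t \<ge> 0" if "t \<ge> 0" for t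
    proof (rule stays_nonneg[OF U _ _ that])
      show "U 0 \<ge> 0" by (simp add: U_def F_def Z0 F0_def)
      fix t :: real assume t: "t \<ge> 0" and Us: "\<And>s. 0 \<le> s \<Longrightarrow> s \<le> t \<Longrightarrow> U s \<ge> 0"
      have Fs: "norm (F s) \<ge> F0 * exp (s / 8)" if "0 \<le> s" "s \<le> t" for s
        using Fge Us that by blast
      have Fnz: "F s \<noteq> 0" if "0 \<le> s" "s \<le> t" for s
      proof -
        have "F0 * exp (s / 8) > 0" using F0 by simp
        then show ?thesis using Fs[OF that] by auto
      qed
      have vs: "norm (v s) \<le> exp (- s / 8) / F0" "norm (v s) \<le> 1" if "0 \<le> s" "s \<le> t" for s
      proof -
        have "norm (v s) = 1 / norm (F s)" by (simp add: v_def norm_divide)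
        also have "\<dots> \<le> 1 / (F0 * exp (s / 8))"
        proof (rule divide_left_mono[OF Fs[OF that]])
          have "F0 * exp (s / 8) > 0" using F0 by simp
          then show "0 < norm (F s) * (F0 * exp (s / 8))" using Fnz[OF that] by simp
        qed simp
        also have "\<dots> = exp (- s / 8) / F0" by (simp add: exp_minus field_simps)
        finally show 1: "norm (v s) \<le> exp (- s / 8) / F0" .
        also have "\<dots> \<le> 1 / 1" using F0 that by (intro frac_le) auto
        finally show "norm (v s) \<le> 1" by simp
      qed
      have Rs: "norm (k' s) \<le> C1 * norm (v s) * (norm (k s - 1) + 2)" if s: "0 \<le> s" "s \<le> t" for s
      proof -
        have ps: "norm (p s) \<ge> 1" using p1[OF s(1)] by simp
        have "norm (W (Z s)) \<le> A * norm (p s) * norm (k s) + norm a2 / A"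
          unfolding Wk[OF s(1)] A_def
          using norm_triangle_ineq4[of "- a1 * p s * k s" "a2 / a1"] by (simp add: norm_mult norm_divide)
        also have "\<dots> \<le> A * (norm (p s) * (norm (k s) + 1)) + norm a2 / A * (norm (p s) * (norm (k s) + 1))"
        proof (rule add_mono)
          show "A * norm (p s) * norm (k s) \<le> A * (norm (p s) * (norm (k s) + 1))"
            unfolding mult.assoc using A by (intro mult_left_mono) auto
          have "1 \<le> norm (p s) * (norm (k s) + 1)" using ps mult_mono[of 1 "norm (p s)" 1 "norm (k s) + 1"] by simp
          from mult_left_mono[OF this, of "norm a2 / A"]
          show "norm a2 / A \<le> norm a2 / A * (norm (p s) * (norm (k s) + 1))" using A by simp
        qed
        finally have Wb: "norm (W (Z s)) \<le> (A + norm a2 / A) * (norm (p s) * (norm (k s) + 1))"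
          by (simp add: algebra_simps)
        define Y where "Y = norm (p s) * (norm (k s) + 1)"
        have Y1: "Y \<ge> 1" using ps mult_mono[of 1 "norm (p s)" 1 "norm (k s) + 1"] by (simp add: Y_def)
        have vv: "norm (v s) \<le> 1" using vs s by blast
        have "norm (Rr s) \<le> norm (b1 * v s) + norm (b2 * v s * W (Z s)) + norm (b3 * (v s)\<^sup>2)"
          unfolding Rr_def by norm
        also have "\<dots> \<le> norm (v s) * (norm b1 * Y) + norm (v s) * (norm b2 * ((A + norm a2 / A) * Y)) + norm (v s) * (norm b3 * Y)"
        proof (intro add_mono)
          show "norm (b1 * v s) \<le> norm (v s) * (norm b1 * Y)"
            unfolding norm_mult using Y1 mult_left_mono[OF Y1, of "norm b1 * norm (v s)"] by (simp add: mult_ac)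
          show "norm (b2 * v s * W (Z s)) \<le> norm (v s) * (norm b2 * ((A + norm a2 / A) * Y))"
            unfolding norm_mult using Wb mult_left_mono[OF Wb, of "norm (v s) * norm b2"] by (simp add: mult_ac Y_def)
          have "norm (v s) * (norm (v s) * norm b3) \<le> norm (v s) * (Y * norm b3)"
            using vv Y1 by (intro mult_left_mono mult_right_mono) auto
          then show "norm (b3 * (v s)\<^sup>2) \<le> norm (v s) * (norm b3 * Y)"
            by (simp add: norm_mult norm_power power2_eq_square mult_ac)
        qed
        also have "\<dots> = C * norm (v s) * Y" by (simp add: C_def algebra_simps)
        finally have Rb: "norm (Rr s) \<le> C * norm (v s) * Y" .
        have "norm (k' s) = norm (Rr s) / (A\<^sup>2 * (norm (p s))\<^sup>2)"
          by (simp add: k'_def norm_divide norm_mult norm_power \<omega> A_def power_mult_distrib)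
        also have "\<dots> \<le> C * norm (v s) * Y / (A\<^sup>2 * (norm (p s))\<^sup>2)"
          using Rb by (intro divide_right_mono) auto
        also have "\<dots> = C1 * norm (v s) * (norm (k s) + 1) / norm (p s)"
          using ps A by (simp add: Y_def C1_def power2_eq_square)
        also have "\<dots> \<le> C1 * norm (v s) * (norm (k s) + 1) / 1"
          using ps C1 by (intro divide_left_mono) auto
        also have "\<dots> \<le> C1 * norm (v s) * (norm (k s - 1) + 2)"
          using C1 norm_triangle_sub[of "k s" 1] by (auto intro!: mult_left_mono)
        finally show ?thesis .
      qed
      \<comment> \<open>With \<open>x = |k - 1|\<close> the growth of \<open>x^2\<close> is governed
        by \<open>2 x (x + 2)\<close>, which is not a multiple of \<open>x^2\<close>; it is at most
        \<open>3 (x^2 + 4)\<close>, so adding 4 makes Gronwall applicable. The total exponent is at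
        most \<open>24 C1 / F0 <= 1/256\<close>, and \<open>4 exp (1/256) - 4\<close> is below
        \<open>1/16\<close>.\<close>
      have "(norm (k t - 1))\<^sup>2 + 4 \<le> ((norm (k 0 - 1))\<^sup>2 + 4) * exp (- (24 * C1 / F0) * exp (- t / 8) - - (24 * C1 / F0) * exp (- 0 / 8))"
      proof (rule gronwall_real[OF t])
        fix s assume s: "0 \<le> s" "s \<le> t"
        have "((\<lambda>t. k t - 1) has_vector_derivative k' s) (at s)"
          using k[OF s(1) Fnz[OF s]] has_vector_derivative_diff[OF _ has_vector_derivative_const] by fastforce
        from DERIV_add[OF norm_sq_has_deriv[OF this] DERIV_const[of 4]]
        show "((\<lambda>t. (norm (k t - 1))\<^sup>2 + 4) has_real_derivative 2 * Re (cnj (k s - 1) * k' s)) (at s)"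
          by simp
        show "((\<lambda>t. - (24 * C1 / F0) * exp (- t / 8)) has_real_derivative (3 * C1 / F0) * exp (- s / 8)) (at s)"
          using F0 by (auto intro!: derivative_eq_intros)
        define x where "x = norm (k s - 1)"
        have "Re (cnj (k s - 1) * k' s) \<le> norm (cnj (k s - 1) * k' s)" by (rule complex_Re_le_cmod)
        also have "\<dots> = x * norm (k' s)" unfolding norm_mult complex_mod_cnj x_def by (rule refl)
        also have "\<dots> \<le> x * (C1 * norm (v s) * (x + 2))"
          using Rs[OF s] by (intro mult_left_mono) (auto simp: x_def)
        finally have "2 * Re (cnj (k s - 1) * k' s) \<le> 2 * (x * (C1 * norm (v s) * (x + 2)))"
          by (rule mult_left_mono) simp
        also have "\<dots> = (C1 * norm (v s)) * (2 * (x * (x + 2)))" by simp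
        also have "\<dots> \<le> (C1 * norm (v s)) * (3 * (x\<^sup>2 + 4))"
          using C1 sum_power2_ge_zero[of "x - 2" 0]
          by (intro mult_left_mono) (auto simp: power2_eq_square algebra_simps)
        also have "\<dots> = (3 * C1 * (x\<^sup>2 + 4)) * norm (v s)" by simp
        also have "\<dots> \<le> (3 * C1 * (x\<^sup>2 + 4)) * (exp (- s / 8) / F0)"
          using C1 vs(1)[OF s] by (intro mult_left_mono) auto
        also have "\<dots> = (3 * C1 / F0) * exp (- s / 8) * (x\<^sup>2 + 4)" by simp
        finally show "2 * Re (cnj (k s - 1) * k' s) \<le> (3 * C1 / F0) * exp (- s / 8) * ((norm (k s - 1))\<^sup>2 + 4)"
          by (simp add: x_def)
      qed
      also have "\<dots> \<le> 4 * (1 + 2 * (1 / 256))"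
      proof -
        have q: "24 * C1 / F0 \<le> 1 / 256" "24 * C1 / F0 \<ge> 0" using F0 C1 by (auto simp: field_simps)
        have "- (24 * C1 / F0) * exp (- t / 8) - - (24 * C1 / F0) * exp (- 0 / 8) = 24 * C1 / F0 * (1 - exp (- t / 8))"
          by (simp add: algebra_simps)
        also have "\<dots> \<le> 24 * C1 / F0 * 1" using q by (intro mult_left_mono) auto
        finally have "exp (- (24 * C1 / F0) * exp (- t / 8) - - (24 * C1 / F0) * exp (- 0 / 8)) \<le> exp (1 / 256)"
          using q by simp
        also have "exp (1 / 256) \<le> 1 + 2 * (1 / 256 :: real)"
          using exp_bound_lemma[of "1 / 256 :: real"] by simp
        finally show ?thesis by (simp add: k0)
      qed
      finally have "(norm (k t - 1))\<^sup>2 \<le> (1 / 4)\<^sup>2" by (simp add: power2_eq_square)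
      then have kt: "norm (k t - 1) \<le> 1 / 4" by (rule power2_le_imp_le) simp
      have eq: "Z' t * W (Z t) = \<omega> * k t + a2 * \<omega> / (a1\<^sup>2 * p t)"
        unfolding Wk[OF t] Z'_def using a1 p0[OF t] by (simp add: divide_simps) (simp add: algebra_simps power2_eq_square)
      have "norm (\<omega> * (k t - 1)) \<le> 1 / 4" using kt by (simp add: norm_mult \<omega>)
      then have "Re (\<omega> * (k t - 1)) \<ge> - 1 / 4" using abs_Re_le_cmod[of "\<omega> * (k t - 1)"] by linarith
      moreover have "Re (\<omega> * k t) = Re \<omega> + Re (\<omega> * (k t - 1))" by (simp add: algebra_simps)
      ultimately have r1: "Re (\<omega> * k t) \<ge> 1 / 4" using \<omega> by linarith
      have "norm (a2 * \<omega> / (a1\<^sup>2 * p t)) = norm a2 / A\<^sup>2 / norm (p t)"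
        by (simp add: norm_divide norm_mult norm_power \<omega> A_def)
      also have "\<dots> \<le> (norm (p t) / 16) / norm (p t)"
      proof (rule divide_right_mono)
        show "norm a2 / A\<^sup>2 \<le> norm (p t) / 16" using p1(2)[OF t] by linarith
      qed simp
      also have "\<dots> = 1 / 16" using p0[OF t] by simp
      finally have "Re (a2 * \<omega> / (a1\<^sup>2 * p t)) \<ge> - 1 / 16"
        using abs_Re_le_cmod[of "a2 * \<omega> / (a1\<^sup>2 * p t)"] by linarith
      then have ReW: "Re (Z' t * W (Z t)) > 1 / 8" unfolding eq using r1 by simp
      have "cnj (F t) * (Z' t * deriv f (Z t)) = (Z' t * W (Z t)) * (F t * cnj (F t))"
        using Fnz[OF t order_refl] by (simp add: W_def F_def)
      also have "\<dots> = (Z' t * W (Z t)) * of_real ((norm (F t))\<^sup>2)" by (simp only: complex_norm_square)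
      finally have eqF: "cnj (F t) * (Z' t * deriv f (Z t)) = (Z' t * W (Z t)) * of_real ((norm (F t))\<^sup>2)" .
      have "Re (x * of_real r) = Re x * r" for x r by simp
      then have "Re (cnj (F t) * (Z' t * deriv f (Z t))) = Re (Z' t * W (Z t)) * (norm (F t))\<^sup>2"
        unfolding eqF by blast
      moreover have "1 / 8 * (norm (F t))\<^sup>2 < Re (Z' t * W (Z t)) * (norm (F t))\<^sup>2"
        using ReW Fnz[OF t order_refl] by (intro mult_strict_right_mono) auto
      ultimately show "U' t > 0" by (simp add: U'_def)
    qed
    then have Fexp: "norm (f (Z t)) \<ge> exp (t / 8)" if "t \<ge> 0" for t
    proof -
      have "exp (t / 8) \<le> F0 * exp (t / 8)" using F0 by simp
      also have "\<dots> \<le> norm (F t)" using Fge \<open>\<And>t. t \<ge> 0 \<Longrightarrow> U t \<ge> 0\<close> that by blast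
      finally show ?thesis by (simp add: F_def)
    qed
    have Zup: "norm (Z t) \<le> norm z0 + (ln (1 + t) + 5) / A"
      and Zlow: "norm (Z t) \<ge> (ln (1 + t / norm c) - 1) / A - norm z0" if t: "t \<ge> 0" for t
    proof -
      define x where "x = p t / c"
      have x0: "x \<noteq> 0" using p0[OF t] c0 by (simp add: x_def)
      have xlow: "(1 + t / norm c) / 2 \<le> norm x"
      proof -
        have "(1 + t / norm c) / 2 = (norm c + t) / 2 / norm c" using c0 by (simp add: add_divide_distrib)
        also have "\<dots> \<le> norm (p t) / norm c" using p_low[OF t] by (rule divide_right_mono) simp
        finally show ?thesis by (simp add: x_def norm_divide)
      qed
      have "norm x \<le> 1 + t / norm c"
        unfolding x_def pc using norm_triangle_ineq[of 1 "of_real t * \<omega> / c"] t by (simp add: norm_divide norm_mult \<omega>)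
      moreover have "t / norm c \<le> t / 1" using nc2 t by (intro divide_left_mono) auto
      ultimately have "ln (norm x) \<le> ln (1 + t)" using x0 by (intro ln_mono) auto
      have tc: "t / norm c \<ge> 0" using t by simp
      have "ln ((1 + t / norm c) / 2) \<le> ln (norm x)" using xlow tc by (intro ln_mono) auto
      moreover have "ln ((1 + t / norm c) / 2) = ln (1 + t / norm c) - ln 2"
        using tc by (intro ln_divide_pos) auto
      moreover have "ln 2 \<le> (1::real)" using ln_le_minus_one[of 2] by simp
      ultimately have lnx: "ln (1 + t / norm c) - 1 \<le> ln (norm x)" by linarith
      have "ln (1 + t / norm c) \<ge> 0" "ln (1 + t) \<ge> 0" using tc t by simp_all
      then have "\<bar>ln (norm x)\<bar> \<le> ln (1 + t) + 1"
        using lnx \<open>ln (norm x) \<le> ln (1 + t)\<close> by linarith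
      moreover have "\<bar>Im (Ln x)\<bar> \<le> 4" using mpi_less_Im_Ln[OF x0] Im_Ln_le_pi[OF x0] pi_less_4 by linarith
      moreover have "Re (Ln x) = ln (norm x)" using x0 by simp
      ultimately have "norm (Ln x) \<le> ln (1 + t) + 5" using cmod_le[of "Ln x"] by linarith
      then have "norm (Ln x / a1) \<le> (ln (1 + t) + 5) / A"
        using A by (simp add: norm_divide A_def divide_right_mono)
      moreover have "norm (Z t) \<le> norm z0 + norm (Ln x / a1)" unfolding Z_def x_def by (rule norm_triangle_ineq4)
      ultimately show "norm (Z t) \<le> norm z0 + (ln (1 + t) + 5) / A" by linarith
      have "ln (1 + t / norm c) - 1 \<le> norm (Ln x)"
        using lnx \<open>Re (Ln x) = ln (norm x)\<close> complex_Re_le_cmod[of "Ln x"] by linarith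
      then have "(ln (1 + t / norm c) - 1) / A \<le> norm (Ln x / a1)"
        using A by (simp add: norm_divide A_def divide_right_mono)
      moreover have "norm (Ln x / a1) - norm z0 \<le> norm (Z t)"
        unfolding Z_def x_def[symmetric] using norm_triangle_ineq2[of "Ln x / a1" z0] by (simp add: norm_minus_commute)
      ultimately show "norm (Z t) \<ge> (ln (1 + t / norm c) - 1) / A - norm z0" by linarith
    qed
    \<comment> \<open>\<open>|Z t|\<close> is at most \<open>ln (1 + t) / A\<close> up to a
      constant. With the constant \<open>A / 2\<close> the inner exponential is therefore only of
      order \<open>sqrt (1 + t)\<close>, well below the exponent \<open>t / 8\<close> known for
      \<open>|f|\<close>.\<close>
    have "\<exists>z. norm z \<ge> R \<and> norm (f z) \<ge> exp (exp (A / 2 * norm z))" for R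
    proof -
      define n where "n = norm c"
      have n: "n > 0" using c0 by (simp add: n_def)
      define D where "D = exp (A * norm z0 / 2 + 5 / 2)"
      have D: "D > 0" by (simp add: D_def)
      have "LIM t at_top. (ln (1 + t / n) - 1) / A - norm z0 :> at_top"
        using n A by real_asymp
      then have e1: "\<forall>\<^sub>F t in at_top. R \<le> (ln (1 + t / n) - 1) / A - norm z0"
        by (simp add: filterlim_at_top)
      have e2: "\<forall>\<^sub>F t in at_top. D * sqrt (1 + t) \<le> t / 8"
        using D by real_asymp
      from eventually_happens[OF eventually_conj[OF eventually_ge_at_top[of 0] eventually_conj[OF e1 e2]]]
      obtain t where t: "t \<ge> 0" "R \<le> (ln (1 + t / n) - 1) / A - norm z0" "D * sqrt (1 + t) \<le> t / 8" by auto
      have "A / 2 * norm (Z t) \<le> A / 2 * (norm z0 + (ln (1 + t) + 5) / A)"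
        using Zup[OF t(1)] A by (intro mult_left_mono) auto
      also have "\<dots> = (A * norm z0 / 2 + 5 / 2) + ln (1 + t) / 2" using A by (simp add: field_simps)
      finally have "exp (A / 2 * norm (Z t)) \<le> exp ((A * norm z0 / 2 + 5 / 2) + ln (1 + t) / 2)" by simp
      also have "\<dots> = D * exp (ln (1 + t) / 2)" by (simp add: D_def exp_add)
      also have "exp (ln (1 + t) / 2) = sqrt (1 + t)"
      proof -
        have "(exp (ln (1 + t) / 2))\<^sup>2 = 1 + t" using t(1) by (simp flip: exp_double)
        then show ?thesis by (intro real_sqrt_unique[symmetric]) auto
      qed
      finally have "exp (A / 2 * norm (Z t)) \<le> t / 8" using t(3) by linarith
      then have "exp (exp (A / 2 * norm (Z t))) \<le> exp (t / 8)" by simp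
      also have "\<dots> \<le> norm (f (Z t))" using Fexp t by blast
      finally show ?thesis using Zlow[OF t(1)] t(2) unfolding n_def by (intro exI[of _ "Z t"]) auto
    qed
    then show "\<exists>c>0. \<forall>R. \<exists>z. norm z \<ge> R \<and> norm (f z) \<ge> exp (exp (c * norm z))"
      using A by (intro exI[of _ "A / 2"]) auto
  qed
qed

end

subsection \<open>Quotients of entire functions\<close>

lemma entire_zero_factor:
  assumes E: "entire E" and "E z0 = 0"
  obtains G where "entire G" "\<And>z. E z = (z - z0) * G z" "G z0 = deriv E z0"
proof
  define G where "G = (\<lambda>z. if z = z0 then deriv E z0 else E z / (z - z0))"
  show "entire G"
    by (rule pole_theorem_0[OF E, of z0]) (auto simp: G_def assms)
  show "E z = (z - z0) * G z" for z using assms by (auto simp: G_def)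
  show "G z0 = deriv E z0" by (simp add: G_def)
qed

lemma entire_isolated_zero:
  assumes "entire f" "f z1 \<noteq> 0" "f z0 = 0"
  obtains r where "r > 0" "\<And>z. z \<in> ball z0 r - {z0} \<Longrightarrow> f z \<noteq> 0"
  using isolated_zeros[of f UNIV z0 z1] assms by (metis UNIV_I connected_UNIV open_UNIV)

lemma entire_mult_eq_0:
  assumes f: "entire f" "f z1 \<noteq> 0" and g: "entire g" and fg: "\<And>z. f z * g z = 0"
  shows "g z = 0"
proof (cases "f z = 0")
  case True
  obtain r where r: "r > 0" "\<And>w. w \<in> ball z r - {z} \<Longrightarrow> f w \<noteq> 0"
    using entire_isolated_zero[OF f True] by blast
  have "\<forall>\<^sub>F w in at z. w \<in> ball z r - {z}"
    using r by (auto simp: eventually_at dist_commute)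
  then have "\<forall>\<^sub>F w in at z. g w = 0"
    by eventually_elim (use r fg in \<open>metis mult_eq_0_iff\<close>)
  then have "(g \<longlongrightarrow> 0) (at z)" by (simp add: tendsto_eventually)
  moreover have "(g \<longlongrightarrow> g z) (at z)" using entire_isCont[OF g] by (simp add: isCont_def)
  ultimately show ?thesis using tendsto_unique by (metis at_neq_bot)
qed (use fg[of z] in auto)

text \<open>By the removable singularity theorem a finite limit at each zero of \<open>f\<close>
  suffices. The zeros are isolated, so the limit can be used as the value of the quotient.\<close>

lemma entire_quotient:
  assumes f: "entire f" "f z1 \<noteq> 0" and N: "entire N"
    and lim: "\<And>z. f z = 0 \<Longrightarrow> \<exists>c. ((\<lambda>w. N w / f w) \<longlongrightarrow> c) (at z)"
  obtains q where "entire q" "\<And>z. N z = q z * f z"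
proof -
  define q where "q = (\<lambda>z. if f z = 0 then Lim (at z) (\<lambda>w. N w / f w) else N z / f z)"
  have lim': "((\<lambda>w. N w / f w) \<longlongrightarrow> q z) (at z)" if "f z = 0" for z
    using lim[OF that] that tendsto_Lim[OF at_neq_bot] by (auto simp: q_def)
  have "q field_differentiable (at z)" for z
  proof (cases "f z = 0")
    case False
    have "isCont f z" using f by (simp add: entire_isCont)
    then have "\<forall>\<^sub>F w in nhds z. f w \<noteq> 0"
      using False by (simp add: continuous_at tendsto_imp_eventually_ne isCont_def eventually_nhds_conv_at)
    then obtain S where S: "open S" "z \<in> S" "\<And>w. w \<in> S \<Longrightarrow> f w \<noteq> 0"
      unfolding eventually_nhds by blast
    have "(\<lambda>w. N w / f w) holomorphic_on S"
      using f N S by (intro holomorphic_intros) (auto intro: holomorphic_on_subset)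
    then have "q holomorphic_on S"
      by (rule holomorphic_transform) (use S in \<open>auto simp: q_def\<close>)
    then show ?thesis using S by (meson holomorphic_on_open field_differentiable_def)
  next
    case True
    obtain r where r: "r > 0" "\<And>w. w \<in> ball z r - {z} \<Longrightarrow> f w \<noteq> 0"
      using entire_isolated_zero[OF f True] by blast
    have "(\<lambda>w. N w / f w) holomorphic_on (ball z r - {z})"
      using f N r by (intro holomorphic_intros) (auto intro: holomorphic_on_subset)
    then have hol: "q holomorphic_on (ball z r - {z})"
      by (rule holomorphic_transform) (use r in \<open>auto simp: q_def\<close>)
    have "\<forall>\<^sub>F w in at z. w \<in> ball z r - {z}"
      using r by (auto simp: eventually_at dist_commute)
    then have "\<forall>\<^sub>F w in at z. N w / f w = q w"
      by eventually_elim (use r in \<open>auto simp: q_def\<close>)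
    with lim'[OF True] have "(q \<longlongrightarrow> q z) (at z)" by (rule Lim_transform_eventually)
    then have "(q \<longlongrightarrow> q z) (at z within ball z r)" by (rule tendsto_within_subset) simp
    then have "q holomorphic_on ball z r"
      using no_isolated_singularity'[of "{z}" q "ball z r"] hol by auto
    then show ?thesis using r by (meson centre_in_ball holomorphic_on_open field_differentiable_def open_ball)
  qed
  then have "entire q" by (simp add: holomorphic_on_def)
  moreover have "N z = q z * f z" for z
  proof (cases "f z = 0")
    case True
    obtain r where r: "r > 0" "\<And>w. w \<in> ball z r - {z} \<Longrightarrow> f w \<noteq> 0"
      using entire_isolated_zero[OF f True] by blast
    have "(f \<longlongrightarrow> f z) (at z)" using entire_isCont[OF f(1)] by (simp add: isCont_def)
    from tendsto_mult[OF lim'[OF True] this]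
    have l: "((\<lambda>w. N w / f w * f w) \<longlongrightarrow> 0) (at z)" using True by simp
    have "\<forall>\<^sub>F w in at z. w \<in> ball z r - {z}"
      using r by (auto simp: eventually_at dist_commute)
    then have "\<forall>\<^sub>F w in at z. N w / f w * f w = N w"
      by eventually_elim (use r in auto)
    with l have "(N \<longlongrightarrow> 0) (at z)" by (rule Lim_transform_eventually)
    moreover have "(N \<longlongrightarrow> N z) (at z)" using entire_isCont[OF N] by (simp add: isCont_def)
    ultimately have "N z = 0" using tendsto_unique by (metis at_neq_bot)
    then show ?thesis using True by simp
  qed (simp add: q_def)
  ultimately show ?thesis by (rule that)
qed

lemma entire_quotient_simple:
  assumes f: "entire f" "f z1 \<noteq> 0" and N: "entire N"
    and z: "\<And>z. f z = 0 \<Longrightarrow> N z = 0 \<and> deriv f z \<noteq> 0"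
  obtains q where "entire q" "\<And>z. N z = q z * f z"
proof -
  have "\<exists>c. ((\<lambda>w. N w / f w) \<longlongrightarrow> c) (at z)" if "f z = 0" for z
    using lhopital_complex_simple[OF entire_has_deriv[OF N] entire_has_deriv[OF f(1)], of z] z[OF that] that by blast
  from entire_quotient[OF f N this] show ?thesis using that by blast
qed

text \<open>The local factorisation at \<open>z0\<close> supplies the limit required by
  \<open>entire_quotient\<close>, which makes the cofactor entire.\<close>

lemma entire_zero_order:
  assumes f: "entire f" "f z1 \<noteq> 0" "f z0 = 0"
  obtains n F where "n > 0" "entire F" "F z0 \<noteq> 0" "\<And>z. f z = (z - z0) ^ n * F z"
proof -
  have nc: "\<not> f constant_on UNIV" using f unfolding constant_on_def by (metis UNIV_I)
  obtain g r n where g: "0 < n" "0 < r" "g holomorphic_on ball z0 r"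
      "\<And>w. w \<in> ball z0 r \<Longrightarrow> f w = (w - z0) ^ n * g w" "\<And>w. w \<in> ball z0 r \<Longrightarrow> g w \<noteq> 0"
    using holomorphic_factor_zero_nonconstant[OF f(1) open_UNIV connected_UNIV UNIV_I f(3) nc] by metis
  have gl: "(g \<longlongrightarrow> g z0) (at z0)"
    using g(2,3) by (meson centre_in_ball continuous_on_eq_continuous_at holomorphic_on_imp_continuous_on isCont_def open_ball)
  have ev: "\<forall>\<^sub>F w in at z0. w \<in> ball z0 r - {z0}"
    using g by (auto simp: eventually_at dist_commute)
  then have "\<forall>\<^sub>F w in at z0. g w = f w / (w - z0) ^ n"
    by eventually_elim (use g in auto)
  with gl have l: "((\<lambda>w. f w / (w - z0) ^ n) \<longlongrightarrow> g z0) (at z0)" by (rule Lim_transform_eventually)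
  obtain F where F: "entire F" "\<And>z. f z = F z * (z - z0) ^ n"
  proof (rule entire_quotient[of "\<lambda>z. (z - z0) ^ n" "z0 + 1" f])
    show "\<exists>c. ((\<lambda>w. f w / (w - z0) ^ n) \<longlongrightarrow> c) (at z)" if "(z - z0) ^ n = 0" for z
      using that l by auto
  qed (use f in \<open>auto intro!: holomorphic_intros\<close>)
  have "\<forall>\<^sub>F w in at z0. f w / (w - z0) ^ n = F w"
    using ev by eventually_elim (auto simp: F)
  with l have "(F \<longlongrightarrow> g z0) (at z0)" by (rule Lim_transform_eventually)
  moreover have "(F \<longlongrightarrow> F z0) (at z0)" using entire_isCont[OF F(1)] by (simp add: isCont_def)
  ultimately have "F z0 = g z0" using tendsto_unique by (metis at_neq_bot)
  then show ?thesis using that[of n F] g F by (simp add: mult.commute)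
qed

lemma poly_norm_bound:
  fixes p :: "complex poly"
  obtains B where "\<And>z. 1 \<le> norm z \<Longrightarrow> norm (poly p z) \<le> B * norm z ^ degree p"
proof
  fix z :: complex assume z: "1 \<le> norm z"
  have "norm (poly p z) \<le> (\<Sum>i\<le>degree p. norm (coeff p i * z ^ i))"
    unfolding poly_altdef by (rule norm_sum)
  also have "\<dots> \<le> (\<Sum>i\<le>degree p. norm (coeff p i) * norm z ^ degree p)"
    unfolding norm_mult norm_power using z by (intro sum_mono mult_left_mono power_increasing) auto
  finally show "norm (poly p z) \<le> (\<Sum>i\<le>degree p. norm (coeff p i)) * norm z ^ degree p"
    by (simp add: sum_distrib_right)
qed

text \<open>A nonzero \<open>p\<close> is bounded away from 0 near infinity, so \<open>f\<close>
  would have at most polynomial growth.\<close>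

lemma transcendental_poly_relation:
  assumes tr: "transcendental_entire f" and eq: "\<And>z. poly p z * f z = poly r z"
  shows "p = 0 \<and> r = 0"
proof -
  have f: "entire f" using tr by (simp add: transcendental_entire_def)
  have p0: "p = 0"
  proof (rule ccontr)
    assume "p \<noteq> 0"
    have "\<exists>R d. d > 0 \<and> (\<forall>z. R \<le> norm z \<longrightarrow> d \<le> norm (poly p z))"
    proof (cases p)
      case (pCons a p')
      show ?thesis
      proof (cases "p' = 0")
        case True
        then show ?thesis using \<open>p \<noteq> 0\<close> pCons by (intro exI[of _ 0] exI[of _ "norm a"]) auto
      next
        case False
        from poly_infinity[OF this, of 1 a] show ?thesis using pCons zero_less_one by blast
      qed
    qed
    then obtain R d where Rd: "d > 0" "\<And>z. R \<le> norm z \<Longrightarrow> d \<le> norm (poly p z)" by blast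
    obtain B where B: "\<And>z. 1 \<le> norm z \<Longrightarrow> norm (poly r z) \<le> B * norm z ^ degree r"
      using poly_norm_bound[of r] by blast
    have "norm (f z) \<le> B / d * norm z ^ degree r" if "max R 1 \<le> norm z" for z
    proof -
      have "d * norm (f z) \<le> norm (poly p z) * norm (f z)" using Rd(2)[of z] that by (intro mult_right_mono) auto
      also have "\<dots> = norm (poly r z)" by (simp add: eq flip: norm_mult)
      also have "\<dots> \<le> B * norm z ^ degree r" using that by (intro B) simp
      finally show ?thesis using Rd(1) by (simp add: field_simps)
    qed
    then have "\<exists>p. f = poly p" by (rule entire_poly_bound[OF f])
    then show False using tr by (simp add: transcendental_entire_def)
  qed
  then have "poly r z = 0" for z using eq[of z] by simp
  then show ?thesis using p0 poly_all_0_iff_0 by blast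
qed

lemma transcendental_nonzero:
  assumes "transcendental_entire f" obtains z where "f z \<noteq> 0"
proof -
  have "\<exists>z. f z \<noteq> 0"
  proof (rule ccontr)
    assume "\<nexists>z. f z \<noteq> 0"
    then have "f = poly 0" by (auto simp: fun_eq_iff)
    then show False using assms by (auto simp: transcendental_entire_def)
  qed
  then show ?thesis using that by blast
qed

text \<open>Cauchy's estimate on circles of radius \<open>1 / (2 * N)\<close>. The radius
  \<open>1 / (16 * K * N)\<close> is chosen so that \<open>E\<close> varies by at most one eighth of
  \<open>N ^ 8\<close>, the size that \<open>|E z0|\<close> has in the applications.\<close>

lemma local_bounds:
  assumes E: "entire E" and N: "N \<ge> 1" and K: "K \<ge> 1"
    and bd: "\<And>z. z \<in> cball z0 (1 / N) \<Longrightarrow> norm (E z) \<le> K * N ^ 8"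
  shows "\<And>z. z \<in> cball z0 (1 / (2 * N)) \<Longrightarrow> norm (deriv E z) \<le> 2 * K * N ^ 9"
    and "\<And>z. z \<in> cball z0 (1 / (16 * K * N)) \<Longrightarrow> norm (E z - E z0) \<le> N ^ 8 / 8"
proof -
  show 1: "norm (deriv E z) \<le> 2 * K * N ^ 9" if z: "z \<in> cball z0 (1 / (2 * N))" for z
  proof -
    have "norm (deriv E z) \<le> K * N ^ 8 / (1 / (2 * N))"
    proof (rule deriv_bound_Cauchy(1)[OF E])
      show "1 / (2 * N) > 0" using N by simp
      fix x assume x: "norm (z - x) = 1 / (2 * N)"
      have "dist z0 x \<le> dist z0 z + dist z x" by (rule dist_triangle)
      also have "\<dots> \<le> 1 / (2 * N) + 1 / (2 * N)" using z x by (intro add_mono) (auto simp: dist_norm)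
      also have "\<dots> = 1 / N" by simp
      finally show "norm (E x) \<le> K * N ^ 8" by (intro bd) simp
    qed
    also have "\<dots> = 2 * K * N ^ 9" by (simp add: power_Suc[of N 8, symmetric] numeral_eq_Suc)
    finally show ?thesis .
  qed
  show "norm (E z - E z0) \<le> N ^ 8 / 8" if z: "z \<in> cball z0 (1 / (16 * K * N))" for z
  proof -
    have "1 / (16 * K * N) \<le> 1 / (2 * N)" using N K by (intro divide_left_mono) auto
    then have sub: "cball z0 (1 / (16 * K * N)) \<subseteq> cball z0 (1 / (2 * N))" by (simp add: subset_cball)
    have "norm (E z - E z0) \<le> 2 * K * N ^ 9 * norm (z - z0)"
    proof (rule field_differentiable_bound[of "cball z0 (1 / (16 * K * N))"])
      show "(E has_field_derivative deriv E x) (at x within cball z0 (1 / (16 * K * N)))" for x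
        using entire_has_deriv[OF E] by (rule has_field_derivative_at_within)
      show "norm (deriv E x) \<le> 2 * K * N ^ 9" if "x \<in> cball z0 (1 / (16 * K * N))" for x
        using 1 sub that by blast
    qed (use z N K in auto)
    also have "\<dots> \<le> 2 * K * N ^ 9 * (1 / (16 * K * N))"
      using z N K by (intro mult_left_mono) (auto simp: dist_norm norm_minus_commute)
    also have "\<dots> = N ^ 8 / 8" using N K by (simp add: field_simps power_Suc[of N 8, symmetric] del: power_Suc)
    finally show ?thesis .
  qed
qed

section \<open>Derivatives of the equation and multiple zeros\<close>

context hayman_ode
begin

lemma f_deriv3: "(deriv (deriv f) has_field_derivative deriv (deriv (deriv f)) z) (at z)"
  by (intro entire_has_deriv entire_deriv f_entire)

lemma f_deriv4: "(deriv (deriv (deriv f)) has_field_derivative deriv (deriv (deriv (deriv f))) z) (at z)"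
  by (intro entire_has_deriv entire_deriv f_entire)

lemma f_deriv5: "(deriv (deriv (deriv (deriv f))) has_field_derivative deriv (deriv (deriv (deriv (deriv f)))) z) (at z)"
  by (intro entire_has_deriv entire_deriv f_entire)

lemma ode_deriv1:
  "f z * deriv (deriv (deriv f)) z - deriv f z * deriv (deriv f) z
    + a1 * (f z * deriv (deriv f) z + deriv f z * deriv f z) + 2 * a2 * f z * deriv f z
    - b1 * deriv f z - b2 * deriv (deriv f) z = 0" (is "?R z = 0")
proof -
  define \<Phi> where "\<Phi> = (\<lambda>z. deriv (deriv f) z * f z - deriv f z * deriv f z + a1 * deriv f z * f z + a2 * (f z * f z)
     - b1 * f z - b2 * deriv f z - b3)"
  have "\<Phi> = (\<lambda>z. 0)" using ode by (simp add: \<Phi>_def fun_eq_iff power2_eq_square)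
  then have "(\<Phi> has_field_derivative 0) (at z)" by simp
  moreover have "(\<Phi> has_field_derivative ?R z) (at z)"
    unfolding \<Phi>_def by (rule derivative_eq_intros f_deriv f_deriv2 f_deriv3 refl)+ (simp add: algebra_simps)
  ultimately show ?thesis using DERIV_unique by blast
qed

lemma ode_deriv2:
  "f z * deriv (deriv (deriv (deriv f))) z - deriv (deriv f) z * deriv (deriv f) z
    + a1 * (f z * deriv (deriv (deriv f)) z + 3 * deriv f z * deriv (deriv f) z)
    + 2 * a2 * (deriv f z * deriv f z + f z * deriv (deriv f) z)
    - b1 * deriv (deriv f) z - b2 * deriv (deriv (deriv f)) z = 0" (is "?R z = 0")
proof -
  define \<Phi> where "\<Phi> = (\<lambda>z. f z * deriv (deriv (deriv f)) z - deriv f z * deriv (deriv f) z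
    + a1 * (f z * deriv (deriv f) z + deriv f z * deriv f z) + 2 * a2 * f z * deriv f z
    - b1 * deriv f z - b2 * deriv (deriv f) z)"
  have "\<Phi> = (\<lambda>z. 0)" using ode_deriv1 by (simp add: \<Phi>_def fun_eq_iff)
  then have "(\<Phi> has_field_derivative 0) (at z)" by simp
  moreover have "(\<Phi> has_field_derivative ?R z) (at z)"
    unfolding \<Phi>_def by (rule derivative_eq_intros f_deriv f_deriv2 f_deriv3 f_deriv4 refl)+ (simp add: algebra_simps)
  ultimately show ?thesis using DERIV_unique by blast
qed

lemma ode_deriv3:
  "deriv f z * deriv (deriv (deriv (deriv f))) z + f z * deriv (deriv (deriv (deriv (deriv f)))) z
    - 2 * deriv (deriv f) z * deriv (deriv (deriv f)) z
    + a1 * (f z * deriv (deriv (deriv (deriv f))) z + 4 * deriv f z * deriv (deriv (deriv f)) z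
      + 3 * deriv (deriv f) z * deriv (deriv f) z)
    + 2 * a2 * (3 * deriv f z * deriv (deriv f) z + f z * deriv (deriv (deriv f)) z)
    - b1 * deriv (deriv (deriv f)) z - b2 * deriv (deriv (deriv (deriv f))) z = 0" (is "?R z = 0")
proof -
  define \<Phi> where "\<Phi> = (\<lambda>z. f z * deriv (deriv (deriv (deriv f))) z - deriv (deriv f) z * deriv (deriv f) z
    + a1 * (f z * deriv (deriv (deriv f)) z + 3 * deriv f z * deriv (deriv f) z)
    + 2 * a2 * (deriv f z * deriv f z + f z * deriv (deriv f) z)
    - b1 * deriv (deriv f) z - b2 * deriv (deriv (deriv f)) z)"
  have "\<Phi> = (\<lambda>z. 0)" using ode_deriv2 by (simp add: \<Phi>_def fun_eq_iff)
  then have "(\<Phi> has_field_derivative 0) (at z)" by simp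
  moreover have "(\<Phi> has_field_derivative ?R z) (at z)"
    unfolding \<Phi>_def by (rule derivative_eq_intros f_deriv f_deriv2 f_deriv3 f_deriv4 f_deriv5 refl)+ (simp add: algebra_simps)
  ultimately show ?thesis using DERIV_unique by blast
qed

lemma cancel_f:
  assumes "entire g" "\<And>z. f z * g z = 0"
  shows "g z = 0"
proof -
  obtain z1 where "f z1 \<noteq> 0" using transcendental_nonzero[OF transcendental] .
  from entire_mult_eq_0[OF f_entire this assms] show ?thesis .
qed

text \<open>At a zero of order \<open>n >= 2\<close> the left side of the equation has order exactly
  \<open>2 n - 2\<close>, with leading coefficient \<open>- n (F z0)^2\<close>. The term
  \<open>b2 f'\<close> has order \<open>n - 1\<close>, so \<open>b2 = 0\<close>; matching with
  \<open>b1 f\<close> forces \<open>2 n - 2 = n\<close> and \<open>b1\<close> nonzero. The values of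
  \<open>f''\<close> and \<open>f'''\<close> follow from the equation differentiated two and three
  times.\<close>

lemma multiple_zero:
  assumes z0: "f z0 = 0" "deriv f z0 = 0"
  obtains F where "b2 = 0" "b3 = 0" "b1 \<noteq> 0" "entire F" "F z0 \<noteq> 0" "\<And>z. f z = (z - z0)\<^sup>2 * F z"
    "deriv (deriv f) z0 = - b1" "deriv (deriv (deriv f)) z0 = - 3 * a1 * b1"
proof -
  have b3: "b3 = 0" using ode[of z0] z0 by simp
  obtain z1 where z1: "f z1 \<noteq> 0" using transcendental_nonzero[OF transcendental] .
  obtain n F where F: "n > 0" "entire F" "F z0 \<noteq> 0" "\<And>z. f z = (z - z0) ^ n * F z"
    using entire_zero_order[OF f_entire z1 z0(1)] by blast
  have fac: "deriv E z = (z - z0) ^ m * (of_nat (Suc m) * G z + (z - z0) * deriv G z)"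
    if "entire G" "\<And>z. E z = (z - z0) ^ Suc m * G z" for E G m z
  proof -
    have E: "E = (\<lambda>z. (z - z0) ^ Suc m * G z)" using that(2) by blast
    have "(E has_field_derivative (z - z0) ^ m * (of_nat (Suc m) * G z + (z - z0) * deriv G z)) (at z)"
      unfolding E by (rule derivative_eq_intros entire_has_deriv[OF that(1)] refl)+ (simp add: algebra_simps)
    then show ?thesis by (rule DERIV_imp_deriv)
  qed
  have ent: "entire (\<lambda>z. of_nat m * G z + (z - z0) * deriv G z)" if "entire G" for G and m :: nat
    using that by (intro holomorphic_intros entire_deriv)
  obtain m where m: "n = Suc m" using F(1) by (cases n) auto
  define G where "G = (\<lambda>z. of_nat (Suc m) * F z + (z - z0) * deriv F z)"
  have f1: "deriv f z = (z - z0) ^ m * G z" for z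
    unfolding G_def by (rule fac) (use F m in auto)
  have G: "entire G" unfolding G_def by (rule ent[OF F(2)])
  have G0: "G z0 = of_nat (Suc m) * F z0" "G z0 \<noteq> 0" using F(3) by (auto simp: G_def simp del: of_nat_Suc)
  obtain l where l: "m = Suc l" using f1[of z0] z0 G0 by (cases m) auto
  define H where "H = (\<lambda>z. of_nat (Suc l) * G z + (z - z0) * deriv G z)"
  have f2: "deriv (deriv f) z = (z - z0) ^ l * H z" for z
    unfolding H_def by (rule fac[OF G]) (use f1 l in auto)
  have H: "entire H" unfolding H_def by (rule ent[OF G])
  have H0: "H z0 = of_nat (Suc l) * G z0" by (simp add: H_def)
  \<comment> \<open>The left side of the equation divided by its common power of
    \<open>z - z0\<close>, which has exponent \<open>2 * l + 2\<close> for a zero of order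
    \<open>l + 2\<close>.\<close>
  define Q where "Q = (\<lambda>z. H z * F z - G z * G z + a1 * (z - z0) * G z * F z + a2 * (z - z0)\<^sup>2 * (F z * F z))"
  have Q: "entire Q" unfolding Q_def using F G H by (intro holomorphic_intros)
  have canc: "g z = 0" if "entire g" "\<And>z. (z - z0) ^ k * g z = 0" for g :: "complex \<Rightarrow> complex" and k z
    by (rule entire_mult_eq_0[of "\<lambda>z. (z - z0) ^ k" "z0 + 1" g]) (use that in \<open>auto intro!: holomorphic_intros\<close>)
  have e1: "(z - z0) ^ Suc l * Q z - b1 * (z - z0) * F z - b2 * G z = 0" for z
  proof (rule canc[of "\<lambda>z. (z - z0) ^ Suc l * Q z - b1 * (z - z0) * F z - b2 * G z" "Suc l"])
    show "entire (\<lambda>z. (z - z0) ^ Suc l * Q z - b1 * (z - z0) * F z - b2 * G z)"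
      using Q F G by (intro holomorphic_intros)
    fix z
    have "(z - z0) ^ Suc l * ((z - z0) ^ Suc l * Q z - b1 * (z - z0) * F z - b2 * G z) =
      deriv (deriv f) z * f z - (deriv f z)\<^sup>2 + a1 * deriv f z * f z + a2 * (f z)\<^sup>2 - b1 * f z - b2 * deriv f z - b3"
      unfolding f1 f2 F(4) Q_def m l b3 by (simp add: power2_eq_square algebra_simps)
    also have "\<dots> = 0" using ode[of z] by simp
    finally show "(z - z0) ^ Suc l * ((z - z0) ^ Suc l * Q z - b1 * (z - z0) * F z - b2 * G z) = 0" .
  qed
  have b2: "b2 = 0" using e1[of z0] G0(2) by simp
  have e2: "(z - z0) ^ l * Q z - b1 * F z = 0" for z
  proof (rule canc[of "\<lambda>z. (z - z0) ^ l * Q z - b1 * F z" 1])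
    show "entire (\<lambda>z. (z - z0) ^ l * Q z - b1 * F z)" using Q F by (intro holomorphic_intros)
    fix z show "(z - z0) ^ 1 * ((z - z0) ^ l * Q z - b1 * F z) = 0"
      using e1[of z] b2 by (simp add: algebra_simps)
  qed
  have Q0: "Q z0 = - of_nat (l + 2) * (F z0 * F z0)"
    by (simp add: Q_def H0 G0 l algebra_simps)
  have nz: "of_nat (l + 2) * (F z0 * F z0) \<noteq> 0"
    using F(3) by (metis add_2_eq_Suc' mult_eq_0_iff nat.distinct(1) of_nat_eq_0_iff)
  have l0: "l = 0"
  proof (rule ccontr)
    assume "l \<noteq> 0"
    then have "b1 = 0" using e2[of z0] F(3) by (simp add: zero_power)
    then have "Q z = 0" for z using canc[OF Q, of l] e2 by simp
    then show False using Q0 nz by (metis minus_mult_left neg_equal_0_iff_equal)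
  qed
  have b1: "b1 \<noteq> 0" using e2[of z0] l0 Q0 nz F(3) by auto
  have "deriv (deriv f) z0 \<noteq> 0" using f2[of z0] l0 H0 G0 by simp
  moreover have "- (deriv (deriv f) z0 * deriv (deriv f) z0) - b1 * deriv (deriv f) z0 = 0"
    using ode_deriv2[of z0] z0 b2 by simp
  then have "deriv (deriv f) z0 * (deriv (deriv f) z0 + b1) = 0" by algebra
  ultimately have f20: "deriv (deriv f) z0 = - b1" by (simp add: eq_neg_iff_add_eq_0)
  have "b1 * (deriv (deriv (deriv f)) z0 + 3 * a1 * b1) = 0"
    using ode_deriv3[of z0] z0 b2 f20 by (simp add: algebra_simps)
  then have "deriv (deriv (deriv f)) z0 = - 3 * a1 * b1" using b1 by (simp add: add_eq_0_iff)
  moreover have "f z = (z - z0)\<^sup>2 * F z" for z using F(4) m l l0 by (simp add: numeral_2_eq_2)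
  ultimately show ?thesis using that[of F] b2 b3 b1 F f20 by blast
qed

end

subsection \<open>Upper growth bounds\<close>

text \<open>On the ray from 0 to \<open>z\<close>, the energy \<open>1 + |f|^2 + |f'|^2\<close>
  grows at rate at most \<open>5 \<phi>'\<close>. The summand 1 takes up the inhomogeneous part, and
  \<open>\<phi>' >= 1\<close> absorbs the mixed term from the derivative of
  \<open>|f|^2\<close>.\<close>

lemma second_order_gronwall:
  fixes \<phi> \<phi>' :: "real \<Rightarrow> real"
  assumes f: "entire f"
    and \<phi>: "\<And>t. t \<ge> 0 \<Longrightarrow> (\<phi> has_real_derivative \<phi>' t) (at t)" "\<And>t. t \<ge> 0 \<Longrightarrow> \<phi>' t \<ge> 1"
    and le: "\<And>z. norm (deriv (deriv f) z) \<le> \<phi>' (norm z) * (1 + norm (f z) + norm (deriv f z))"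
  shows "(norm (f z))\<^sup>2 \<le> (1 + (norm (f 0))\<^sup>2 + (norm (deriv f 0))\<^sup>2) * exp (5 * \<phi> (norm z) - 5 * \<phi> 0)"
proof -
  define u where "u = (if z = 0 then 1 else z / of_real (norm z))"
  have u: "norm u = 1" "of_real (norm z) * u = z" by (auto simp: u_def norm_divide)
  define x where "x = (\<lambda>t::real. f (of_real t * u))"
  define y where "y = (\<lambda>t::real. deriv f (of_real t * u))"
  define y' where "y' = (\<lambda>t::real. u * deriv (deriv f) (of_real t * u))"
  have line: "((\<lambda>t. of_real t * u) has_vector_derivative u) (at t)" for t
    by (auto intro!: derivative_eq_intros simp: has_vector_derivative_def scaleR_conv_of_real)
  have x: "(x has_vector_derivative u * y t) (at t)" for t
    using field_vector_diff_chain_at[OF line entire_has_deriv[OF f]] by (simp add: x_def y_def o_def)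
  have y: "(y has_vector_derivative y' t) (at t)" for t
    using field_vector_diff_chain_at[OF line entire_has_deriv[OF entire_deriv[OF f]]] by (simp add: y_def y'_def o_def)
  define U where "U = (\<lambda>t. 1 + (norm (x t))\<^sup>2 + (norm (y t))\<^sup>2)"
  have "U (norm z) \<le> U 0 * exp (5 * \<phi> (norm z) - 5 * \<phi> 0)"
  proof (rule gronwall_real)
    fix t :: real assume t: "0 \<le> t" "t \<le> norm z"
    from DERIV_add[OF DERIV_add[OF DERIV_const norm_sq_has_deriv[OF x]] norm_sq_has_deriv[OF y]]
    show "(U has_real_derivative 0 + 2 * Re (cnj (x t) * (u * y t)) + 2 * Re (cnj (y t) * y' t)) (at t)"
      unfolding U_def .
    show "((\<lambda>t. 5 * \<phi> t) has_real_derivative 5 * \<phi>' t) (at t)"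
      by (rule DERIV_cmult[OF \<phi>(1)[OF t(1)]])
    define a b where "a = norm (x t)" and "b = norm (y t)"
    have ab: "a \<ge> 0" "b \<ge> 0" by (auto simp: a_def b_def)
    have "Re (cnj (x t) * (u * y t)) \<le> a * b"
      using complex_Re_le_cmod[of "cnj (x t) * (u * y t)"] unfolding norm_mult complex_mod_cnj u(1) by (simp add: a_def b_def)
    moreover have "norm (y' t) \<le> \<phi>' t * (1 + a + b)"
      using le[of "of_real t * u"] t u(1) by (simp add: y'_def norm_mult a_def b_def x_def y_def)
    then have "b * norm (y' t) \<le> b * (\<phi>' t * (1 + a + b))" using ab by (intro mult_left_mono)
    then have "Re (cnj (y t) * y' t) \<le> b * (\<phi>' t * (1 + a + b))"
      using complex_Re_le_cmod[of "cnj (y t) * y' t"] unfolding norm_mult complex_mod_cnj b_def by linarith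
    moreover have "a * b \<le> \<phi>' t * (a * b)" using mult_right_mono[OF \<phi>(2)[OF t(1)], of "a * b"] ab by simp
    ultimately have "0 + 2 * Re (cnj (x t) * (u * y t)) + 2 * Re (cnj (y t) * y' t)
        \<le> 2 * (\<phi>' t * (a * b)) + 2 * (b * (\<phi>' t * (1 + a + b)))" by linarith
    also have "\<dots> = \<phi>' t * (2 * (a * b) + 2 * (b * (1 + a + b)))" by (simp add: algebra_simps)
    also have "\<dots> \<le> \<phi>' t * (5 * (1 + a\<^sup>2 + b\<^sup>2))"
    proof (rule mult_left_mono)
      have "0 \<le> 2 * (a - b)\<^sup>2 + (b - 1)\<^sup>2" by simp
      then have "4 * (a * b) + 2 * b \<le> 2 * a\<^sup>2 + 3 * b\<^sup>2 + 1" by (simp add: power2_eq_square algebra_simps)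
      moreover have "0 \<le> a\<^sup>2" "0 \<le> b\<^sup>2" by simp_all
      moreover have "2 * (a * b) + 2 * (b * (1 + a + b)) = 4 * (a * b) + 2 * b + 2 * b\<^sup>2"
        by (simp add: power2_eq_square algebra_simps)
      ultimately show "2 * (a * b) + 2 * (b * (1 + a + b)) \<le> 5 * (1 + a\<^sup>2 + b\<^sup>2)"
        by argo
    qed (use \<phi>(2)[OF t(1)] in simp)
    also have "\<dots> = 5 * \<phi>' t * U t" by (simp add: U_def a_def b_def)
    finally show "0 + 2 * Re (cnj (x t) * (u * y t)) + 2 * Re (cnj (y t) * y' t) \<le> 5 * \<phi>' t * U t" .
  qed simp
  moreover have "(norm (f z))\<^sup>2 \<le> U (norm z)" by (simp add: U_def x_def u)
  moreover have "U 0 = 1 + (norm (f 0))\<^sup>2 + (norm (deriv f 0))\<^sup>2" by (simp add: U_def x_def y_def)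
  ultimately show ?thesis by simp
qed

lemma second_order_bound_transfer:
  fixes \<phi> \<phi>' \<psi> :: "real \<Rightarrow> real"
  assumes f: "entire f"
    and \<phi>: "\<And>t. t \<ge> 0 \<Longrightarrow> (\<phi> has_real_derivative \<phi>' t) (at t)" "\<And>t. t \<ge> 0 \<Longrightarrow> \<phi>' t \<ge> 1"
    and le: "\<And>z. norm (deriv (deriv f) z) \<le> \<phi>' (norm z) * (1 + norm (f z) + norm (deriv f z))"
    and ev: "\<And>d. \<forall>\<^sub>F r in at_top. d + 5 * \<phi> r \<le> 2 * \<psi> r"
  shows "\<forall>\<^sub>F z in at_infinity. norm (f z) \<le> exp (\<psi> (norm z))"
proof -
  define D where "D = 1 + (norm (f 0))\<^sup>2 + (norm (deriv f 0))\<^sup>2"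
  have D: "D > 0" by (simp add: D_def add_pos_nonneg)
  from eventually_at_infinityI_real[OF ev[of "ln D - 5 * \<phi> 0"]]
  show ?thesis
  proof eventually_elim
    case (elim z)
    have "(norm (f z))\<^sup>2 \<le> D * exp (5 * \<phi> (norm z) - 5 * \<phi> 0)"
      unfolding D_def by (rule second_order_gronwall[OF f \<phi> le])
    also have "\<dots> = exp (ln D - 5 * \<phi> 0 + 5 * \<phi> (norm z))" using D by (simp add: exp_add exp_diff)
    also have "\<dots> \<le> exp (2 * \<psi> (norm z))" using elim by simp
    also have "\<dots> = (exp (\<psi> (norm z)))\<^sup>2" by (simp add: exp_double)
    finally show ?case by (rule power2_le_imp_le) simp
  qed
qed

lemma linear_ode_double_exp_bound:
  assumes f: "entire f" and c: "c > 0"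
    and le: "\<And>z. norm (deriv (deriv f) z) \<le> K * exp (c * norm z) * (1 + norm (f z) + norm (deriv f z))"
  shows "\<exists>C. \<forall>\<^sub>F z in at_infinity. norm (f z) \<le> exp (exp (C * norm z))"
proof -
  define K' where "K' = max K 1"
  have K': "K' \<ge> 1" "K \<le> K'" by (auto simp: K'_def)
  have "\<forall>\<^sub>F z in at_infinity. norm (f z) \<le> exp (exp ((c + 1) * norm z))"
  proof (rule second_order_bound_transfer[OF f, of "\<lambda>t. K' / c * exp (c * t)" "\<lambda>t. K' * exp (c * t)"])
    show "((\<lambda>t. K' / c * exp (c * t)) has_real_derivative K' * exp (c * t)) (at t)" for t
      using c by (auto intro!: derivative_eq_intros)
    show "1 \<le> K' * exp (c * t)" if "t \<ge> 0" for t
      using mult_mono[of 1 K' 1 "exp (c * t)"] K' c that by simp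
    show "norm (deriv (deriv f) z) \<le> K' * exp (c * norm z) * (1 + norm (f z) + norm (deriv f z))" for z
      by (rule order_trans[OF le]) (use K' in \<open>intro mult_right_mono, auto\<close>)
    show "\<forall>\<^sub>F r in at_top. d + 5 * (K' / c * exp (c * r)) \<le> 2 * exp ((c + 1) * r)" for d
      using c K' by real_asymp
  qed
  then show ?thesis by blast
qed

lemma linear_ode_const_order_le:
  assumes f: "entire f"
    and le: "\<And>z. norm (deriv (deriv f) z) \<le> K * (1 + norm (f z) + norm (deriv f z))"
  shows "growth_order f \<le> 1"
proof -
  define K' where "K' = max K 1"
  have K': "K' \<ge> 1" "K \<le> K'" by (auto simp: K'_def)
  have "\<forall>\<^sub>F z in at_infinity. norm (f z) \<le> exp ((\<lambda>r. 5 * K' * r ^ 1) (norm z))"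
  proof (rule second_order_bound_transfer[OF f, of "\<lambda>t. K' * t" "\<lambda>t. K'"])
    show "((\<lambda>t. K' * t) has_real_derivative K') (at t)" for t
      by (auto intro!: derivative_eq_intros)
    show "norm (deriv (deriv f) z) \<le> K' * (1 + norm (f z) + norm (deriv f z))" for z
      by (rule order_trans[OF le]) (use K' in \<open>intro mult_right_mono, auto\<close>)
    show "\<forall>\<^sub>F r in at_top. d + 5 * (K' * r) \<le> 2 * (5 * K' * r ^ 1)" for d
      using K' by real_asymp
  qed (use K' in auto)
  from growth_order_le[OF this] show ?thesis by (simp add: one_ereal_def)
qed

lemma linear_ode_affine_order_le:
  assumes f: "entire f"
    and le: "\<And>z. norm (deriv (deriv f) z) \<le> K * (1 + norm z) * (1 + norm (f z) + norm (deriv f z))"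
  shows "growth_order f \<le> 2"
proof -
  define K' where "K' = max K 1"
  have K': "K' \<ge> 1" "K \<le> K'" by (auto simp: K'_def)
  have "\<forall>\<^sub>F z in at_infinity. norm (f z) \<le> exp ((\<lambda>r. 5 * K' * r ^ 2) (norm z))"
  proof (rule second_order_bound_transfer[OF f, of "\<lambda>t. K' * (t + t ^ 2 / 2)" "\<lambda>t. K' * (1 + t)"])
    show "((\<lambda>t. K' * (t + t ^ 2 / 2)) has_real_derivative K' * (1 + t)) (at t)" for t
      by (auto intro!: derivative_eq_intros)
    show "1 \<le> K' * (1 + t)" if "t \<ge> 0" for t
      using mult_mono[of 1 K' 1 "1 + t"] K' that by simp
    show "norm (deriv (deriv f) z) \<le> K' * (1 + norm z) * (1 + norm (f z) + norm (deriv f z))" for z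
      by (rule order_trans[OF le]) (use K' in \<open>intro mult_right_mono, auto\<close>)
    show "\<forall>\<^sub>F r in at_top. d + 5 * (K' * (r + r ^ 2 / 2)) \<le> 2 * (5 * K' * r ^ 2)" for d
      using K' by real_asymp
  qed
  from growth_order_le[OF this] show ?thesis by simp
qed

lemma exp_type_imp_order_le_1:
  assumes "\<And>z. norm (f z) \<le> K * exp (c * norm z)"
  shows "growth_order f \<le> 1"
proof -
  define K' where "K' = max K 1"
  have K': "K' \<ge> 1" "K \<le> K'" by (auto simp: K'_def)
  have "\<forall>\<^sub>F r in at_top. K' \<le> exp r" by real_asymp
  then have "\<forall>\<^sub>F r in at_top. K' * exp (c * r) \<le> exp ((c + 1) * r)"
    by eventually_elim (simp add: algebra_simps exp_add)
  from eventually_at_infinityI_real[OF this]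
  have "\<forall>\<^sub>F z in at_infinity. norm (f z) \<le> exp ((c + 1) * norm z ^ 1)"
  proof eventually_elim
    case (elim z)
    have "norm (f z) \<le> K * exp (c * norm z)" by (rule assms)
    also have "\<dots> \<le> K' * exp (c * norm z)" using K' by (intro mult_right_mono) auto
    finally show ?case using elim by simp
  qed
  from growth_order_le[OF this] show ?thesis by (simp add: one_ereal_def)
qed

lemma le_0_of_le_eps:
  fixes x D :: real
  assumes "\<And>\<epsilon>. 0 < \<epsilon> \<Longrightarrow> \<epsilon> \<le> 1 \<Longrightarrow> x \<le> D * \<epsilon>"
  shows "x \<le> 0"
proof (rule ccontr)
  assume "\<not> x \<le> 0"
  define E where "E = \<bar>D\<bar> + x + 1"
  have E: "E > 0" "x \<le> E" "D \<le> E" using \<open>\<not> x \<le> 0\<close> by (auto simp: E_def)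
  have "x \<le> D * (x / (2 * E))" using E \<open>\<not> x \<le> 0\<close> by (intro assms) (auto simp: divide_le_eq)
  also have "\<dots> \<le> E * (x / (2 * E))" using E \<open>\<not> x \<le> 0\<close> by (intro mult_right_mono) auto
  also have "\<dots> = x / 2" using E by simp
  finally show False using \<open>\<not> x \<le> 0\<close> by simp
qed

section \<open>Conclusions from linear equations with controlled coefficients\<close>

context hayman_ode
begin

abbreviation conclusion :: bool where
  "conclusion \<equiv> (growth_order f < \<infinity> \<longrightarrow> growth_order f = 1 \<or> growth_order f = 2) \<and>
         (growth_order f = \<infinity> \<longrightarrow> hyper_order f = 1)"

text \<open>Divided by \<open>f^2\<close>, the equation at a point from
  \<open>small_type_point\<close> reads \<open>a2 + a1 w = O(\<epsilon> \<eta>)\<close> with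
  \<open>w = f'/f\<close> between \<open>\<eta> / 2\<close> and \<open>\<eta>\<close> in modulus.
  Letting \<open>\<epsilon>\<close> tend to 0 gives \<open>a2 = 0\<close>, and then
  \<open>a1 = 0\<close>.\<close>

lemma growth_order_ge_1_of_a1:
  assumes a1: "a1 \<noteq> 0"
  shows "growth_order f \<ge> 1"
proof (rule ccontr)
  assume "\<not> growth_order f \<ge> 1"
  then have lt: "growth_order f < 1" by simp
  define D where "D = 7 + norm a1 + norm b1 + norm b2 + norm b3"
  have pt: "\<exists>\<eta> w v d. 0 < \<eta> \<and> \<eta> \<le> \<epsilon> \<and> norm v \<le> \<epsilon> * \<eta> \<and> \<eta> \<le> 2 * norm w \<and> norm w \<le> \<eta> \<and> norm d \<le> 6 * \<eta>\<^sup>2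
      \<and> d - w\<^sup>2 + a1 * w + a2 = b1 * v + b2 * v * w + b3 * v\<^sup>2" if "\<epsilon> > 0" for \<epsilon>
  proof -
    obtain \<eta> z0 where *: "0 < \<eta>" "\<eta> \<le> \<epsilon>" "f z0 \<noteq> 0" "norm (1 / f z0) \<le> \<epsilon> * \<eta>"
      "\<eta> \<le> 2 * norm (deriv f z0 / f z0)" "norm (deriv f z0 / f z0) \<le> \<eta>"
      "norm (deriv (deriv f) z0 / f z0) \<le> 6 * \<eta>\<^sup>2"
      using small_type_point[OF transcendental lt \<open>\<epsilon> > 0\<close>] .
    have "deriv (deriv f) z0 / f z0 - (deriv f z0 / f z0)\<^sup>2 + a1 * (deriv f z0 / f z0) + a2
      = (deriv (deriv f) z0 * f z0 - (deriv f z0)\<^sup>2 + a1 * deriv f z0 * f z0 + a2 * (f z0)\<^sup>2) / (f z0)\<^sup>2"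
      using *(3) by (simp add: field_simps power2_eq_square)
    also have "\<dots> = b1 * (1 / f z0) + b2 * (1 / f z0) * (deriv f z0 / f z0) + b3 * (1 / f z0)\<^sup>2"
      unfolding ode using *(3) by (simp add: field_simps power2_eq_square)
    finally show ?thesis using * by blast
  qed
  have rest: "norm (b1 * v + b2 * v * w + b3 * v\<^sup>2 - d + w\<^sup>2) \<le> (D - norm a1) * (\<epsilon> * \<eta>)"
    if "0 < \<eta>" "\<eta> \<le> \<epsilon>" "\<epsilon> \<le> 1" "norm v \<le> \<epsilon> * \<eta>" "norm w \<le> \<eta>" "norm d \<le> 6 * \<eta>\<^sup>2" for \<eta> \<epsilon> w v d
  proof -
    have \<eta>1: "\<eta> \<le> 1" and \<epsilon>: "\<epsilon> > 0" using that by auto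
    have e1: "\<epsilon> * \<eta> \<le> 1" using \<eta>1 \<epsilon> that by (simp add: mult_le_one)
    have \<eta>2: "\<eta>\<^sup>2 \<le> \<epsilon> * \<eta>" using that by (simp add: power2_eq_square mult_right_mono)
    have "norm (b1 * v + b2 * v * w + b3 * v\<^sup>2 - d + w\<^sup>2) \<le> norm (b1 * v) + norm (b2 * v * w) + norm (b3 * v\<^sup>2) + norm d + norm (w\<^sup>2)"
      by norm
    also have "\<dots> \<le> norm b1 * (\<epsilon> * \<eta>) + norm b2 * (\<epsilon> * \<eta>) + norm b3 * (\<epsilon> * \<eta>) + 6 * (\<epsilon> * \<eta>) + \<epsilon> * \<eta>"
    proof (intro add_mono)
      show "norm (b1 * v) \<le> norm b1 * (\<epsilon> * \<eta>)" unfolding norm_mult using that by (intro mult_left_mono) auto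
      have "norm v * norm w \<le> (\<epsilon> * \<eta>) * 1" using that \<eta>1 \<epsilon> by (intro mult_mono) auto
      then show "norm (b2 * v * w) \<le> norm b2 * (\<epsilon> * \<eta>)" unfolding norm_mult mult.assoc by (intro mult_left_mono) auto
      have "norm v * norm v \<le> (\<epsilon> * \<eta>) * 1" using that e1 \<epsilon> by (intro mult_mono) auto
      then show "norm (b3 * v\<^sup>2) \<le> norm b3 * (\<epsilon> * \<eta>)"
        unfolding norm_mult power2_eq_square by (intro mult_left_mono) auto
      show "norm d \<le> 6 * (\<epsilon> * \<eta>)" using that(6) \<eta>2 by linarith
      have "(norm w)\<^sup>2 \<le> \<eta>\<^sup>2" using that by (intro power_mono) auto
      then show "norm (w\<^sup>2) \<le> \<epsilon> * \<eta>" using \<eta>2 by (simp add: norm_power)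
    qed
    also have "\<dots> = (D - norm a1) * (\<epsilon> * \<eta>)" by (simp add: D_def algebra_simps)
    finally show ?thesis .
  qed
  have a2: "a2 = 0"
  proof -
    have "norm a2 \<le> D * \<epsilon>" if \<epsilon>: "0 < \<epsilon>" "\<epsilon> \<le> 1" for \<epsilon>
    proof -
      obtain \<eta> w v d where *: "0 < \<eta>" "\<eta> \<le> \<epsilon>" "norm v \<le> \<epsilon> * \<eta>" "norm w \<le> \<eta>" "norm d \<le> 6 * \<eta>\<^sup>2"
        "d - w\<^sup>2 + a1 * w + a2 = b1 * v + b2 * v * w + b3 * v\<^sup>2" using pt[OF \<epsilon>(1)] by blast
      have "a2 = (b1 * v + b2 * v * w + b3 * v\<^sup>2 - d + w\<^sup>2) - a1 * w" using *(6) by (simp add: algebra_simps)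
      then have "norm a2 \<le> norm (b1 * v + b2 * v * w + b3 * v\<^sup>2 - d + w\<^sup>2) + norm (a1 * w)"
        by (metis norm_triangle_ineq4)
      also have "\<dots> \<le> (D - norm a1) * (\<epsilon> * \<eta>) + norm a1 * \<epsilon>"
        unfolding norm_mult[of a1] using * \<epsilon> by (intro add_mono rest mult_left_mono) auto
      also have "\<dots> \<le> (D - norm a1) * (\<epsilon> * 1) + norm a1 * \<epsilon>"
        using * \<epsilon> by (intro add_right_mono mult_left_mono) (auto simp: D_def)
      finally show ?thesis by (simp add: algebra_simps)
    qed
    then have "norm a2 \<le> 0" by (rule le_0_of_le_eps)
    then show ?thesis by simp
  qed
  have "norm a1 / 2 \<le> D * \<epsilon>" if \<epsilon>: "0 < \<epsilon>" "\<epsilon> \<le> 1" for \<epsilon>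
  proof -
    obtain \<eta> w v d where *: "0 < \<eta>" "\<eta> \<le> \<epsilon>" "norm v \<le> \<epsilon> * \<eta>" "norm w \<le> \<eta>" "norm d \<le> 6 * \<eta>\<^sup>2" "\<eta> \<le> 2 * norm w"
      "d - w\<^sup>2 + a1 * w + a2 = b1 * v + b2 * v * w + b3 * v\<^sup>2" using pt[OF \<epsilon>(1)] by blast
    have "a1 * w = b1 * v + b2 * v * w + b3 * v\<^sup>2 - d + w\<^sup>2" using *(7) a2 by (simp add: algebra_simps)
    then have "norm (a1 * w) \<le> (D - norm a1) * (\<epsilon> * \<eta>)" using rest[OF *(1,2) \<epsilon>(2) *(3,4,5)] by simp
    moreover have "norm a1 * (\<eta> / 2) \<le> norm (a1 * w)" unfolding norm_mult using * by (intro mult_left_mono) auto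
    moreover have "(D - norm a1) * (\<epsilon> * \<eta>) \<le> D * (\<epsilon> * \<eta>)" using * \<epsilon> by (intro mult_right_mono) auto
    ultimately have "(norm a1 / 2) * \<eta> \<le> (D * \<epsilon>) * \<eta>" by simp
    then show ?thesis using *(1) by simp
  qed
  then have "norm a1 / 2 \<le> 0" by (rule le_0_of_le_eps)
  then show False using a1 by simp
qed

lemma conclusion_of_double_exp_bound:
  assumes a1: "a1 \<noteq> 0"
    and ub: "\<exists>C. \<forall>\<^sub>F z in at_infinity. norm (f z) \<le> exp (exp (C * norm z))"
  shows conclusion
proof -
  obtain L where L: "\<And>z0. norm (f z0) \<ge> L \<Longrightarrow> norm (deriv f z0) > L * norm (f z0) \<Longrightarrow>
    (\<exists>c>0. \<forall>R. \<exists>z. norm z \<ge> R \<and> norm (f z) \<ge> exp (exp (c * norm z)))"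
    using double_exponential_growth[OF a1] by blast
  show ?thesis
  proof (cases "\<exists>z0. norm (f z0) \<ge> L \<and> norm (deriv f z0) > L * norm (f z0)")
    case True
    then obtain c where c: "c > 0" "\<And>R. \<exists>z. norm z \<ge> R \<and> norm (f z) \<ge> exp (exp (c * norm z))"
      using L by blast
    have "hyper_order f \<ge> 1" "growth_order f = \<infinity>"
      using hyper_order_ge[OF c(2,1)] growth_order_eq_top[OF c(2,1)] by auto
    moreover have "hyper_order f \<le> 1" using ub hyper_order_le by blast
    ultimately show ?thesis by auto
  next
    case False
    then have "\<exists>K c. c > 0 \<and> (\<forall>z. norm (f z) \<le> K * exp (c * norm z))"
      by (intro exp_type_or_large_log_deriv[OF f_entire, of L]) (meson not_le)
    then have "growth_order f \<le> 1" using exp_type_imp_order_le_1 by blast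
    moreover have "growth_order f \<ge> 1" by (rule growth_order_ge_1_of_a1[OF a1])
    ultimately have "growth_order f = 1" by (rule antisym)
    then show ?thesis by simp
  qed
qed

lemma conclusion_of_linear_const:
  assumes eq: "\<And>z. deriv (deriv f) z = A * deriv f z + h * f z + B"
  shows conclusion
proof -
  have "growth_order f \<ge> 1" by (rule growth_order_ge_1_linear[OF transcendental eq])
  moreover have "growth_order f \<le> 1"
  proof (rule linear_ode_const_order_le[OF f_entire])
    fix z
    define M where "M = norm A + norm h + norm B"
    have "norm (deriv (deriv f) z) \<le> norm A * norm (deriv f z) + norm h * norm (f z) + norm B"
      unfolding eq by (metis norm_mult norm_triangle_le norm_triangle_ineq add_mono order_refl)
    also have "\<dots> \<le> M * norm (deriv f z) + M * norm (f z) + M"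
      by (intro add_mono mult_right_mono) (auto simp: M_def)
    finally show "norm (deriv (deriv f) z) \<le> (norm A + norm h + norm B) * (1 + norm (f z) + norm (deriv f z))"
      unfolding M_def[symmetric] by (simp add: algebra_simps)
  qed
  ultimately have "growth_order f = 1" by (metis antisym)
  then show ?thesis by simp
qed

text \<open>The differentiated equation is linear with affine coefficients, which bounds the order
  by 2; a nonconstant coefficient also forces order at least 2. This is the source of the value 2 in
  the theorem; for \<open>c1 = 0\<close> the coefficients are constant.\<close>

lemma conclusion_of_first_order:
  assumes eq: "\<And>z. deriv f z = \<gamma> + (c1 * z + c0) * f z"
  shows conclusion
proof -
  have "((\<lambda>z. \<gamma> + (c1 * z + c0) * f z) has_field_derivative c1 * f z + (c1 * z + c0) * deriv f z) (at z)" for z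
    by (rule derivative_eq_intros f_deriv refl)+ (simp add: algebra_simps)
  moreover have "deriv f = (\<lambda>z. \<gamma> + (c1 * z + c0) * f z)" using eq by blast
  ultimately have eq2: "deriv (deriv f) z = (c1 * z + c0) * deriv f z + c1 * f z" for z
    by (metis DERIV_imp_deriv add.commute)
  show ?thesis
  proof (cases "c1 = 0")
    case True
    then show ?thesis using eq2 by (intro conclusion_of_linear_const[of c0 0 0]) simp
  next
    case False
    have "growth_order f \<ge> 2" by (rule growth_order_ge_2[OF transcendental False eq])
    moreover have "growth_order f \<le> 2"
    proof (rule linear_ode_affine_order_le[OF f_entire])
      fix z
      define M where "M = norm c1 + norm c0"
      have M: "M \<ge> 0" "norm c1 \<le> M" "norm c0 \<le> M" by (auto simp: M_def)
      have m1: "norm (c1 * z + c0) \<le> M * (1 + norm z)"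
      proof -
        have "norm (c1 * z + c0) \<le> norm c1 * norm z + norm c0" by (metis norm_mult norm_triangle_ineq)
        also have "\<dots> \<le> M * norm z + M" using M by (intro add_mono mult_right_mono) auto
        finally show ?thesis by (simp add: algebra_simps)
      qed
      have m2: "norm c1 \<le> M * (1 + norm z)"
        using M mult_left_mono[of 1 "1 + norm z" M] by simp
      have "norm (deriv (deriv f) z) \<le> norm (c1 * z + c0) * norm (deriv f z) + norm c1 * norm (f z)"
        unfolding eq2 by (metis norm_mult norm_triangle_ineq)
      also have "\<dots> \<le> M * (1 + norm z) * norm (deriv f z) + M * (1 + norm z) * norm (f z)"
        using m1 m2 by (intro add_mono mult_right_mono) auto
      also have "\<dots> \<le> M * (1 + norm z) * (1 + norm (f z) + norm (deriv f z))"
        using M by (simp add: algebra_simps)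
      finally show "norm (deriv (deriv f) z) \<le> (norm c1 + norm c0) * (1 + norm z) * (1 + norm (f z) + norm (deriv f z))"
        by (simp add: M_def)
    qed
    ultimately have "growth_order f = 2" by (metis antisym)
    then show ?thesis by simp
  qed
qed

lemma conclusion_of_linear_exp:
  assumes a1: "a1 \<noteq> 0" and c: "c > 0"
    and p: "\<And>z. norm (p z) \<le> K * exp (c * norm z)" and q: "\<And>z. norm (q z) \<le> K * exp (c * norm z)"
    and eq: "\<And>z. deriv (deriv f) z = p z * deriv f z + q z * f z + B"
  shows conclusion
proof (rule conclusion_of_double_exp_bound[OF a1 linear_ode_double_exp_bound[OF f_entire c]])
  fix z :: complex
  define M where "M = (\<bar>K\<bar> + norm B) * exp (c * norm z)"
  have e1: "exp (c * norm z) \<ge> 1" using c by simp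
  have M: "norm (p z) \<le> M" "norm (q z) \<le> M" "norm B \<le> M"
  proof -
    have "K \<le> \<bar>K\<bar> + norm B" using abs_ge_self[of K] norm_ge_zero[of B] by linarith
    then have "K * exp (c * norm z) \<le> M" unfolding M_def by (rule mult_right_mono) simp
    then show "norm (p z) \<le> M" "norm (q z) \<le> M" using p[of z] q[of z] by linarith+
    have "norm B * 1 \<le> M" unfolding M_def using e1 by (intro mult_mono) auto
    then show "norm B \<le> M" by simp
  qed
  have "norm (deriv (deriv f) z) \<le> norm (p z * deriv f z) + norm (q z * f z) + norm B"
    unfolding eq by norm
  also have "\<dots> \<le> M * norm (deriv f z) + M * norm (f z) + M"
    unfolding norm_mult using M by (intro add_mono mult_right_mono) auto
  finally show "norm (deriv (deriv f) z) \<le> (\<bar>K\<bar> + norm B) * exp (c * norm z) * (1 + norm (f z) + norm (deriv f z))"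
    unfolding M_def[symmetric] by (simp add: algebra_simps)
qed

end

subsection \<open>Zeros with a single value of the derivative\<close>

text \<open>Knowing that \<open>w^2\<close> stays near \<open>(w z0)^2\<close> leaves the sign of
  \<open>w\<close> open. By connectedness \<open>w\<close> could change sign only through a point
  with \<open>|w - w z0| = |w z0| / 2\<close>; there \<open>|w + w z0| >= 3/2 |w z0|\<close>, so the
  squares would differ by \<open>3/4 |w z0|^2\<close>.\<close>

lemma near_root:
  fixes w :: "complex \<Rightarrow> complex"
  assumes w: "continuous_on (cball z0 r) w" and r: "r \<ge> 0"
    and sq: "\<And>z. z \<in> cball z0 r \<Longrightarrow> norm ((w z)\<^sup>2 - (w z0)\<^sup>2) < 3 / 4 * (norm (w z0))\<^sup>2"
    and z: "z \<in> cball z0 r"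
  shows "norm (w z - w z0) \<le> norm (w z0) / 2"
proof (rule ccontr)
  assume neg: "\<not> ?thesis"
  define g where "g = (\<lambda>z. norm (w z - w z0))"
  have "continuous_on (cball z0 r) g" unfolding g_def by (intro continuous_intros w)
  then have conn: "connected (g ` cball z0 r)"
    by (rule connected_continuous_image[OF _ convex_connected[OF convex_cball]])
  have "norm (w z0) / 2 \<in> g ` cball z0 r"
    by (rule connectedD_interval[OF conn, of "g z0" "g z"]) (use z r neg in \<open>auto simp: g_def\<close>)
  then obtain y where y: "y \<in> cball z0 r" "norm (w y - w z0) = norm (w z0) / 2" by (auto simp: g_def)
  have "norm (2 * w z0) - norm (w y - w z0) \<le> norm (2 * w z0 + (w y - w z0))" by (rule norm_diff_ineq)
  then have "3 / 2 * norm (w z0) \<le> norm (w y + w z0)" by (simp add: y norm_mult algebra_simps)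
  then have "norm (w z0) / 2 * (3 / 2 * norm (w z0)) \<le> norm (w y - w z0) * norm (w y + w z0)"
    using y by (intro mult_mono) auto
  also have "\<dots> = norm ((w y)\<^sup>2 - (w z0)\<^sup>2)" by (simp add: power2_eq_square algebra_simps flip: norm_mult)
  finally show False using sq[OF y(1)] by (simp add: power2_eq_square)
qed

text \<open>For \<open>N >= 2 C\<close> the quadratic term on the right is at most
  \<open>x^2 / 2\<close>. In the unit \<open>u = x / N ^ 4\<close> this leaves
  \<open>u^2 <= 2 C + 2 C u\<close>, which fails for \<open>u > 2 C + 1\<close>.\<close>

lemma self_bound_sqrt:
  fixes x N C :: real
  assumes x: "x \<ge> 0" and N: "N \<ge> 1" "N \<ge> 2 * C" and C: "C \<ge> 0"
    and le: "x\<^sup>2 \<le> C * N ^ 8 + C * N * x + C * x\<^sup>2 / N ^ 8"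
  shows "x \<le> (2 * C + 1) * N ^ 4"
proof (rule ccontr)
  define u where "u = x / N ^ 4"
  have N0: "N > 0" using N by simp
  assume "\<not> x \<le> (2 * C + 1) * N ^ 4"
  then have u: "u > 2 * C + 1" using N0 by (simp add: u_def field_simps)
  have xu: "x = u * N ^ 4" using N0 by (simp add: u_def)
  have N8: "N \<le> N ^ 8" "N \<le> N ^ 4" using N(1) by (simp_all add: self_le_power)
  have "C / N ^ 8 \<le> 1 / 2" using N N8 N0 by (simp add: divide_le_eq)
  then have "C / N ^ 8 * x\<^sup>2 \<le> 1 / 2 * x\<^sup>2" by (rule mult_right_mono) simp
  moreover have "C / N ^ 8 * x\<^sup>2 = C * x\<^sup>2 / N ^ 8" by simp
  ultimately have "x\<^sup>2 \<le> 2 * (C * N ^ 8) + 2 * (C * N * x)" using le by linarith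
  also have "\<dots> \<le> 2 * (C * N ^ 8) + 2 * (C * N ^ 4 * x)"
    using N8 C x by (intro add_left_mono mult_left_mono mult_right_mono) auto
  finally have "u\<^sup>2 * N ^ 8 \<le> (2 * C + 2 * C * u) * N ^ 8"
    by (simp add: xu power_mult_distrib algebra_simps flip: power_add power_mult)
  then have "u\<^sup>2 \<le> 2 * C + 2 * C * u" using N0 by (subst (asm) mult_le_cancel_right) auto
  moreover have "(2 * C + 1) * u < u\<^sup>2" unfolding power2_eq_square using u C by (intro mult_strict_right_mono) auto
  ultimately show False using u by (simp add: algebra_simps)
qed

context hayman_ode
begin

text \<open>Replacing \<open>f'\<close> by \<open>\<gamma> + q f\<close> in the equation cancels the
  terms without \<open>f\<close>, since \<open>\<gamma>\<close> is a root of
  \<open>x^2 + b2 x + b3\<close> with second root \<open>\<gamma>'\<close>. One factor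
  \<open>f\<close> can then be divided out.\<close>

lemma q_relation:
  assumes q: "entire q" and eq: "\<And>z. deriv f z = \<gamma> + q z * f z"
    and \<gamma>: "\<gamma> + \<gamma>' = - b2" "\<gamma> * \<gamma>' = b3"
  shows "(deriv q z + a1 * q z + a2) * f z = b1 - a1 * \<gamma> - \<gamma>' * q z"
proof -
  have "((\<lambda>z. \<gamma> + q z * f z) has_field_derivative deriv q z * f z + q z * deriv f z) (at z)" for z
    by (rule derivative_eq_intros f_deriv entire_has_deriv[OF q] refl)+ (simp add: algebra_simps)
  moreover have "deriv f = (\<lambda>z. \<gamma> + q z * f z)" using eq by blast
  ultimately have f2: "deriv (deriv f) z = deriv q z * f z + q z * deriv f z" for z
    by (metis DERIV_imp_deriv)
  have b2: "b2 = - \<gamma> - \<gamma>'" using \<gamma>(1) by algebra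
  have "f z * ((deriv q z + a1 * q z + a2) * f z - (b1 - a1 * \<gamma> - \<gamma>' * q z)) = 0" for z
    using ode[of z] unfolding f2 eq b2 \<gamma>(2)[symmetric] by (simp add: power2_eq_square algebra_simps)
  moreover have "entire (\<lambda>z. (deriv q z + a1 * q z + a2) * f z - (b1 - a1 * \<gamma> - \<gamma>' * q z))"
    using q f_entire by (intro holomorphic_intros entire_deriv)
  ultimately have "(deriv q z + a1 * q z + a2) * f z - (b1 - a1 * \<gamma> - \<gamma>' * q z) = 0"
    using cancel_f by blast
  then show ?thesis by simp
qed

text \<open>
  Near a point where the entire function \<open>q\<close> is large and does not grow too fast, \<open>f'/f\<close> stays close to
  the large number \<open>q z0\<close> while \<open>1/f\<close> stays moderate on a disc of radius much larger than \<open>1/|q z0|\<close>.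
  This forces \<open>1/f z0\<close> to be exponentially small, so \<open>q' + a1 q + a2\<close> is negligible at \<open>z0\<close>.
\<close>

lemma q_deriv_bound:
  assumes q: "entire q" and eq: "\<And>z. deriv f z = \<gamma> + q z * f z"
    and \<gamma>: "\<gamma> + \<gamma>' = - b2" "\<gamma> * \<gamma>' = b3"
    and cases: "\<gamma>' \<noteq> 0 \<or> \<gamma> = 0 \<or> b1 = a1 * \<gamma>"
  shows "\<exists>M C. \<forall>z0 N. N \<ge> M \<longrightarrow> norm (q z0) = N ^ 8 \<longrightarrow>
    (\<forall>z\<in>cball z0 (1 / N). norm (q z) \<le> K0 * N ^ 8) \<longrightarrow> norm (deriv q z0) \<le> norm a1 * N ^ 8 + C * N ^ 4"
proof -
  define \<kappa> where "\<kappa> = b1 - a1 * \<gamma>"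
  define D where "D = (\<lambda>z. deriv q z + a1 * q z + a2)"
  have rel: "D z * f z = \<kappa> - \<gamma>' * q z" for z
    unfolding D_def \<kappa>_def by (rule q_relation[OF q eq \<gamma>])
  define K where "K = max K0 1"
  have K: "K \<ge> 1" "K \<ge> K0" by (auto simp: K_def)
  define C2 where "C2 = 2 * K + norm a1 * K + norm a2"
  have C2: "C2 \<ge> 0" using K by (simp add: C2_def)
  have "\<exists>M \<ge> 1. \<forall>z0 N. N \<ge> M \<longrightarrow> norm (q z0) = N ^ 8 \<longrightarrow>
    (\<forall>z\<in>cball z0 (1 / N). norm (q z) \<le> K * N ^ 8) \<longrightarrow> norm (D z0) \<le> 1"
  proof (cases "\<gamma>' = 0 \<and> \<kappa> = 0")
    case True
    have "entire D" unfolding D_def using q by (intro holomorphic_intros entire_deriv)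
    moreover have "f z * D z = 0" for z using rel[of z] True by (simp add: mult.commute)
    ultimately have "D z = 0" for z using cancel_f by blast
    then show ?thesis by (intro exI[of _ 1]) auto
  next
    case False
    \<comment> \<open>\<open>1/f = D/(\<kappa> - \<gamma>' q)\<close> is \<open>O(N)\<close> if \<open>\<gamma>' \<noteq> 0\<close>; otherwise it is \<open>O(N ^ 9)\<close>, but then \<open>f'/f = q\<close>.\<close>
    have "\<exists>C3 M. C3 > 0 \<and> M \<ge> 1 \<and> (\<forall>N d Q. N \<ge> M \<longrightarrow> norm Q \<ge> 7 / 8 * N ^ 8 \<longrightarrow> norm d \<le> C2 * N ^ 9 \<longrightarrow>
      \<kappa> - \<gamma>' * Q \<noteq> 0 \<and> norm (d / (\<kappa> - \<gamma>' * Q)) \<le> C3 * N ^ 9 \<and> norm (\<gamma> * (d / (\<kappa> - \<gamma>' * Q))) \<le> N ^ 8 / 8)"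
    proof (cases "\<gamma>' = 0")
      case True
      then have g0: "\<gamma> = 0" and k0: "\<kappa> \<noteq> 0" using False cases by (auto simp: \<kappa>_def)
      show ?thesis
      proof (intro exI conjI allI impI)
        show "C2 / norm \<kappa> + 1 > 0" using C2 k0 by (intro add_nonneg_pos) auto
        show "(1::real) \<ge> 1" by simp
        fix N :: real and d Q :: complex
        assume N: "N \<ge> 1" and d: "norm d \<le> C2 * N ^ 9"
        show "\<kappa> - \<gamma>' * Q \<noteq> 0" using True k0 by simp
        have "norm (d / \<kappa>) \<le> C2 * N ^ 9 / norm \<kappa>" unfolding norm_divide using d by (rule divide_right_mono) simp
        also have "\<dots> \<le> (C2 / norm \<kappa> + 1) * N ^ 9" using N by (simp add: algebra_simps)
        finally show "norm (d / (\<kappa> - \<gamma>' * Q)) \<le> (C2 / norm \<kappa> + 1) * N ^ 9" using True by simp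
        show "norm (\<gamma> * (d / (\<kappa> - \<gamma>' * Q))) \<le> N ^ 8 / 8" using g0 N by simp
      qed
    next
      case g': False
      define M where "M = 1 + 3 * norm \<kappa> / norm \<gamma>' + 16 * C2 * norm \<gamma> / norm \<gamma>'"
      have M: "M \<ge> 1" "M \<ge> 3 * norm \<kappa> / norm \<gamma>'" "M \<ge> 16 * C2 * norm \<gamma> / norm \<gamma>'"
        using C2 by (auto simp: M_def intro: add_nonneg_nonneg)
      show ?thesis
      proof (intro exI conjI allI impI)
        show "2 * C2 / norm \<gamma>' + 1 > 0" using C2 g' by (intro add_nonneg_pos) auto
        show "M \<ge> 1" by (rule M)
        fix N :: real and d Q :: complex
        assume N: "N \<ge> M" and Q: "norm Q \<ge> 7 / 8 * N ^ 8" and d: "norm d \<le> C2 * N ^ 9"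
        have N1: "N \<ge> 1" using N M by simp
        have N8: "N \<le> N ^ 8" "N \<le> N ^ 7" using N1 by (simp_all add: self_le_power)
        have "3 * norm \<kappa> / norm \<gamma>' \<le> N ^ 8" using N M N8 by linarith
        then have k: "3 * norm \<kappa> \<le> norm \<gamma>' * N ^ 8" using g' by (simp add: divide_le_eq mult.commute)
        have "norm \<gamma>' * (7 / 8 * N ^ 8) \<le> norm (\<gamma>' * Q)" unfolding norm_mult using Q by (intro mult_left_mono) auto
        moreover have "norm (\<gamma>' * Q) - norm \<kappa> \<le> norm (\<kappa> - \<gamma>' * Q)"
          using norm_triangle_ineq2[of "\<gamma>' * Q" \<kappa>] by (simp add: norm_minus_commute)
        moreover have "norm \<gamma>' * (7 / 8 * N ^ 8) = 7 / 8 * (norm \<gamma>' * N ^ 8)" by simp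
        moreover have "norm \<gamma>' * N ^ 8 \<ge> 0" using N1 by simp
        ultimately have low: "norm \<gamma>' * N ^ 8 / 2 \<le> norm (\<kappa> - \<gamma>' * Q)" using k by linarith
        have lowpos: "norm \<gamma>' * N ^ 8 / 2 > 0" using g' N1 by simp
        then show "\<kappa> - \<gamma>' * Q \<noteq> 0" using low by auto
        have "norm (d / (\<kappa> - \<gamma>' * Q)) \<le> C2 * N ^ 9 / (norm \<gamma>' * N ^ 8 / 2)"
          unfolding norm_divide using d low lowpos C2 N1 by (intro frac_le) auto
        also have "\<dots> = 2 * C2 / norm \<gamma>' * N"
          using N1 g' by (simp add: field_simps power_Suc[of N 8, symmetric] del: power_Suc)
        finally have dq: "norm (d / (\<kappa> - \<gamma>' * Q)) \<le> 2 * C2 / norm \<gamma>' * N" .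
        also have "\<dots> \<le> (2 * C2 / norm \<gamma>' + 1) * N ^ 9"
          using C2 N1 by (intro mult_mono) (auto simp: self_le_power)
        finally show "norm (d / (\<kappa> - \<gamma>' * Q)) \<le> (2 * C2 / norm \<gamma>' + 1) * N ^ 9" .
        have "norm (\<gamma> * (d / (\<kappa> - \<gamma>' * Q))) \<le> norm \<gamma> * (2 * C2 / norm \<gamma>' * N)"
          unfolding norm_mult using dq by (intro mult_left_mono) auto
        also have "\<dots> = (16 * C2 * norm \<gamma> / norm \<gamma>') * N / 8" by simp
        also have "\<dots> \<le> N ^ 7 * N / 8" using M N N8 N1 by (intro divide_right_mono mult_right_mono) auto
        also have "\<dots> = N ^ 8 / 8" by (simp add: power_Suc2[symmetric] del: power_Suc2)
        finally show "norm (\<gamma> * (d / (\<kappa> - \<gamma>' * Q))) \<le> N ^ 8 / 8" .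
      qed
    qed
    then obtain C3 M1 where C3: "C3 > 0" and M1: "M1 \<ge> 1" and est:
      "\<And>N d Q. N \<ge> M1 \<Longrightarrow> norm Q \<ge> 7 / 8 * N ^ 8 \<Longrightarrow> norm d \<le> C2 * N ^ 9 \<Longrightarrow>
      \<kappa> - \<gamma>' * Q \<noteq> 0 \<and> norm (d / (\<kappa> - \<gamma>' * Q)) \<le> C3 * N ^ 9 \<and> norm (\<gamma> * (d / (\<kappa> - \<gamma>' * Q))) \<le> N ^ 8 / 8"
      by meson
    define k where "k = norm \<kappa>"
    define g where "g = norm \<gamma>'"
    have kg: "k \<ge> 0" "g \<ge> 0" by (auto simp: k_def g_def)
    have "\<forall>\<^sub>F N in at_top. (k + g * N ^ 8) * (C3 * N ^ 9 * exp (- (N ^ 7 / (32 * K)))) < 1"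
    proof -
      have "((\<lambda>N. (k + g * N ^ 8) * (C3 * N ^ 9 * exp (- (N ^ 7 / (32 * K))))) \<longlongrightarrow> 0) at_top"
        using K C3 by real_asymp
      then show ?thesis by (auto simp: order_tendsto_iff)
    qed
    then obtain M2 where M2: "\<And>N. N \<ge> M2 \<Longrightarrow> (k + g * N ^ 8) * (C3 * N ^ 9 * exp (- (N ^ 7 / (32 * K)))) < 1"
      unfolding eventually_at_top_linorder by blast
    show ?thesis
    proof (rule exI[of _ "max M1 M2"], intro conjI allI impI)
      show "max M1 M2 \<ge> 1" using M1 by simp
      fix z0 N
      assume N: "N \<ge> max M1 M2" and m: "norm (q z0) = N ^ 8"
        and bd: "\<forall>z\<in>cball z0 (1 / N). norm (q z) \<le> K * N ^ 8"
      have N1: "N \<ge> 1" using N M1 by simp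
      \<comment> \<open>On this disc \<open>q\<close> varies by at most \<open>|q z0| / 8\<close>.
        With \<open>|q z0| = N ^ 8\<close>, the gain \<open>exp (- |q z0| r / 2)\<close> is
        \<open>exp (- N ^ 7 / (32 K))\<close>, which outweighs every power of
        \<open>N\<close>.\<close>
      define r where "r = 1 / (16 * K * N)"
      have r: "r \<ge> 0" using K N1 by (simp add: r_def)
      have "r \<le> 1 / (2 * N)" unfolding r_def using K N1 by (intro divide_left_mono) auto
      moreover have "1 / (2 * N) \<le> 1 / N" using N1 by (intro divide_left_mono) auto
      ultimately have sub: "cball z0 r \<subseteq> cball z0 (1 / (2 * N))" "cball z0 r \<subseteq> cball z0 (1 / N)"
        by (auto simp: subset_cball)
      note lb = local_bounds[OF q N1 K(1), of z0, OF bd[rule_format]]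
      have loc: "f z \<noteq> 0 \<and> norm (deriv f z / f z - q z0) \<le> norm (q z0) / 2 \<and> norm (1 / f z) \<le> C3 * N ^ 9"
        if z: "z \<in> cball z0 r" for z
      proof -
        have q1: "norm (deriv q z) \<le> 2 * K * N ^ 9" using lb(1) sub z by blast
        have q2: "norm (q z - q z0) \<le> N ^ 8 / 8" using lb(2) z by (simp add: r_def)
        have "norm (q z0) - norm (q z) \<le> norm (q z - q z0)" by (metis norm_minus_commute norm_triangle_ineq2)
        then have q3: "norm (q z) \<ge> 7 / 8 * N ^ 8" using q2 m by linarith
        have "norm (q z) \<le> K * N ^ 8" using bd sub z by blast
        also have "\<dots> \<le> K * N ^ 9" using N1 K by (intro mult_left_mono power_increasing) auto
        finally have q4: "norm (q z) \<le> K * N ^ 9" .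
        have "norm (D z) \<le> norm (deriv q z) + norm a1 * norm (q z) + norm a2"
          unfolding D_def by (metis norm_mult norm_triangle_le norm_triangle_ineq add_mono order_refl)
        also have "\<dots> \<le> 2 * K * N ^ 9 + norm a1 * (K * N ^ 9) + norm a2 * N ^ 9"
          using q1 q4 N1 mult_left_mono[of 1 "N ^ 9" "norm a2"] by (intro add_mono mult_left_mono) auto
        also have "\<dots> = C2 * N ^ 9" by (simp add: C2_def algebra_simps)
        finally have Dz: "norm (D z) \<le> C2 * N ^ 9" .
        have e: "\<kappa> - \<gamma>' * q z \<noteq> 0" "norm (D z / (\<kappa> - \<gamma>' * q z)) \<le> C3 * N ^ 9"
          "norm (\<gamma> * (D z / (\<kappa> - \<gamma>' * q z))) \<le> N ^ 8 / 8"
          using est[OF _ q3 Dz] N by auto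
        have fz: "f z \<noteq> 0" using rel[of z] e(1) by auto
        have v: "1 / f z = D z / (\<kappa> - \<gamma>' * q z)" using rel[of z] fz e(1) by (simp add: field_simps)
        have "deriv f z / f z - q z0 = (q z - q z0) + \<gamma> * (1 / f z)" using fz by (simp add: eq field_simps)
        then have "norm (deriv f z / f z - q z0) \<le> norm (q z - q z0) + norm (\<gamma> * (1 / f z))" by (metis norm_triangle_ineq)
        also have "\<dots> \<le> N ^ 8 / 8 + N ^ 8 / 8" using q2 e(3) unfolding v by (rule add_mono)
        also have "\<dots> \<le> norm (q z0) / 2" using m N1 by simp
        finally show ?thesis using fz e(2) unfolding v by blast
      qed
      have "norm (1 / f z0) \<le> C3 * N ^ 9 * exp (- norm (q z0) * r / 2)"
        by (rule nonvanishing_lower_bound[OF f_entire r _ loc]) (use C3 N1 in auto)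
      also have "- norm (q z0) * r / 2 = - (N ^ 7 / (32 * K))"
        using N1 K by (simp add: m r_def field_simps power_Suc[of N 7, symmetric] del: power_Suc)
      finally have v0: "norm (1 / f z0) \<le> C3 * N ^ 9 * exp (- (N ^ 7 / (32 * K)))" .
      have f0: "f z0 \<noteq> 0" using loc[of z0] r by simp
      have "D z0 = (\<kappa> - \<gamma>' * q z0) * (1 / f z0)" using rel[of z0] f0 by (simp add: field_simps)
      then have "norm (D z0) = norm (\<kappa> - \<gamma>' * q z0) * norm (1 / f z0)" by (simp only: norm_mult)
      also have "\<dots> \<le> (k + g * N ^ 8) * (C3 * N ^ 9 * exp (- (N ^ 7 / (32 * K))))"
      proof (rule mult_mono[OF _ v0])
        show "norm (\<kappa> - \<gamma>' * q z0) \<le> k + g * N ^ 8"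
          using norm_triangle_ineq4[of \<kappa> "\<gamma>' * q z0"] by (simp add: norm_mult m k_def g_def)
      qed (use kg N1 in auto)
      also have "\<dots> < 1" using M2 N by simp
      finally show "norm (D z0) \<le> 1" by simp
    qed
  qed
  then obtain M where M: "M \<ge> 1" "\<And>z0 N. N \<ge> M \<Longrightarrow> norm (q z0) = N ^ 8 \<Longrightarrow>
    (\<forall>z\<in>cball z0 (1 / N). norm (q z) \<le> K * N ^ 8) \<Longrightarrow> norm (D z0) \<le> 1" by blast
  show ?thesis
  proof (rule exI[of _ M], rule exI[of _ "norm a2 + 1"], intro allI impI)
    fix z0 N
    assume N: "N \<ge> M" and m: "norm (q z0) = N ^ 8" and bd: "\<forall>z\<in>cball z0 (1 / N). norm (q z) \<le> K0 * N ^ 8"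
    have N1: "N \<ge> 1" using N M by simp
    have "K0 * N ^ 8 \<le> K * N ^ 8" using K N1 by (intro mult_right_mono) auto
    then have "norm (D z0) \<le> 1" using bd by (intro M(2)[OF N m]) (meson order_trans)
    moreover have "deriv q z0 = D z0 - a1 * q z0 - a2" by (simp add: D_def)
    then have "norm (deriv q z0) \<le> norm (D z0) + norm a1 * norm (q z0) + norm a2"
      by (metis norm_mult norm_triangle_ineq4 order_trans add_right_mono)
    moreover have "norm a2 + 1 \<le> (norm a2 + 1) * N ^ 4"
      using N1 mult_left_mono[of 1 "N ^ 4" "norm a2 + 1"] by simp
    ultimately show "norm (deriv q z0) \<le> norm a1 * N ^ 8 + (norm a2 + 1) * N ^ 4"
      using m by simp
  qed
qed

text \<open>For \<open>a1 = 0\<close>, \<open>q\<close> is a polynomial and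
  \<open>q_relation\<close> becomes a polynomial relation for \<open>f\<close>. Transcendence gives
  \<open>q' = - a2\<close>, so \<open>q\<close> is affine. For \<open>a1\<close> nonzero,
  \<open>q\<close> has exponential type and \<open>f'' = q f' + q' f\<close>.\<close>

lemma conclusion_of_q:
  assumes q: "entire q" and eq: "\<And>z. deriv f z = \<gamma> + q z * f z"
    and \<gamma>: "\<gamma> + \<gamma>' = - b2" "\<gamma> * \<gamma>' = b3"
    and cases: "\<gamma>' \<noteq> 0 \<or> \<gamma> = 0 \<or> b1 = a1 * \<gamma>"
  shows conclusion
proof (cases "a1 = 0")
  case True
  have "\<exists>p. q = poly p"
    by (rule polynomial_of_deriv_bound[OF q]) (use q_deriv_bound[OF assms] True in simp)
  then obtain p where p: "q = poly p" by blast
  have dq: "deriv q z = poly (pderiv p) z" for z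
    unfolding p by (intro DERIV_imp_deriv poly_DERIV)
  have "(poly (pderiv p) z + a2) * f z = b1 - \<gamma>' * q z" for z
    using q_relation[OF q eq \<gamma>, of z] unfolding dq True by simp
  then have "poly (pderiv p + [:a2:]) z * f z = poly ([:b1:] - smult \<gamma>' p) z" for z
    by (simp add: p)
  from transcendental_poly_relation[OF transcendental this]
  have "pderiv p + [:a2:] = 0" by blast
  then have "poly (pderiv p + [:a2:]) z = 0" for z by simp
  then have dq': "deriv q z = - a2" for z by (simp add: dq eq_neg_iff_add_eq_0)
  have "((\<lambda>z. q z + a2 * z) has_field_derivative 0) (at z)" for z
    using entire_has_deriv[OF q, of z] dq'[of z] by (auto intro!: derivative_eq_intros)
  then obtain c0 where "\<And>z. q z + a2 * z = c0" using deriv_zero_imp_const by blast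
  then have "q z = - a2 * z + c0" for z by (metis add.commute add_diff_cancel_right' diff_conv_add_uminus mult_minus_left)
  then show ?thesis using eq by (intro conclusion_of_first_order[of \<gamma> "- a2" c0]) simp
next
  case False
  have "\<exists>K c. c > 0 \<and> (\<forall>z. norm (q z) \<le> K * exp (c * norm z))"
    by (rule exp_type_of_deriv_bound[OF q norm_ge_zero[of a1]]) (rule q_deriv_bound[OF assms])
  then obtain K c where Kc: "c > 0" "\<And>z. norm (q z) \<le> K * exp (c * norm z)" by blast
  have K: "K \<ge> 0" using Kc(2)[of 0] by (simp add: order_trans[OF norm_ge_zero])
  have q': "norm (deriv q z) \<le> K * exp c * exp (c * norm z)" for z
  proof -
    have "norm (deriv q z) \<le> K * exp (c * (norm z + 1)) / 1"
    proof (rule deriv_bound_Cauchy(1)[OF q])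
      fix x assume "norm (z - x) = 1"
      then have "norm x \<le> norm z + 1" using norm_triangle_sub[of x z] by (simp add: norm_minus_commute)
      then have "K * exp (c * norm x) \<le> K * exp (c * (norm z + 1))" using K Kc by (intro mult_left_mono) auto
      then show "norm (q x) \<le> K * exp (c * (norm z + 1))" using Kc(2)[of x] by linarith
    qed simp
    then show ?thesis by (simp add: algebra_simps exp_add)
  qed
  have "((\<lambda>z. \<gamma> + q z * f z) has_field_derivative deriv q z * f z + q z * deriv f z) (at z)" for z
    by (rule derivative_eq_intros f_deriv entire_has_deriv[OF q] refl)+ (simp add: algebra_simps)
  moreover have "deriv f = (\<lambda>z. \<gamma> + q z * f z)" using eq by blast
  ultimately have f2: "deriv (deriv f) z = q z * deriv f z + deriv q z * f z + 0" for z
    by (metis DERIV_imp_deriv add.commute add.right_neutral)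
  show ?thesis
  proof (rule conclusion_of_linear_exp[OF False Kc(1) _ q' f2])
    fix z :: complex
    have "K * 1 \<le> K * exp c" using K Kc by (intro mult_left_mono) auto
    then have "K * exp (c * norm z) \<le> K * exp c * exp (c * norm z)" by (intro mult_right_mono) auto
    then show "norm (q z) \<le> K * exp c * exp (c * norm z)" using Kc(2)[of z] by linarith
  qed
qed

end

subsection \<open>Zeros with two values of the derivative\<close>

lemma quadratic_root_bound:
  fixes x b c :: complex
  assumes "x\<^sup>2 + b * x + c = 0"
  shows "norm x \<le> norm b + norm c + 1"
proof (rule ccontr)
  assume neg: "\<not> ?thesis"
  then have x: "norm x > norm b + norm c + 1" by simp
  then have x1: "norm x \<ge> 1" using norm_ge_zero[of b] norm_ge_zero[of c] by linarith
  have "x * x = - (b * x + c)" using assms by algebra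
  then have "norm x * norm x = norm (b * x + c)" by (metis norm_minus_cancel norm_mult)
  also have "\<dots> \<le> norm b * norm x + norm c" by (metis norm_mult norm_triangle_ineq)
  also have "\<dots> \<le> norm b * norm x + norm c * norm x"
    using x1 mult_left_mono[of 1 "norm x" "norm c"] by simp
  also have "\<dots> = (norm b + norm c) * norm x" by (simp add: algebra_simps)
  also have "\<dots> < norm x * norm x" using x x1 by (intro mult_strict_right_mono) auto
  finally show False by simp
qed

text \<open>\<open>x\<close> stands for \<open>|f'/f|\<close> and \<open>y\<close> for
  \<open>|1/f|\<close>. After the bound on \<open>y\<close> is inserted, each term is controlled by
  \<open>N ^ 8\<close>, \<open>N x\<close> or \<open>x^2 / N ^ 8\<close>, the form that
  \<open>self_bound_sqrt\<close> can resolve.\<close>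

lemma quadratic_log_deriv_bound:
  fixes x y N K a C3 D :: real
  assumes xy: "x \<ge> 0" "y \<ge> 0" and N: "N \<ge> 1" and nonneg: "K \<ge> 0" "a \<ge> 0" "C3 \<ge> 0" "D \<ge> 0"
    and y: "y \<le> D * (N + x / N ^ 8)"
    and x: "x\<^sup>2 \<le> K * N ^ 8 + a + C3 * (x + y + x * y + y\<^sup>2)"
    and large: "N \<ge> 2 * (K + a + C3 * (1 + 3 * D + 4 * D\<^sup>2))"
  shows "x \<le> (2 * (K + a + C3 * (1 + 3 * D + 4 * D\<^sup>2)) + 1) * N ^ 4"
proof (rule self_bound_sqrt[OF xy(1) N large])
  have N8: "N ^ 8 \<ge> 1" "N ^ 8 \<ge> N\<^sup>2" "N ^ 8 \<ge> N" "N\<^sup>2 \<ge> N"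
    using N by (auto simp: self_le_power intro!: power_increasing)
  define e where "e = x / N ^ 8"
  have e: "e \<ge> 0" "e \<le> x" using xy N8 by (auto simp: e_def divide_le_eq mult_left_le mult_le_cancel_left1)
  have ex: "e * x = x\<^sup>2 / N ^ 8" by (simp add: e_def power2_eq_square)
  have e2: "e\<^sup>2 \<le> x\<^sup>2 / N ^ 8"
    unfolding power2_eq_square[of e] using mult_left_mono[OF e(2) e(1)] ex by simp
  have y1: "y \<le> D * N + D * e" using y by (simp add: e_def algebra_simps)
  have "y\<^sup>2 \<le> (D * N + D * e)\<^sup>2" using y1 xy by (intro power_mono) auto
  also have "\<dots> \<le> 2 * D\<^sup>2 * N\<^sup>2 + 2 * D\<^sup>2 * e\<^sup>2"
    using zero_le_power2[of "D * N - D * e"] by (simp add: power2_eq_square algebra_simps)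
  also have "\<dots> \<le> 2 * D\<^sup>2 * N ^ 8 + 2 * D\<^sup>2 * (x\<^sup>2 / N ^ 8)"
    using N8 e2 by (intro add_mono mult_left_mono) auto
  finally have y2: "y\<^sup>2 \<le> 2 * (D\<^sup>2 * N ^ 8) + 2 * (D\<^sup>2 * (x\<^sup>2 / N ^ 8))" by simp
  have "x * y \<le> x * (D * N + D * e)" using y1 xy by (intro mult_left_mono) auto
  then have xy': "x * y \<le> D * (N * x) + D * (x\<^sup>2 / N ^ 8)" using ex by (simp add: algebra_simps)
  have xN: "x \<le> N * x" using xy N mult_right_mono[of 1 N x] by simp
  have Dn: "D * N \<le> D * N ^ 8" "D * e \<le> D * (N * x)"
    using nonneg N8 e xN by (auto intro!: mult_left_mono)
  define P where "P = x\<^sup>2 / N ^ 8"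
  define Q where "Q = N ^ 8"
  define R where "R = N * x"
  have PQR: "P \<ge> 0" "Q \<ge> 0" "R \<ge> 0" using N xy by (auto simp: P_def Q_def R_def)
  have "x + y + x * y + y\<^sup>2 \<le> R + (D * Q + D * R) + (D * R + D * P) + (2 * (D\<^sup>2 * Q) + 2 * (D\<^sup>2 * P))"
    using xN y1 Dn xy' y2 unfolding P_def[symmetric] unfolding Q_def[symmetric] R_def[symmetric] by linarith
  also have "\<dots> \<le> (1 + 3 * D + 4 * D\<^sup>2) * (Q + R + P)"
  proof -
    have "(1 + 3 * D + 4 * D\<^sup>2) * (Q + R + P) - (R + (D * Q + D * R) + (D * R + D * P) + (2 * (D\<^sup>2 * Q) + 2 * (D\<^sup>2 * P)))
      = Q + P + 2 * (D * Q) + D * R + 2 * (D * P) + 2 * (D\<^sup>2 * Q) + 4 * (D\<^sup>2 * R) + 2 * (D\<^sup>2 * P)"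
      by (simp add: algebra_simps)
    also have "\<dots> \<ge> 0" using PQR nonneg by simp
    finally show ?thesis by simp
  qed
  finally have "C3 * (x + y + x * y + y\<^sup>2) \<le> C3 * ((1 + 3 * D + 4 * D\<^sup>2) * (Q + R + P))"
    using nonneg by (intro mult_left_mono) auto
  moreover have "K * N ^ 8 \<le> K * (Q + R + P)" using PQR nonneg by (intro mult_left_mono) (auto simp: Q_def)
  moreover have "a \<le> a * (Q + R + P)"
    using mult_left_mono[of 1 "Q + R + P" a] N8 PQR nonneg by (simp add: Q_def)
  ultimately have "x\<^sup>2 \<le> (K + a + C3 * (1 + 3 * D + 4 * D\<^sup>2)) * (Q + R + P)"
    using x by (simp add: algebra_simps)
  moreover have "c * (Q + R + P) = c * N ^ 8 + c * N * x + c * x\<^sup>2 / N ^ 8" for c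
    by (simp add: P_def Q_def R_def algebra_simps)
  ultimately show "x\<^sup>2 \<le> (K + a + C3 * (1 + 3 * D + 4 * D\<^sup>2)) * N ^ 8 + (K + a + C3 * (1 + 3 * D + 4 * D\<^sup>2)) * N * x
      + (K + a + C3 * (1 + 3 * D + 4 * D\<^sup>2)) * x\<^sup>2 / N ^ 8"
    by simp
  show "0 \<le> K + a + C3 * (1 + 3 * D + 4 * D\<^sup>2)" using nonneg by simp
qed

text \<open>
  The constants make \<open>f'' - A f' - B\<close> vanish at the simple zeros of \<open>f\<close>, where \<open>f'\<close> is a root of
  \<open>x\<^sup>2 + b2 x + b3\<close>; \<open>h\<close> is the quotient by \<open>f\<close>.
\<close>

locale hayman_ode_h = hayman_ode +
  fixes h :: "complex \<Rightarrow> complex" and A B :: complex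
  assumes h: "entire h"
    and eqh: "\<And>z. deriv (deriv f) z = A * deriv f z + h z * f z + B"
    and A: "A * b3 = - b1 * b2 - a1 * (b2\<^sup>2 - b3)"
    and B: "B = - b1 - a1 * b2"
begin

text \<open>\<open>k0\<close>, \<open>l0\<close> and \<open>X\<close> are the coefficients left when
  \<open>(A - a1)\<close> times the equation is subtracted from its derivative, \<open>f''\<close>
  and \<open>f'''\<close> are eliminated through \<open>eqh\<close>, and a factor \<open>f\<close>
  is cancelled.\<close>

definition k0 :: complex where "k0 = - (a1\<^sup>2 + a1 * A + 2 * a2)"
definition l0 :: complex where "l0 = - 2 * a1 * B - b1 * (A - a1)"
definition X :: "complex \<Rightarrow> complex" where "X z = deriv h z + 2 * a1 * h z - (A - a1) * a2"

lemma X_entire: "entire X"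
  unfolding X_def[abs_def] using h by (intro holomorphic_intros entire_deriv)

lemma X_relation: "X z * f z = k0 * deriv f z + l0 + b2 * h z"
proof -
  have f3: "deriv (deriv (deriv f)) z = A * deriv (deriv f) z + (deriv h z * f z + h z * deriv f z)" for z
  proof -
    have "((\<lambda>z. A * deriv f z + h z * f z + B) has_field_derivative
        A * deriv (deriv f) z + (deriv h z * f z + h z * deriv f z)) (at z)"
      by (rule derivative_eq_intros f_deriv f_deriv2 entire_has_deriv[OF h] refl)+ (simp add: algebra_simps)
    moreover have "deriv (deriv f) = (\<lambda>z. A * deriv f z + h z * f z + B)" using eqh by blast
    ultimately show ?thesis by (metis DERIV_imp_deriv)
  qed
  have alg: "f0 * ((h' + 2 * a1 * hh - (A - a1) * a2) * f0 - (k0 * f1 + l0 + b2 * hh)) = 0"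
    if o: "f2 * f0 - f1\<^sup>2 + a1 * f1 * f0 + a2 * f0\<^sup>2 = b1 * f0 + b2 * f1 + b3"
    and d: "f0 * f3 - f1 * f2 + a1 * (f0 * f2 + f1 * f1) + 2 * a2 * f0 * f1 - b1 * f1 - b2 * f2 = 0"
    and f2: "f2 = A * f1 + hh * f0 + B" and f3: "f3 = A * f2 + (h' * f0 + hh * f1)" for f0 f1 f2 f3 hh h'
  proof -
    \<comment> \<open>Among the terms of this combination without a factor \<open>f\<close>, the
      choice of \<open>B\<close> removes the multiple of \<open>f'\<close>, and the last bracket,
      which vanishes by the condition on \<open>A\<close>, is the remaining constant.\<close>
    have "f0 * ((h' + 2 * a1 * hh - (A - a1) * a2) * f0 - (k0 * f1 + l0 + b2 * hh)) =
      (f0 * f3 - f1 * f2 + a1 * (f0 * f2 + f1 * f1) + 2 * a2 * f0 * f1 - b1 * f1 - b2 * f2)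
      - (A - a1) * (f2 * f0 - f1\<^sup>2 + a1 * f1 * f0 + a2 * f0\<^sup>2 - (b1 * f0 + b2 * f1 + b3))
      - (A * b3 - (- b1 * b2 - a1 * (b2\<^sup>2 - b3)))"
      unfolding k0_def l0_def unfolding f3 f2 unfolding B by (simp add: power2_eq_square algebra_simps)
    then show ?thesis using o d A by simp
  qed
  have "f z * (X z * f z - (k0 * deriv f z + l0 + b2 * h z)) = 0" for z
    unfolding X_def by (rule alg[OF ode ode_deriv1 eqh f3])
  moreover have "entire (\<lambda>z. X z * f z - (k0 * deriv f z + l0 + b2 * h z))"
    using h f_entire X_entire by (intro holomorphic_intros entire_deriv)
  ultimately have "X z * f z - (k0 * deriv f z + l0 + b2 * h z) = 0" using cancel_f by blast
  then show ?thesis by simp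
qed

text \<open>The equation with \<open>f''\<close> eliminated. At zeros of \<open>f\<close> it is the
  quadratic equation for \<open>f'\<close>; divided by \<open>f^2\<close> it compares
  \<open>(f'/f)^2\<close> with \<open>h\<close>.\<close>

lemma energy:
  "(deriv f z)\<^sup>2 + b2 * deriv f z + b3 = (h z + a2) * (f z)\<^sup>2 + (A + a1) * f z * deriv f z + (B - b1) * f z"
  using ode[of z] unfolding eqh by (simp add: power2_eq_square algebra_simps)

lemma conclusion_of_h_exp:
  assumes a1: "a1 \<noteq> 0" and hb: "\<exists>K c. c > 0 \<and> (\<forall>z. norm (h z) \<le> K * exp (c * norm z))"
  shows conclusion
proof -
  obtain K c where c: "c > 0" and K: "\<And>z. norm (h z) \<le> K * exp (c * norm z)" using hb by blast
  show ?thesis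
  proof (rule conclusion_of_linear_exp[OF a1 c _ _ eqh])
    fix z :: complex
    have e1: "exp (c * norm z) \<ge> 1" using c by simp
    have "norm A * 1 \<le> (\<bar>K\<bar> + norm A) * exp (c * norm z)" using e1 by (intro mult_mono) auto
    then show "norm A \<le> (\<bar>K\<bar> + norm A) * exp (c * norm z)" by simp
    have "K \<le> \<bar>K\<bar> + norm A" using abs_ge_self[of K] norm_ge_zero[of A] by linarith
    then have "K * exp (c * norm z) \<le> (\<bar>K\<bar> + norm A) * exp (c * norm z)" by (rule mult_right_mono) simp
    then show "norm (h z) \<le> (\<bar>K\<bar> + norm A) * exp (c * norm z)" using K[of z] by linarith
  qed
qed

text \<open>With \<open>X = 0\<close>, \<open>h\<close> solves a first-order linear equation with
  constant coefficients. For \<open>a1 = 0\<close> the assumption \<open>c0\<close> makes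
  \<open>h\<close> constant; otherwise \<open>h\<close> has exponential type.\<close>

lemma conclusion_of_X_zero:
  assumes X0: "\<And>z. X z = 0" and c0: "a1 = 0 \<Longrightarrow> (A - a1) * a2 = 0"
  shows conclusion
proof (cases "a1 = 0")
  case True
  have "deriv h z + 2 * a1 * h z - (A - a1) * a2 = 0" for z
    using X0[of z] unfolding X_def .
  then have "deriv h z = 0" for z using c0[OF True] True by simp
  then have "(h has_field_derivative 0) (at z)" for z
    using entire_has_deriv[OF h, of z] by simp
  then obtain c where "\<And>z. h z = c" using deriv_zero_imp_const by blast
  then show ?thesis using eqh by (intro conclusion_of_linear_const[of A c B]) simp
next
  case False
  have "\<exists>K c. c > 0 \<and> (\<forall>z. norm (h z) \<le> K * exp (c * norm z))"
  proof (rule exp_type_of_deriv_bound[OF h, of "2 * norm a1"])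
    fix K
    show "\<exists>M C. \<forall>z0 N. N \<ge> M \<longrightarrow> norm (h z0) = N ^ 8 \<longrightarrow>
      (\<forall>z\<in>cball z0 (1 / N). norm (h z) \<le> K * N ^ 8) \<longrightarrow> norm (deriv h z0) \<le> 2 * norm a1 * N ^ 8 + C * N ^ 4"
    proof (rule exI[of _ 1], rule exI[of _ "norm ((A - a1) * a2)"], intro allI impI)
      fix z0 and N :: real assume N: "N \<ge> 1" and m: "norm (h z0) = N ^ 8"
      have "deriv h z0 = (A - a1) * a2 - 2 * a1 * h z0" using X0[of z0] by (simp add: X_def algebra_simps)
      then have "norm (deriv h z0) \<le> norm ((A - a1) * a2) + norm (2 * a1 * h z0)" by (metis norm_triangle_ineq4)
      moreover have "norm ((A - a1) * a2) * 1 \<le> norm ((A - a1) * a2) * N ^ 4"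
        using N by (intro mult_left_mono) auto
      moreover have "norm (2 * a1 * h z0) = 2 * norm a1 * N ^ 8" by (simp add: norm_mult m)
      ultimately show "norm (deriv h z0) \<le> 2 * norm a1 * N ^ 8 + norm ((A - a1) * a2) * N ^ 4" by linarith
    qed
  qed simp
  then show ?thesis by (rule conclusion_of_h_exp[OF False])
qed

text \<open>
  At a zero of \<open>f\<close> the function \<open>h\<close> takes one of finitely many values, so \<open>f\<close> has no zeros near a point where
  \<open>h\<close> is large. There \<open>(f'/f)\<^sup>2\<close> is close to \<open>h\<close>, which again forces \<open>1/f\<close> to be exponentially small.
\<close>

lemma h_deriv_bound:
  assumes b2: "b2 \<noteq> 0"
  shows "\<exists>M C. \<forall>z0 N. N \<ge> M \<longrightarrow> norm (h z0) = N ^ 8 \<longrightarrow>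
    (\<forall>z\<in>cball z0 (1 / N). norm (h z) \<le> K0 * N ^ 8) \<longrightarrow> norm (deriv h z0) \<le> 2 * norm a1 * N ^ 8 + C * N ^ 4"
proof -
  define K where "K = max K0 1"
  have K: "K \<ge> 1" "K \<ge> K0" by (auto simp: K_def)
  have norm3: "norm (x + y - z) \<le> norm x + norm y + norm z" for x y z :: complex
    by (meson norm_triangle_ineq4 norm_triangle_ineq order_trans add_right_mono)
  define c0 where "c0 = (A - a1) * a2"
  \<comment> \<open>These constants give, on the small disc, \<open>|X| <= CX N ^ 9\<close>,
    \<open>|f'/f| <= C4 N ^ 4\<close>, \<open>|1/f| <= C6 N\<close> and
    \<open>|(f'/f)^2 - h| <= C7 N ^ 5\<close>. \<open>D\<close> arises from solving
    \<open>X_relation\<close> for \<open>1/f\<close>, and \<open>C3\<close> collects coefficients of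
    \<open>energy\<close>.\<close>
  define CX where "CX = 2 * K + 2 * norm a1 * K + norm c0"
  define D where "D = 2 * (CX + norm k0) / norm b2"
  define C3 where "C3 = norm (A + a1) + norm (B - b1) + norm b2 + norm b3"
  define C5 where "C5 = K + norm a2 + C3 * (1 + 3 * D + 4 * D\<^sup>2)"
  define C4 where "C4 = 2 * C5 + 1"
  define C6 where "C6 = D * (1 + C4)"
  define C7 where "C7 = norm a2 + C3 * (C4 + C6 + C4 * C6 + C6\<^sup>2)"
  have CX: "CX \<ge> 0" using K by (simp add: CX_def)
  have D: "D \<ge> 0" using CX by (simp add: D_def)
  have C3: "C3 \<ge> 0" by (simp add: C3_def)
  have C5: "C5 \<ge> 0" using K C3 D by (simp add: C5_def)
  have C4: "C4 \<ge> 1" using C5 by (simp add: C4_def)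
  have C6: "C6 \<ge> 0" using D C4 by (simp add: C6_def)
  have C7: "C7 \<ge> 0" using C3 C4 C6 by (simp add: C7_def)
  define G where "G = norm b2 + norm b3 + 1"
  \<comment> \<open>Beyond this threshold \<open>b2 h\<close> dominates \<open>l0\<close> and the
    value of \<open>k0 f'\<close> at a zero of \<open>f\<close>, the bound on \<open>|f'/f|\<close>
    closes up, and \<open>C7 N ^ 5\<close> is at most \<open>N ^ 8 / 16\<close>.\<close>
  define M1 where "M1 = 1 + 4 * (norm l0 + norm k0 * G) / norm b2 + 2 * C5 + 16 * C7"
  have "4 * (norm l0 + norm k0 * G) / norm b2 \<ge> 0" by (simp add: G_def)
  then have M1: "M1 \<ge> 1" "M1 \<ge> 4 * (norm l0 + norm k0 * G) / norm b2" "M1 \<ge> 2 * C5" "M1 \<ge> 16 * C7"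
    using C5 C7 unfolding M1_def by linarith+
  define l where "l = norm l0"
  define b where "b = norm b2"
  have lb: "l \<ge> 0" "b \<ge> 0" by (auto simp: l_def b_def)
  have "\<forall>\<^sub>F N in at_top. (l + b * N ^ 8) * ((C6 + 1) * N * exp (- (N ^ 3 / (64 * K)))) < 1"
  proof -
    have "((\<lambda>N. (l + b * N ^ 8) * ((C6 + 1) * N * exp (- (N ^ 3 / (64 * K))))) \<longlongrightarrow> 0) at_top"
      using K by real_asymp
    then show ?thesis by (auto simp: order_tendsto_iff)
  qed
  then obtain M2 where M2: "\<And>N. N \<ge> M2 \<Longrightarrow> (l + b * N ^ 8) * ((C6 + 1) * N * exp (- (N ^ 3 / (64 * K)))) < 1"
    unfolding eventually_at_top_linorder by blast
  show ?thesis
  proof (rule exI[of _ "max M1 M2"], rule exI[of _ "norm k0 * C4 + 1 + norm c0"], intro allI impI)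
    fix z0 N
    assume N: "N \<ge> max M1 M2" and m: "norm (h z0) = N ^ 8"
      and bd0: "\<forall>z\<in>cball z0 (1 / N). norm (h z) \<le> K0 * N ^ 8"
    have N1: "N \<ge> 1" and NM: "N \<ge> M1" using N M1 by auto
    have "K0 * N ^ 8 \<le> K * N ^ 8" using K N1 by (intro mult_right_mono) auto
    then have bd: "norm (h z) \<le> K * N ^ 8" if "z \<in> cball z0 (1 / N)" for z using bd0 that by (meson order_trans)
    have pw: "N \<le> N ^ 8" "N \<le> N ^ 3" "N ^ 8 \<le> N ^ 9" "N ^ 8 \<ge> 1"
      using N1 by (auto simp: self_le_power intro!: power_increasing)
    have Gl: "norm l0 + norm k0 * G \<le> norm b2 * N ^ 8 / 4"
    proof -
      have "4 * (norm l0 + norm k0 * G) / norm b2 \<le> N ^ 8" using M1 NM pw by linarith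
      then have "4 * (norm l0 + norm k0 * G) \<le> N ^ 8 * norm b2" using b2 by (simp add: divide_le_eq)
      then show ?thesis by (simp add: mult.commute)
    qed
    have kG: "norm k0 * G \<ge> 0" by (simp add: G_def)
    define r where "r = 1 / (16 * K * N)"
    have r: "r \<ge> 0" using K N1 by (simp add: r_def)
    have "r \<le> 1 / (2 * N)" unfolding r_def using K N1 by (intro divide_left_mono) auto
    moreover have "1 / (2 * N) \<le> 1 / N" using N1 by (intro divide_left_mono) auto
    ultimately have sub: "cball z0 r \<subseteq> cball z0 (1 / (2 * N))" "cball z0 r \<subseteq> cball z0 (1 / N)"
      by (auto simp: subset_cball)
    note lbs = local_bounds[OF h N1 K(1) bd]
    define w where "w = (\<lambda>z. deriv f z / f z)"
    have loc: "f z \<noteq> 0 \<and> norm (w z) \<le> C4 * N ^ 4 \<and> norm (1 / f z) \<le> C6 * N \<and> norm ((w z)\<^sup>2 - h z) \<le> N ^ 8 / 16"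
      if z: "z \<in> cball z0 r" for z
    proof -
      have h1: "norm (deriv h z) \<le> 2 * K * N ^ 9" using lbs(1) sub z by blast
      have h2: "norm (h z - h z0) \<le> N ^ 8 / 8" using lbs(2) z by (simp add: r_def)
      have "norm (h z0) - norm (h z) \<le> norm (h z - h z0)" by (metis norm_minus_commute norm_triangle_ineq2)
      then have h3: "norm (h z) \<ge> 7 / 8 * N ^ 8" using h2 m by linarith
      have h4: "norm (h z) \<le> K * N ^ 8" using bd sub z by blast
      have "norm b2 * (7 / 8 * N ^ 8) \<le> norm b2 * norm (h z)" using h3 by (rule mult_left_mono) simp
      moreover have "norm b2 * (7 / 8 * N ^ 8) = 7 / 8 * (norm b2 * N ^ 8)" by simp
      moreover have "norm b2 * N ^ 8 > 0" using b2 N1 by simp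
      ultimately have bh: "norm (b2 * h z) \<ge> 7 / 8 * (norm b2 * N ^ 8)" "norm b2 * N ^ 8 > 0"
        by (simp_all add: norm_mult)
      have "norm (b2 * h z) - norm l0 \<le> norm (b2 * h z + l0)" by (rule norm_diff_ineq)
      then have low: "norm (l0 + b2 * h z) \<ge> norm b2 * N ^ 8 / 2"
        using bh Gl kG by (simp add: add.commute)
      have fz: "f z \<noteq> 0"
      proof
        assume 0: "f z = 0"
        have "(deriv f z)\<^sup>2 + b2 * deriv f z + b3 = 0" using energy[of z] 0 by simp
        then have "norm (deriv f z) \<le> G" unfolding G_def by (rule quadratic_root_bound)
        then have "norm (k0 * deriv f z) \<le> norm k0 * G" unfolding norm_mult by (rule mult_left_mono) simp
        moreover have "l0 + b2 * h z = - (k0 * deriv f z)" using X_relation[of z] 0 by (simp add: eq_neg_iff_add_eq_0 algebra_simps)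
        ultimately have "norm b2 * N ^ 8 / 2 \<le> norm k0 * G" using low by simp
        then show False using Gl bh(2) norm_ge_zero[of l0] by linarith
      qed
      define v where "v = 1 / f z"
      define x where "x = norm (w z)"
      define y where "y = norm v"
      have "norm (X z) \<le> norm (deriv h z) + norm (2 * a1 * h z) + norm c0"
        unfolding X_def c0_def by (rule norm3)
      also have "\<dots> \<le> 2 * K * N ^ 9 + 2 * norm a1 * (K * N ^ 9) + norm c0 * N ^ 9"
      proof (intro add_mono h1)
        have "K * N ^ 8 \<le> K * N ^ 9" using pw K by (intro mult_left_mono) auto
        then have "norm (h z) \<le> K * N ^ 9" using h4 by linarith
        then have "2 * norm a1 * norm (h z) \<le> 2 * norm a1 * (K * N ^ 9)" by (rule mult_left_mono) simp
        then show "norm (2 * a1 * h z) \<le> 2 * norm a1 * (K * N ^ 9)" by (simp add: norm_mult)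
        show "norm c0 \<le> norm c0 * N ^ 9" using mult_left_mono[of 1 "N ^ 9" "norm c0"] pw by simp
      qed
      also have "\<dots> = CX * N ^ 9" by (simp add: CX_def algebra_simps)
      finally have Xb: "norm (X z) \<le> CX * N ^ 9" .
      have Xv: "X z = k0 * w z + (l0 + b2 * h z) * v"
        using X_relation[of z] fz by (simp add: w_def v_def field_simps)
      then have "(l0 + b2 * h z) * v = X z - k0 * w z" by simp
      then have "norm (l0 + b2 * h z) * y \<le> norm (X z) + norm k0 * x"
        unfolding y_def x_def by (metis norm_mult norm_triangle_ineq4)
      moreover have "norm b2 * N ^ 8 / 2 * y \<le> norm (l0 + b2 * h z) * y"
        using low by (rule mult_right_mono) (simp add: y_def)
      ultimately have "norm b2 * N ^ 8 / 2 * y \<le> CX * N ^ 9 + norm k0 * x" using Xb by linarith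
      also have "\<dots> \<le> (CX + norm k0) * (N ^ 9 + x)"
      proof -
        have "0 \<le> CX * x" "0 \<le> norm k0 * N ^ 9" using CX N1 by (auto simp: x_def)
        then show ?thesis by (simp add: algebra_simps)
      qed
      finally have "y \<le> (CX + norm k0) * (N ^ 9 + x) / (norm b2 * N ^ 8 / 2)"
        using bh(2) by (simp add: le_divide_eq mult.commute)
      also have "\<dots> = D * (N + x / N ^ 8)"
        using N1 b2 by (simp add: D_def field_simps power_Suc[of N 8, symmetric] del: power_Suc)
      finally have yb: "y \<le> D * (N + x / N ^ 8)" .
      have wq: "(w z)\<^sup>2 - h z = a2 + (A + a1) * w z + (B - b1) * v - b2 * v * w z - b3 * v\<^sup>2"
      proof -
        have gen: "W\<^sup>2 - H = a2 + (A + a1) * W + (B - b1) * V - b2 * V * W - b3 * V\<^sup>2"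
          if "F * V = 1" "(W * F)\<^sup>2 + b2 * (W * F) + b3 = (H + a2) * F\<^sup>2 + (A + a1) * F * (W * F) + (B - b1) * F"
          for F V W H :: complex
          using that by algebra
        have "w z * f z = deriv f z" "f z * v = 1" using fz by (simp_all add: w_def v_def)
        then show ?thesis using gen[of "f z" v "w z" "h z"] energy[of z] by simp
      qed
      have "norm ((w z)\<^sup>2 - h z) \<le> norm a2 + norm ((A + a1) * w z) + norm ((B - b1) * v) + norm (b2 * v * w z) + norm (b3 * v\<^sup>2)"
        unfolding wq by norm
      also have "\<dots> = norm a2 + norm (A + a1) * x + norm (B - b1) * y + norm b2 * (x * y) + norm b3 * y\<^sup>2"
        by (simp add: norm_mult norm_power x_def y_def)
      also have "\<dots> \<le> norm a2 + C3 * x + C3 * y + C3 * (x * y) + C3 * y\<^sup>2"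
        by (intro add_mono mult_right_mono order_refl) (auto simp: C3_def x_def y_def)
      also have "\<dots> = norm a2 + C3 * (x + y + x * y + y\<^sup>2)" by (simp add: algebra_simps)
      finally have wh: "norm ((w z)\<^sup>2 - h z) \<le> norm a2 + C3 * (x + y + x * y + y\<^sup>2)" .
      have "x\<^sup>2 \<le> norm (h z) + norm ((w z)\<^sup>2 - h z)"
        unfolding x_def norm_power[symmetric] by (rule norm_triangle_sub)
      then have x2: "x\<^sup>2 \<le> K * N ^ 8 + norm a2 + C3 * (x + y + x * y + y\<^sup>2)" using wh h4 by linarith
      have xb: "x \<le> C4 * N ^ 4"
        unfolding C4_def C5_def
        by (rule quadratic_log_deriv_bound[OF _ _ N1 _ _ C3 D yb x2]) (use K M1 NM in \<open>auto simp: x_def y_def C5_def\<close>)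
      have "x / N ^ 8 \<le> C4 * N"
      proof -
        have "C4 * N ^ 4 \<le> C4 * N ^ 8" using C4 N1 by (intro mult_left_mono power_increasing) auto
        then have "x \<le> C4 * N ^ 8" using xb by linarith
        then have "x / N ^ 8 \<le> C4" using N1 by (simp add: divide_le_eq)
        also have "\<dots> \<le> C4 * N" using C4 N1 mult_left_mono[of 1 N C4] by simp
        finally show ?thesis .
      qed
      then have "D * (N + x / N ^ 8) \<le> D * (N + C4 * N)" using D by (intro mult_left_mono) auto
      then have yb': "y \<le> C6 * N" using yb by (simp add: C6_def algebra_simps)
      have "norm a2 + C3 * (x + y + x * y + y\<^sup>2) \<le> norm a2 * N ^ 5 + C3 * (C4 * N ^ 5 + C6 * N ^ 5 + C4 * C6 * N ^ 5 + C6\<^sup>2 * N ^ 5)"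
      proof (intro add_mono mult_left_mono)
        have N5: "1 \<le> N ^ 5" "N ^ 4 \<le> N ^ 5" "N \<le> N ^ 5" "N\<^sup>2 \<le> N ^ 5"
          using N1 by (auto simp: self_le_power intro!: power_increasing)
        show "norm a2 \<le> norm a2 * N ^ 5" using mult_left_mono[OF N5(1), of "norm a2"] by simp
        show "x \<le> C4 * N ^ 5" using xb mult_left_mono[OF N5(2), of C4] C4 by linarith
        show "y \<le> C6 * N ^ 5" using yb' mult_left_mono[OF N5(3), of C6] C6 by linarith
        have "x * y \<le> (C4 * N ^ 4) * (C6 * N)" using xb yb' C4 N1 by (intro mult_mono) (auto simp: x_def y_def)
        also have "\<dots> = C4 * C6 * N ^ 5" by (simp add: power_Suc2[of N 4, symmetric] del: power_Suc2)
        finally show "x * y \<le> C4 * C6 * N ^ 5" .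
        have "y\<^sup>2 \<le> (C6 * N)\<^sup>2" using yb' by (intro power_mono) (auto simp: y_def)
        also have "\<dots> \<le> C6\<^sup>2 * N ^ 5" using mult_left_mono[OF N5(4), of "C6\<^sup>2"] by (simp add: power_mult_distrib)
        finally show "y\<^sup>2 \<le> C6\<^sup>2 * N ^ 5" .
      qed (use C3 in auto)
      also have "\<dots> = C7 * N ^ 5" by (simp add: C7_def algebra_simps)
      also have "\<dots> \<le> (N ^ 3 / 16) * N ^ 5"
        using M1 NM pw N1 by (intro mult_right_mono) auto
      also have "\<dots> = N ^ 8 / 16" by (simp flip: power_add)
      finally have "norm ((w z)\<^sup>2 - h z) \<le> N ^ 8 / 16" using wh by linarith
      then show ?thesis using fz xb yb' by (simp add: x_def y_def v_def)
    qed
    have z0in: "z0 \<in> cball z0 r" using r by simp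
    have w0h: "norm ((w z0)\<^sup>2 - h z0) \<le> N ^ 8 / 16" using loc[OF z0in] by blast
    have w0sq: "(norm (w z0))\<^sup>2 \<ge> 15 / 16 * N ^ 8"
    proof -
      have "norm (h z0) - norm ((w z0)\<^sup>2) \<le> norm ((w z0)\<^sup>2 - h z0)" by (metis norm_minus_commute norm_triangle_ineq2)
      then show ?thesis using w0h m by (simp add: norm_power)
    qed
    have "(N ^ 4 / 2)\<^sup>2 \<le> (norm (w z0))\<^sup>2"
      using w0sq pw(4) by (simp add: power_divide flip: power_mult)
    then have w0low: "N ^ 4 / 2 \<le> norm (w z0)" by (rule power2_le_imp_le) simp
    \<comment> \<open>The three errors \<open>N ^ 8 / 16\<close>, \<open>N ^ 8 / 8\<close>,
      \<open>N ^ 8 / 16\<close> add up to \<open>N ^ 8 / 4\<close>, below the margin of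
      \<open>near_root\<close>. So \<open>f'/f\<close> follows a single branch of the square root of
      \<open>h\<close> and is nearly constant on the disc.\<close>
    have sq: "norm ((w z)\<^sup>2 - (w z0)\<^sup>2) < 3 / 4 * (norm (w z0))\<^sup>2" if z: "z \<in> cball z0 r" for z
    proof -
      have "norm ((w z)\<^sup>2 - h z) \<le> N ^ 8 / 16" using loc[OF z] by blast
      moreover have "norm (h z - h z0) \<le> N ^ 8 / 8" using lbs(2) z by (simp add: r_def)
      moreover have "norm ((w z)\<^sup>2 - (w z0)\<^sup>2) \<le> norm ((w z)\<^sup>2 - h z) + norm (h z - h z0) + norm ((w z0)\<^sup>2 - h z0)"
      proof -
        have "(w z)\<^sup>2 - (w z0)\<^sup>2 = ((w z)\<^sup>2 - h z) + (h z - h z0) - ((w z0)\<^sup>2 - h z0)" by simp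
        then show ?thesis by (simp only: norm3)
      qed
      ultimately have "norm ((w z)\<^sup>2 - (w z0)\<^sup>2) \<le> N ^ 8 / 4" using w0h by linarith
      also have "\<dots> < 3 / 4 * (15 / 16 * N ^ 8)" using N1 by simp
      also have "\<dots> \<le> 3 / 4 * (norm (w z0))\<^sup>2" using w0sq by simp
      finally show ?thesis .
    qed
    have "continuous_on (cball z0 r) w"
      unfolding w_def using loc f_entire entire_deriv[OF f_entire]
      by (intro continuous_intros holomorphic_on_imp_continuous_on) (auto intro: holomorphic_on_subset)
    from near_root[OF this r sq]
    have near: "norm (w z - w z0) \<le> norm (w z0) / 2" if "z \<in> cball z0 r" for z using that by blast
    have v0: "norm (1 / f z0) \<le> (C6 + 1) * N * exp (- norm (w z0) * r / 2)"
    proof (rule nonvanishing_lower_bound[OF f_entire r])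
      show "(C6 + 1) * N > 0" using C6 N1 by simp
      fix z assume z: "z \<in> cball z0 r"
      have "C6 * N \<le> (C6 + 1) * N" using N1 by (intro mult_right_mono) auto
      then show "f z \<noteq> 0 \<and> norm (deriv f z / f z - w z0) \<le> norm (w z0) / 2 \<and> norm (1 / f z) \<le> (C6 + 1) * N"
        using loc[OF z] near[OF z] by (auto simp: w_def)
    qed
    have "N ^ 4 / 2 * (r / 2) \<le> norm (w z0) * (r / 2)" using w0low r by (intro mult_right_mono) auto
    moreover have "N ^ 4 / 2 * (r / 2) = N ^ 3 / (64 * K)"
      using N1 K by (simp add: r_def field_simps power_Suc[of N 3, symmetric] del: power_Suc)
    moreover have "- norm (w z0) * r / 2 = - (norm (w z0) * (r / 2))" by simp
    ultimately have "- norm (w z0) * r / 2 \<le> - (N ^ 3 / (64 * K))" by linarith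
    then have "(C6 + 1) * N * exp (- norm (w z0) * r / 2) \<le> (C6 + 1) * N * exp (- (N ^ 3 / (64 * K)))"
      using C6 N1 by (intro mult_left_mono) auto
    then have v0': "norm (1 / f z0) \<le> (C6 + 1) * N * exp (- (N ^ 3 / (64 * K)))" using v0 by linarith
    have "X z0 = k0 * w z0 + (l0 + b2 * h z0) * (1 / f z0)"
      using X_relation[of z0] loc[OF z0in] by (simp add: w_def field_simps)
    then have "norm (X z0) \<le> norm k0 * norm (w z0) + norm (l0 + b2 * h z0) * norm (1 / f z0)"
      by (metis norm_mult norm_triangle_ineq)
    also have "\<dots> \<le> norm k0 * (C4 * N ^ 4) + (l + b * N ^ 8) * ((C6 + 1) * N * exp (- (N ^ 3 / (64 * K))))"
    proof (intro add_mono mult_mono v0')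
      show "norm (w z0) \<le> C4 * N ^ 4" using loc[OF z0in] by blast
      show "norm (l0 + b2 * h z0) \<le> l + b * N ^ 8"
        using norm_triangle_ineq[of l0 "b2 * h z0"] by (simp add: norm_mult m l_def b_def)
    qed (use lb N1 C4 C6 in auto)
    also have "\<dots> \<le> norm k0 * (C4 * N ^ 4) + 1" using M2[of N] N by simp
    finally have X0: "norm (X z0) \<le> norm k0 * (C4 * N ^ 4) + 1" .
    have "deriv h z0 = X z0 + c0 - 2 * a1 * h z0" by (simp add: X_def c0_def)
    then have "norm (deriv h z0) \<le> norm (X z0) + norm c0 + norm (2 * a1 * h z0)" by (simp only: norm3)
    moreover have "norm (2 * a1 * h z0) = 2 * norm a1 * N ^ 8" by (simp add: norm_mult m)
    moreover have "1 + norm c0 \<le> (1 + norm c0) * N ^ 4"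
      using N1 mult_left_mono[of 1 "N ^ 4" "1 + norm c0"] by simp
    ultimately show "norm (deriv h z0) \<le> 2 * norm a1 * N ^ 8 + (norm k0 * C4 + 1 + norm c0) * N ^ 4"
      using X0 by (simp add: algebra_simps)
  qed
qed

text \<open>Eliminating \<open>f'\<close> between \<open>X_relation\<close> and its derivative gives
  \<open>den f = num\<close> with polynomials, so both vanish. In \<open>num\<close> the product of
  \<open>p\<close> and \<open>yp\<close> has too high a degree unless \<open>yp = 0\<close>; then
  \<open>den\<close> reduces to a multiple of \<open>k0^2 p\<close>, so \<open>k0 = 0\<close>. With
  \<open>a1 = 0\<close> this gives \<open>a2 = 0\<close>, and \<open>h' = 0\<close> follows.\<close>

lemma h_poly_const:
  assumes b2: "b2 \<noteq> 0" and a1: "a1 = 0" and p: "h = poly p"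
  shows "degree p = 0"
proof (rule ccontr)
  assume deg: "degree p \<noteq> 0"
  define c0 where "c0 = A * a2"
  define xp where "xp = pderiv p - [:c0:]"
  have dh: "deriv h z = poly (pderiv p) z" for z
    unfolding p by (intro DERIV_imp_deriv poly_DERIV)
  have "X z = poly xp z" for z
    unfolding X_def dh xp_def c0_def using a1 by simp
  then have Xp: "X = poly xp" by blast
  have rel: "X z * f z = k0 * deriv f z + l0 + b2 * h z" for z by (rule X_relation)
  have rel': "deriv X z * f z + X z * deriv f z = k0 * deriv (deriv f) z + b2 * deriv h z" for z
  proof -
    have "((\<lambda>z. X z * f z) has_field_derivative deriv X z * f z + X z * deriv f z) (at z)"
      by (rule derivative_eq_intros f_deriv entire_has_deriv[OF X_entire] refl)+ (simp add: algebra_simps)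
    moreover have "((\<lambda>z. k0 * deriv f z + l0 + b2 * h z) has_field_derivative k0 * deriv (deriv f) z + b2 * deriv h z) (at z)"
      by (rule derivative_eq_intros f_deriv2 entire_has_deriv[OF h] refl)+ simp
    ultimately show ?thesis unfolding rel by (rule DERIV_unique)
  qed
  have dX: "deriv X z = poly (pderiv xp) z" for z
    unfolding Xp by (intro DERIV_imp_deriv poly_DERIV)
  \<comment> \<open>\<open>X - k0 A\<close> is the coefficient of \<open>f'\<close> in the
    derivative of \<open>X_relation\<close> once \<open>f''\<close> is replaced; it multiplies the
    relation itself in the elimination.\<close>
  define yp where "yp = xp - [:k0 * A:]"
  define num where "num = ([:l0:] + smult b2 p) * yp + smult k0 ([:k0 * B:] + smult b2 (pderiv p))"
  define den where "den = xp * yp + smult k0 (pderiv xp - smult k0 p)"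
  have "poly den z * f z = poly num z" for z
  proof -
    have alg: "(x * (x - k * a) + k * (x' - k * hh)) * f0 = (l + b * hh) * (x - k * a) + k * (k * bb + b * h')"
      if r1: "x * f0 = k * f1 + l + b * hh" and r2: "x' * f0 + x * f1 = k * (a * f1 + hh * f0 + bb) + b * h'"
      for x x' k a hh h' f0 f1 l b bb :: complex
      using that by algebra
    have r2: "poly (pderiv xp) z * f z + poly xp z * deriv f z = k0 * (A * deriv f z + poly p z * f z + B) + b2 * poly (pderiv p) z"
      using rel'[of z] unfolding dX dh eqh unfolding Xp unfolding p .
    have r1: "poly xp z * f z = k0 * deriv f z + l0 + b2 * poly p z"
      using rel[of z] unfolding Xp unfolding p .
    from alg[OF r1 r2] show ?thesis
      by (simp add: den_def num_def yp_def mult.commute)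
  qed
  from transcendental_poly_relation[OF transcendental this] have den0: "den = 0" and num0: "num = 0" by auto
  have "yp = 0"
  proof (rule ccontr)
    assume yp: "yp \<noteq> 0"
    have p0: "p \<noteq> 0" using deg by auto
    have "smult b2 p * yp = - (smult l0 yp + smult k0 ([:k0 * B:] + smult b2 (pderiv p)))"
      using num0 by (simp add: num_def algebra_simps eq_neg_iff_add_eq_0)
    then have "degree (smult b2 p * yp) = degree (smult l0 yp + smult k0 ([:k0 * B:] + smult b2 (pderiv p)))"
      by (metis degree_minus)
    also have "\<dots> \<le> max (degree yp) (degree p - 1)"
    proof (rule degree_add_le)
      show "degree (smult l0 yp) \<le> max (degree yp) (degree p - 1)"
        using degree_smult_le[of l0 yp] by simp
      have "degree (smult k0 ([:k0 * B:] + smult b2 (pderiv p))) \<le> degree ([:k0 * B:] + smult b2 (pderiv p))"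
        by (rule degree_smult_le)
      also have "\<dots> \<le> degree p - 1"
        by (rule degree_add_le) (use degree_smult_le[of b2 "pderiv p"] in \<open>auto simp: degree_pderiv\<close>)
      finally show "degree (smult k0 ([:k0 * B:] + smult b2 (pderiv p))) \<le> max (degree yp) (degree p - 1)" by simp
    qed
    also have "degree (smult b2 p * yp) = degree p + degree yp"
      using b2 p0 yp by (simp add: degree_mult_eq)
    finally show False using deg by simp
  qed
  then have xp: "xp = [:k0 * A:]" by (simp add: yp_def)
  have "smult (k0 * k0) p = 0" using den0 \<open>yp = 0\<close> by (simp add: den_def xp)
  then have k: "k0 = 0" using deg by auto
  then have "a1\<^sup>2 + a1 * A + 2 * a2 = 0" unfolding k0_def by (simp only: neg_equal_0_iff_equal)
  then have "a2 = 0" using a1 by simp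
  then have "pderiv p = 0" using xp k by (simp add: xp_def c0_def)
  then show False using deg by (simp add: pderiv_eq_0_iff)
qed

lemma conclusion_of_h:
  assumes b2: "b2 \<noteq> 0"
  shows conclusion
proof (cases "a1 = 0")
  case True
  have "\<exists>p. h = poly p"
    by (rule polynomial_of_deriv_bound[OF h]) (use h_deriv_bound[OF b2] True in simp)
  then obtain p where p: "h = poly p" by blast
  from h_poly_const[OF b2 True p] obtain c where "p = [:c:]" by (rule degree_eq_zeroE)
  then have "h z = c" for z by (simp add: p)
  then show ?thesis using eqh by (intro conclusion_of_linear_const[of A c B]) simp
next
  case False
  show ?thesis
    by (rule conclusion_of_h_exp[OF False exp_type_of_deriv_bound[OF h _ h_deriv_bound[OF b2]]]) simp
qed

end

section \<open>Case distinction on the zeros of the solution\<close>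

context hayman_ode
begin

lemma simple_zeros:
  assumes "b2 \<noteq> 0 \<or> b3 \<noteq> 0" "f z = 0"
  shows "deriv f z \<noteq> 0" "(deriv f z)\<^sup>2 + b2 * deriv f z + b3 = 0"
proof -
  show "deriv f z \<noteq> 0"
  proof
    assume "deriv f z = 0"
    show False by (rule multiple_zero[OF assms(2) \<open>deriv f z = 0\<close>]) (use assms(1) in simp)
  qed
  show "(deriv f z)\<^sup>2 + b2 * deriv f z + b3 = 0"   proof -
    have "- (deriv f z)\<^sup>2 = b2 * deriv f z + b3" using ode[of z] assms(2) by simp
    then show ?thesis by (simp add: add.assoc neg_eq_iff_add_eq_0)
  qed
qed

text \<open>All zeros are simple and \<open>f' - \<gamma>\<close> vanishes at each of them, so
  \<open>q = (f' - \<gamma>) / f\<close> is entire. The last assumption serves the degenerate case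
  \<open>\<gamma>' = 0\<close>, in which \<open>1/f\<close> is harder to control.\<close>

lemma conclusion_of_single_zero_type:
  assumes simple: "b2 \<noteq> 0 \<or> b3 \<noteq> 0"
    and zeros: "\<And>z. f z = 0 \<Longrightarrow> deriv f z = \<gamma>"
    and \<gamma>: "\<gamma> + \<gamma>' = - b2" "\<gamma> * \<gamma>' = b3"
    and cases: "\<gamma>' \<noteq> 0 \<or> \<gamma> = 0 \<or> (\<exists>z. f z = 0)"
  shows conclusion
proof -
  obtain z1 where z1: "f z1 \<noteq> 0" using transcendental_nonzero[OF transcendental] .
  have ent: "entire (\<lambda>z. deriv f z - \<gamma>)" using f_entire by (intro holomorphic_intros entire_deriv)
  have "deriv f z - \<gamma> = 0 \<and> deriv f z \<noteq> 0" if "f z = 0" for z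
    using zeros[OF that] simple_zeros(1)[OF simple that] by simp
  from entire_quotient_simple[OF f_entire z1 ent this]
  obtain q where q: "entire q" "\<And>z. deriv f z - \<gamma> = q z * f z" by blast
  have eq: "deriv f z = \<gamma> + q z * f z" for z using q(2)[of z] by (simp add: algebra_simps)
  have "\<gamma>' \<noteq> 0 \<or> \<gamma> = 0 \<or> b1 = a1 * \<gamma>"
  proof (cases "\<gamma>' = 0 \<and> (\<exists>z. f z = 0)")
    case True
    then obtain z where "f z = 0" by blast
    \<comment> \<open>At a zero of \<open>f\<close> with \<open>\<gamma>' = 0\<close> the relation
      reduces to \<open>0 = b1 - a1 \<gamma>\<close>.\<close>
    then show ?thesis using q_relation[OF q(1) eq \<gamma>, of z] True by simp
  qed (use cases in blast)
  then show ?thesis by (rule conclusion_of_q[OF q(1) eq \<gamma>])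
qed

lemma conclusion_zero_free:
  assumes zf: "\<And>z. f z \<noteq> 0" and b3: "b3 = 0"
  shows conclusion
proof (rule conclusion_of_q[of "\<lambda>z. deriv f z / f z" 0 "- b2"])
  show "entire (\<lambda>z. deriv f z / f z)" using zf f_entire by (intro holomorphic_intros entire_deriv) auto
qed (use zf b3 in auto)

text \<open>With \<open>g = f'\<close> at the zero, the differentiated equation reads
  \<open>(g + b2) f'' = a1 g^2 - b1 g\<close>. The factor \<open>g + b2\<close> is nonzero because
  \<open>g (g + b2) = - b3\<close>; the same identity reduces the quotient to an affine function of
  \<open>g\<close>, with coefficients independent of the root.\<close>

lemma deriv2_at_simple_zero:
  assumes fz: "f z = 0" and \<gamma>: "(deriv f z)\<^sup>2 + b2 * deriv f z + b3 = 0" and b3: "b3 \<noteq> 0"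
    and A: "A * b3 = - b1 * b2 - a1 * (b2\<^sup>2 - b3)" and B: "B = - b1 - a1 * b2"
  shows "deriv (deriv f) z = A * deriv f z + B"
proof -
  define g where "g = deriv f z"
  have "g\<^sup>2 + b2 * g + b3 = 0" using \<gamma> by (simp add: g_def)
  then have g: "g * (g + b2) = - b3" by algebra
  have gb: "g + b2 \<noteq> 0" using g b3 by auto
  define g2 where "g2 = deriv (deriv f) z"
  have "- (g * g2) + a1 * (g * g) - b1 * g - b2 * g2 = 0"
    using ode_deriv1[of z] fz by (simp add: g_def g2_def)
  then have d: "(g + b2) * deriv (deriv f) z = a1 * g\<^sup>2 - b1 * g"
    unfolding g2_def[symmetric] by algebra
  have "(g + b2) * (A * g + B) = A * (g * (g + b2)) + B * (g + b2)" by (simp add: algebra_simps)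
  also have "\<dots> = - (A * b3) + B * (g + b2)" unfolding g by simp
  also have "\<dots> = a1 * g\<^sup>2 - b1 * g" unfolding A B using g by algebra
  finally have "(g + b2) * deriv (deriv f) z = (g + b2) * (A * g + B)" using d by simp
  then show ?thesis using gb by (simp add: g_def)
qed

text \<open>For \<open>b2\<close> nonzero the growth estimates for \<open>h\<close> apply. For
  \<open>b2 = 0\<close>, \<open>h\<close> drops out of the right side of \<open>X_relation\<close>;
  at the zeros this gives \<open>k0 f' + l0 = 0\<close> for two different values of
  \<open>f'\<close>, so \<open>k0 = l0 = 0\<close> and \<open>X = 0\<close>.\<close>

lemma conclusion_two_zero_types:
  assumes b3: "b3 \<noteq> 0" and z: "f z1 = 0" "f z2 = 0" "deriv f z1 \<noteq> deriv f z2"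
  shows conclusion
proof -
  define A where "A = (- b1 * b2 - a1 * (b2\<^sup>2 - b3)) / b3"
  define B where "B = - b1 - a1 * b2"
  have A: "A * b3 = - b1 * b2 - a1 * (b2\<^sup>2 - b3)" using b3 by (simp add: A_def)
  obtain w where w: "f w \<noteq> 0" using transcendental_nonzero[OF transcendental] .
  have ent: "entire (\<lambda>z. deriv (deriv f) z - A * deriv f z - B)"
    using f_entire by (intro holomorphic_intros entire_deriv)
  have "deriv (deriv f) z - A * deriv f z - B = 0 \<and> deriv f z \<noteq> 0" if "f z = 0" for z
    using deriv2_at_simple_zero[OF that _ b3 A B_def] simple_zeros[of z] b3 that by simp
  from entire_quotient_simple[OF f_entire w ent this]
  obtain h where h: "entire h" "\<And>z. deriv (deriv f) z - A * deriv f z - B = h z * f z" by blast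
  have eqh: "deriv (deriv f) z = A * deriv f z + h z * f z + B" for z
    using h(2)[of z] by (simp add: algebra_simps)
  interpret hayman_ode_h f a1 a2 b1 b2 b3 h A B
    by unfold_locales (use h eqh A B_def in auto)
  show ?thesis
  proof (cases "b2 = 0")
    case False
    then show ?thesis by (rule conclusion_of_h)
  next
    case True
    have "k0 * deriv f z1 + l0 = 0" "k0 * deriv f z2 + l0 = 0"
      using X_relation[of z1] X_relation[of z2] z True by auto
    then have "k0 * (deriv f z1 - deriv f z2) = 0" by algebra
    then have "k0 = 0" using z(3) by simp
    moreover from this have "l0 = 0" using \<open>k0 * deriv f z1 + l0 = 0\<close> by simp
    ultimately have "f z * X z = 0" for z using X_relation[of z] True by (simp add: mult.commute)
    then have X0: "X z = 0" for z using cancel_f[OF X_entire] by blast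
    show ?thesis
    proof (rule conclusion_of_X_zero[OF X0])
      assume "a1 = 0"
      then have "A * b3 = 0" using A True by simp
      then show "(A - a1) * a2 = 0" using b3 \<open>a1 = 0\<close> by simp
    qed
  qed
qed

text \<open>Every zero is double with \<open>f'' = - b1\<close> and \<open>f''' = 3 a1 f''\<close>,
  so \<open>f'' - 3 a1 f' + b1\<close> vanishes there to second order and is divisible by
  \<open>f\<close>.\<close>

lemma conclusion_double_zeros:
  assumes b: "b2 = 0" "b3 = 0" and z0: "f z0 = 0"
  shows conclusion
proof -
  have dz: "deriv f z = 0" if "f z = 0" for z using ode[of z] that b by simp
  define N where "N = (\<lambda>z. deriv (deriv f) z - 3 * a1 * deriv f z + b1)"
  have N: "entire N" unfolding N_def using f_entire by (intro holomorphic_intros entire_deriv)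
  have dN: "deriv N z = deriv (deriv (deriv f)) z - 3 * a1 * deriv (deriv f) z" for z
  proof (rule DERIV_imp_deriv)
    show "(N has_field_derivative deriv (deriv (deriv f)) z - 3 * a1 * deriv (deriv f) z) (at z)"
      unfolding N_def by (rule derivative_eq_intros f_deriv2 f_deriv3 refl)+ simp
  qed
  obtain w where w: "f w \<noteq> 0" using transcendental_nonzero[OF transcendental] .
  have lim: "\<exists>c. ((\<lambda>w. N w / f w) \<longlongrightarrow> c) (at z)" if fz: "f z = 0" for z
  proof -
    obtain F where F: "entire F" "F z \<noteq> 0" "\<And>w. f w = (w - z)\<^sup>2 * F w"
      "deriv (deriv f) z = - b1" "deriv (deriv (deriv f)) z = - 3 * a1 * b1"
    proof (rule multiple_zero[OF fz dz[OF fz]])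
      fix F assume "entire F" "F z \<noteq> 0" "\<And>w. f w = (w - z)\<^sup>2 * F w"
        "deriv (deriv f) z = - b1" "deriv (deriv (deriv f)) z = - 3 * a1 * b1"
      then show thesis by (rule that)
    qed
    have N0: "N z = 0" using F(4) dz[OF fz] by (simp add: N_def)
    have N0': "deriv N z = 0" using F(4,5) by (simp add: dN)
    obtain G where G: "entire G" "\<And>w. N w = (w - z) * G w" "G z = deriv N z"
      using entire_zero_factor[OF N N0] by blast
    have "G z = 0" using G(3) N0' by simp
    obtain H where H: "entire H" "\<And>w. G w = (w - z) * H w"
    proof (rule entire_zero_factor[OF G(1) \<open>G z = 0\<close>])
      fix H assume "entire H" "\<And>w. G w = (w - z) * H w"
      then show thesis by (rule that)
    qed
    have "isCont (\<lambda>w. H w / F w) z" using H(1) F(1,2) by (intro continuous_intros entire_isCont)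
    then have l: "((\<lambda>w. H w / F w) \<longlongrightarrow> H z / F z) (at z)" by (simp add: isCont_def)
    have "\<forall>\<^sub>F w in at z. w \<noteq> z" by (simp add: eventually_at_filter)
    then have "\<forall>\<^sub>F w in at z. H w / F w = N w / f w"
    proof eventually_elim
      case (elim w)
      have "N w / f w = ((w - z)\<^sup>2 * H w) / ((w - z)\<^sup>2 * F w)"
        by (simp only: G(2) H(2) F(3) power2_eq_square mult.assoc)
      then show ?case using elim by simp
    qed
    from Lim_transform_eventually[OF l this] show ?thesis by (rule exI)
  qed
  obtain h where h: "entire h" "\<And>z. N z = h z * f z"
    using entire_quotient[OF f_entire w N lim] by blast
  have eqh: "deriv (deriv f) z = 3 * a1 * deriv f z + h z * f z + - b1" for z
    using h(2)[of z] by (simp add: N_def algebra_simps)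
  \<comment> \<open>With \<open>b2 = b3 = 0\<close> the locale's condition on \<open>A\<close> reads
    \<open>0 = 0\<close>; the value \<open>3 * a1\<close> is dictated by the third derivative at the
    double zeros.\<close>
  interpret hayman_ode_h f a1 a2 b1 b2 b3 h "3 * a1" "- b1"
    by unfold_locales (use h eqh b in auto)
  have l0: "l0 = 0" unfolding l0_def by simp
  have rel: "X z * f z = k0 * deriv f z" for z using X_relation[of z] l0 b by simp
  \<comment> \<open>At the double zero \<open>z0\<close> the relation \<open>X f = k0 f'\<close>
    holds trivially. Its derivative there says \<open>0 = k0 f''\<close>, and \<open>f''\<close> is
    nonzero.\<close>
  have "((\<lambda>z. X z * f z) has_field_derivative deriv X z0 * f z0 + X z0 * deriv f z0) (at z0)"
    by (rule derivative_eq_intros f_deriv entire_has_deriv[OF X_entire] refl)+ (simp add: algebra_simps)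
  moreover have "((\<lambda>z. k0 * deriv f z) has_field_derivative k0 * deriv (deriv f) z0) (at z0)"
    by (rule derivative_eq_intros f_deriv2 refl)+ simp
  ultimately have "deriv X z0 * f z0 + X z0 * deriv f z0 = k0 * deriv (deriv f) z0"
    unfolding rel by (rule DERIV_unique)
  moreover have "deriv (deriv f) z0 \<noteq> 0"
    by (rule multiple_zero[OF z0 dz[OF z0]]) simp
  ultimately have k0: "k0 = 0" using z0 dz[OF z0] by simp
  then have "f z * X z = 0" for z using rel[of z] by (simp add: mult.commute)
  then have X0: "X z = 0" for z using cancel_f[OF X_entire] by blast
  show ?thesis
  proof (rule conclusion_of_X_zero[OF X0])
    assume "a1 = 0"
    then show "(3 * a1 - a1) * a2 = 0" by simp
  qed
qed

lemma hayman_conclusion: conclusion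
proof (cases "b3 = 0")
  case b3: True
  show ?thesis
  proof (cases "\<exists>z. f z = 0")
    case False
    then show ?thesis using conclusion_zero_free b3 by blast
  next
    case True
    show ?thesis
    proof (cases "b2 = 0")
      case True
      then show ?thesis using conclusion_double_zeros b3 \<open>\<exists>z. f z = 0\<close> by blast
    next
      case False
      have "deriv f z = - b2" if "f z = 0" for z
      proof -
        have "deriv f z * (deriv f z + b2) = 0"
          using simple_zeros(2)[of z] that False b3 by (simp add: power2_eq_square algebra_simps)
        then show ?thesis using simple_zeros(1)[of z] that False by (simp add: eq_neg_iff_add_eq_0)
      qed
      \<comment> \<open>Here the second root is 0, so the existence of a zero of \<open>f\<close>
        has to fill the last assumption of the lemma.\<close>
      then show ?thesis
        using False True b3 by (intro conclusion_of_single_zero_type[of "- b2" 0]) auto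
    qed
  qed
next
  case b3: False
  define \<gamma>\<^sub>1 where "\<gamma>\<^sub>1 = (- b2 + csqrt (b2\<^sup>2 - 4 * b3)) / 2"
  define \<gamma>\<^sub>2 where "\<gamma>\<^sub>2 = (- b2 - csqrt (b2\<^sup>2 - 4 * b3)) / 2"
  have sum: "\<gamma>\<^sub>1 + \<gamma>\<^sub>2 = - b2" by (simp add: \<gamma>\<^sub>1_def \<gamma>\<^sub>2_def field_simps)
  have "\<gamma>\<^sub>1 * \<gamma>\<^sub>2 = (b2\<^sup>2 - (csqrt (b2\<^sup>2 - 4 * b3))\<^sup>2) / 4"
    by (simp add: \<gamma>\<^sub>1_def \<gamma>\<^sub>2_def power2_eq_square algebra_simps)
  then have prod: "\<gamma>\<^sub>1 * \<gamma>\<^sub>2 = b3" by simp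
  have nz: "\<gamma>\<^sub>1 \<noteq> 0" "\<gamma>\<^sub>2 \<noteq> 0" using prod b3 by auto
  have roots: "deriv f z = \<gamma>\<^sub>1 \<or> deriv f z = \<gamma>\<^sub>2" if "f z = 0" for z
  proof -
    have "(deriv f z - \<gamma>\<^sub>1) * (deriv f z - \<gamma>\<^sub>2) = 0"
      using simple_zeros(2)[of z] that b3 sum prod by algebra
    then show ?thesis by simp
  qed
  show ?thesis
  proof (cases "\<exists>z1 z2. f z1 = 0 \<and> f z2 = 0 \<and> deriv f z1 \<noteq> deriv f z2")
    case True
    then show ?thesis using conclusion_two_zero_types b3 by blast
  next
    case False
    then consider "\<And>z. f z = 0 \<Longrightarrow> deriv f z = \<gamma>\<^sub>1" | "\<And>z. f z = 0 \<Longrightarrow> deriv f z = \<gamma>\<^sub>2"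
      using roots by metis
    then show ?thesis
    proof cases
      case 1
      then show ?thesis
        using conclusion_of_single_zero_type[of \<gamma>\<^sub>1 \<gamma>\<^sub>2] b3 sum prod nz by blast
    next
      case 2
      then show ?thesis
        using conclusion_of_single_zero_type[of \<gamma>\<^sub>2 \<gamma>\<^sub>1] b3 sum prod nz by (metis add.commute mult.commute)
    qed
  qed
qed

end

theorem mainTheorem5:
  fixes \<alpha>\<^sub>1 \<alpha>\<^sub>2 \<beta>\<^sub>1 \<beta>\<^sub>2 \<beta>\<^sub>3 :: complex and f :: "complex \<Rightarrow> complex"
  assumes "transcendental_entire f"
    and "\<And>z. deriv (deriv f) z * f z - (deriv f z)\<^sup>2 + \<alpha>\<^sub>1 * deriv f z * f z + \<alpha>\<^sub>2 * (f z)\<^sup>2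
             = \<beta>\<^sub>1 * f z + \<beta>\<^sub>2 * deriv f z + \<beta>\<^sub>3"
  shows "(growth_order f < \<infinity> \<longrightarrow> growth_order f = 1 \<or> growth_order f = 2) \<and>
         (growth_order f = \<infinity> \<longrightarrow> hyper_order f = 1)"
proof -
  interpret hayman_ode f \<alpha>\<^sub>1 \<alpha>\<^sub>2 \<beta>\<^sub>1 \<beta>\<^sub>2 \<beta>\<^sub>3
    by unfold_locales (rule assms)+
  show ?thesis by (rule hayman_conclusion)
qed

end
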